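(* Fix $\sigma>0$ and $f\in C_c^\infty((0,\infty))$. Then $$\lim_{\ell\to\infty}\frac{1}{\#\mathcal E_\ell(\sigma)}\sum_{n:\ \lambda_n(\sigma)\in \mathcal E_\ell(\sigma)} f\big(d_n(\sigma)\big)=\int_{4\sigma/\pi}^\infty f(y)\,\frac{16\sigma^2}{\pi^2 y^3\sqrt{1-\left(\frac{4\sigma}{\pi y}\right)^2}}\,dy .$$
   Context: Let $\Omega$ be the closed upper unit hemisphere in $\mathbb R^3$ with coordinates $(\sin\theta\cos\phi,\sin\theta\sin\phi,\cos\theta)$, $0\le\theta\le\pi/2$, $0\le \phi<2\pi$, and boundary the equator $\theta=\pi/2$. For a constant $\sigma\ge0$ the Robin problem is $\Delta F+\lambda F=0$ in $\Omega$, $\frac{\partial F}{\partial n}+\sigma F=0$ on $\partial\Omega$, where $\Delta$ is the Laplace-Beltrami operator and $\partial/\partial n$ the outward normal derivative ($\sigma=0$ is the Neumann problem). It separates into sectors of functions $F=e^{im\phi}f(\cos\theta)$, $m\in\mathbb Z$; since $\pm m$ give the same eigenvalues, the desymmetrized spectrum keeps only the eigenvalues of sectors with $m\ge0$ (an eigenvalue is counted once for each $m\ge 0$ for which it has a nonzero eigenfunction in sector $m$). Let $\lambda_0(\sigma)\le\lambda_1(\sigma)\le\cdots$ be the ordered desymmetrized Robin eigenvalues, repeated with multiplicity, let $\lambda_0(0)\le\lambda_1(0)\le\cdots$ be the ordered desymmetrized Neumann eigenvalues ($0<2<6=6<\cdots$; $\ell(\ell+1)$ has multiplicity $\lfloor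 \ell/2\rfloor+1$), and put $d_n(\sigma)=\lambda_n(\sigma)-\lambda_n(0)$. For integer $m\ge 0$ define $$S_m(\nu)=2\tan\left(\frac{\pi(m+\nu)}{2}\right)\frac{\Gamma\left(\frac{\nu+m}{2}+1\right)\Gamma\left(\frac{\nu-m}{2}+1\right)}{\Gamma\left(\frac{\nu+m+1}{2}\right)\Gamma\left(\frac{\nu-m+1}{2}\right)}.$$ For $\sigma>0$ and integers $0\le m\le \ell$ with $m\equiv\ell\pmod 2$, $\nu_{\ell,m}(\sigma)$ is the unique solution of $S_m(\nu)=\sigma$ in $(\ell,\ell+1)$, and $\Lambda_{\ell,m}(\sigma)=\nu_{\ell,m}(\sigma)(\nu_{\ell,m}(\sigma)+1)$. For $\sigma>0$ the desymmetrized Robin spectrum consists of the $\Lambda_{\ell,m}(\sigma)$ and is partitioned into the disjoint clusters $$\mathcal E_\ell(\sigma)=\{\Lambda_{\ell,m}(\sigma):0\le m\le\ell,\ m\equiv\ell \pmod 2\},\qquad \#\mathcal E_\ell(\sigma)=\lfloor \ell/2\rfloor+1 .$$ *)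

theory Defs
  imports "HOL-Analysis.Analysis"
begin

definition sph :: "real \<Rightarrow> real \<Rightarrow> real ^ 3" where
  "sph \<theta> \<phi> = vector [sin \<theta> * cos \<phi>, sin \<theta> * sin \<phi>, cos \<theta>]"

definition hemisphere :: "(real ^ 3) set" where
  "hemisphere = {x. norm x = 1 \<and> x $ 3 \<ge> 0}"

definition C2_on :: "(real ^ 3) set \<Rightarrow> (real ^ 3 \<Rightarrow> complex) \<Rightarrow> bool" where
  "C2_on U G \<longleftrightarrow>
     (\<exists>(G' :: real ^ 3 \<Rightarrow> (real ^ 3) \<Rightarrow>\<^sub>L complex)
       (G'' :: real ^ 3 \<Rightarrow> (real ^ 3) \<Rightarrow>\<^sub>L ((real ^ 3) \<Rightarrow>\<^sub>L complex)).
        (\<forall>x\<in>U. (G has_derivative blinfun_apply (G' x)) (at x)) \<and>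
        (\<forall>x\<in>U. (G' has_derivative blinfun_apply (G'' x)) (at x)) \<and>
        continuous_on U G'')"

text \<open>Regularity up to the boundary: only the values of \<open>F\<close> on the hemisphere matter.\<close>

definition C2_hemisphere :: "(real ^ 3 \<Rightarrow> complex) \<Rightarrow> bool" where
  "C2_hemisphere F \<longleftrightarrow>
     (\<exists>U G. open U \<and> hemisphere \<subseteq> U \<and> C2_on U G \<and> (\<forall>x\<in>hemisphere. G x = F x))"

text \<open>The Laplace--Beltrami operator of the round sphere in spherical coordinates,
  \<open>(1 / sin \<theta>) \<partial>\<^sub>\<theta> (sin \<theta> \<partial>\<^sub>\<theta> F) + (1 / sin\<^sup>2 \<theta>) \<partial>\<^sub>\<phi>\<^sup>2 F\<close>,
  evaluated at the point \<open>sph \<theta> \<phi>\<close>. It is meaningful away from the pole \<open>\<theta> = 0\<close>.\<close>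

definition laplace_beltrami :: "(real ^ 3 \<Rightarrow> complex) \<Rightarrow> real \<Rightarrow> real \<Rightarrow> complex" where
  "laplace_beltrami F \<theta> \<phi> =
     vector_derivative
       (\<lambda>s. sin s *\<^sub>R vector_derivative (\<lambda>t. F (sph t \<phi>)) (at s)) (at \<theta>) /\<^sub>R sin \<theta>
     + vector_derivative
       (\<lambda>s. vector_derivative (\<lambda>t. F (sph \<theta> t)) (at s)) (at \<phi>) /\<^sub>R (sin \<theta>)\<^sup>2"

text \<open>On the equator the outward unit normal is the direction of increasing \<open>\<theta>\<close>.\<close>

definition normal_derivative :: "(real ^ 3 \<Rightarrow> complex) \<Rightarrow> real \<Rightarrow> complex" where
  "normal_derivative F \<phi> =
     vector_derivative (\<lambda>\<theta>. F (sph \<theta> \<phi>)) (at (pi / 2) within {0..pi / 2})"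

text \<open>For a function that is \<open>C\<^sup>2\<close> on the hemisphere, the equation \<open>\<Delta> F + \<mu> F = 0\<close> at the pole
  follows by continuity from the equation at the other interior points, so it is imposed only
  there; continuity of the second derivatives at the pole excludes singular solutions.\<close>

definition robin_eigenfunction :: "real \<Rightarrow> real \<Rightarrow> (real ^ 3 \<Rightarrow> complex) \<Rightarrow> bool" where
  "robin_eigenfunction \<sigma> \<mu> F \<longleftrightarrow>
     C2_hemisphere F \<and>
     (\<exists>x\<in>hemisphere. F x \<noteq> 0) \<and>
     (\<forall>\<theta> \<phi>. 0 < \<theta> \<and> \<theta> < pi / 2 \<longrightarrow>
        laplace_beltrami F \<theta> \<phi> + of_real \<mu> * F (sph \<theta> \<phi>) = 0) \<and>
     (\<forall>\<phi>. normal_derivative F \<phi> + of_real \<sigma> * F (sph (pi / 2) \<phi>) = 0)"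

definition in_sector :: "int \<Rightarrow> (real ^ 3 \<Rightarrow> complex) \<Rightarrow> bool" where
  "in_sector m F \<longleftrightarrow>
     (\<exists>f :: real \<Rightarrow> complex. \<forall>\<theta> \<phi>. 0 \<le> \<theta> \<and> \<theta> \<le> pi / 2 \<longrightarrow>
        F (sph \<theta> \<phi>) = exp (\<i> * of_int m * of_real \<phi>) * f (cos \<theta>))"

text \<open>The desymmetrized spectrum with multiplicity: an eigenvalue \<open>\<mu>\<close> occurs once for each
  \<open>m \<ge> 0\<close> such that \<open>\<mu>\<close> has an eigenfunction in sector \<open>m\<close>.\<close>

definition desym_spectrum :: "real \<Rightarrow> (nat \<times> real) set" where
  "desym_spectrum \<sigma> =
     {(m, \<mu>). \<exists>F. robin_eigenfunction \<sigma> \<mu> F \<and> in_sector (int m) F}"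

definition desym_eigenvalue :: "real \<Rightarrow> nat \<Rightarrow> real" where
  "desym_eigenvalue \<sigma> =
     (THE s. incseq s \<and> (\<exists>e. bij_betw e UNIV (desym_spectrum \<sigma>) \<and> s = snd \<circ> e))"

definition RN_gap :: "real \<Rightarrow> nat \<Rightarrow> real" where
  "RN_gap \<sigma> n = desym_eigenvalue \<sigma> n - desym_eigenvalue 0 n"

definition S :: "nat \<Rightarrow> real \<Rightarrow> real" where
  "S m \<nu> = 2 * tan (pi * (real m + \<nu>) / 2) *
     (Gamma ((\<nu> + real m) / 2 + 1) * Gamma ((\<nu> - real m) / 2 + 1)) /
     (Gamma ((\<nu> + real m + 1) / 2) * Gamma ((\<nu> - real m + 1) / 2))"

definition nu :: "nat \<Rightarrow> nat \<Rightarrow> real \<Rightarrow> real" where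
  "nu l m \<sigma> = (THE \<nu>. real l < \<nu> \<and> \<nu> < real l + 1 \<and> S m \<nu> = \<sigma>)"

definition Lam :: "nat \<Rightarrow> nat \<Rightarrow> real \<Rightarrow> real" where
  "Lam l m \<sigma> = nu l m \<sigma> * (nu l m \<sigma> + 1)"

definition cluster :: "nat \<Rightarrow> real \<Rightarrow> real set" where
  "cluster l \<sigma> = {Lam l m \<sigma> | m. m \<le> l \<and> m mod 2 = l mod 2}"

text \<open>Elements of \<open>C\<^sub>c\<^sup>\<infinity>((0, \<infinity>))\<close>, extended by zero to the real line; complex values are allowed.\<close>

definition test_function :: "(real \<Rightarrow> complex) \<Rightarrow> bool" where
  "test_function f \<longleftrightarrow>
     (\<forall>k. ((\<lambda>g x. vector_derivative g (at x)) ^^ k) f differentiable_on UNIV) \<and>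
     compact (closure {x. f x \<noteq> 0}) \<and> closure {x. f x \<noteq> 0} \<subseteq> {0<..}"

end

theory Submission
  imports Defs "HOL-Real_Asymp.Real_Asymp"
begin

text \<open>The theorem rests on an exact secular equation for the eigenvalues and on its asymptotics.

  An eigenfunction in sector \<open>m\<close> is \<open>e\<^sup>i\<^sup>m\<^sup>\<phi> sin\<^sup>m \<theta> v(cos \<theta>)\<close>, where
  \<open>(1 - x\<^sup>2) v'' - 2 (m + 1) x v' + \<kappa> v = 0\<close> and \<open>\<kappa> = \<mu> - m (m + 1)\<close>. Regularity at the pole
  \<open>x = 1\<close> leaves one solution up to scaling, the hypergeometric function \<open>legendre m \<kappa>\<close>, and the Robin
  condition at the equator is \<open>v'(0) = \<sigma> v(0)\<close>. One direction is a Wronskian argument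
  (\<open>spectrum_imp_robin_condition\<close>), the other one an explicit eigenfunction
  (\<open>robin_condition_imp_spectrum\<close>).

  The ratio \<open>v'(0) / v(0)\<close> comes from a growth argument. In the Taylor series of
  \<open>v\<close> at \<open>x = 0\<close> the even coefficients are asymptotic to \<open>v(0) K\<^sub>e j\<^sup>m\<^sup>-\<^sup>1\<close> and the odd ones to
  \<open>v'(0) K\<^sub>o j\<^sup>m\<^sup>-\<^sup>1\<close>, with constants given by Gamma functions. Such a series is unbounded near
  \<open>x = 1\<close> unless \<open>v(0) K\<^sub>e + v'(0) K\<^sub>o = 0\<close> (\<open>connection_zero\<close>). With \<open>\<mu> = \<nu> (\<nu> + 1)\<close> and the reflection
  formula this relation becomes \<open>v'(0) = S m \<nu> v(0)\<close>, cleared of denominators (\<open>robin_quotient\<close>).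

  For fixed \<open>m\<close> the secular function increases in \<open>\<nu>\<close> on \<open>[l, l + 1]\<close>, and for fixed \<open>\<nu>\<close> it decreases
  when \<open>m\<close> is raised by \<open>2\<close>. Hence there is exactly one root for every \<open>m \<le> l\<close> of the parity of \<open>l\<close>,
  the roots increase with \<open>m\<close>, and the clusters follow each other. The Neumann spectrum has the same
  arrangement with all roots equal to \<open>l\<close>, so the gaps of cluster \<open>l\<close> are the numbers
  \<open>\<nu> (\<nu> + 1) - l (l + 1)\<close> (\<open>sum_over_cluster\<close>).

  Because \<open>Gamma (y + 1/2) / Gamma y\<close> is asymptotic to \<open>sqrt y\<close>, the gap with \<open>m\<close> close to \<open>t l\<close> tends to
  \<open>(4 \<sigma> / \<pi>) / sqrt (1 - t\<^sup>2)\<close> (\<open>gap_limit\<close>). The ratios \<open>m / l\<close> equidistribute in \<open>[0, 1]\<close>, so the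
  average of \<open>f\<close> converges to \<open>\<integral> f ((4 \<sigma> / \<pi>) / sqrt (1 - t\<^sup>2)) dt\<close> over \<open>[0, 1]\<close>, and the substitution
  \<open>y = (4 \<sigma> / \<pi>) / sqrt (1 - t\<^sup>2)\<close> produces the stated density.\<close>

section \<open>Uniqueness for linear second-order equations\<close>

text \<open>The energy \<open>E = \<bar>w\<bar>\<^sup>2 + \<bar>w'\<bar>\<^sup>2\<close> satisfies \<open>\<bar>E'\<bar> \<le> C E\<close>, so \<open>E exp (- C t)\<close> decreases
  to the right of \<open>c\<close> and \<open>E exp (C t)\<close> increases to the left of it; both vanish at \<open>c\<close>.
  The equation is only asked for in the open interval and the target space is any inner
  product space, because the lemma is used for real power series on \<open>[0, 1)\<close> and for
  complex-valued profiles of eigenfunctions on \<open>[\<epsilon>, \<pi>/2]\<close>, with initial data at the right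
  end point.\<close>

lemma linear_ode_unique:
  fixes w w' w'' :: "real \<Rightarrow> 'a::real_inner"
  assumes cont: "continuous_on {a..b} w" "continuous_on {a..b} w'"
    and der: "\<And>t. a < t \<Longrightarrow> t < b \<Longrightarrow> (w has_vector_derivative w' t) (at t)"
             "\<And>t. a < t \<Longrightarrow> t < b \<Longrightarrow> (w' has_vector_derivative w'' t) (at t)"
    and bound: "\<And>t. a < t \<Longrightarrow> t < b \<Longrightarrow> norm (w'' t) \<le> K * (norm (w t) + norm (w' t))"
    and K: "K \<ge> 0" and c: "c \<in> {a..b}" and init: "w c = 0" "w' c = 0" and x: "x \<in> {a..b}"
  shows "w x = 0"
proof -
  define E where "E = (\<lambda>t. w t \<bullet> w t + w' t \<bullet> w' t)"
  define E' where "E' = (\<lambda>t. 2 * (w t \<bullet> w' t) + 2 * (w' t \<bullet> w'' t))"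
  define C where "C = 1 + 3 * K"
  have E_cont: "continuous_on {a..b} E" unfolding E_def by (intro continuous_intros cont)
  have E_der: "(E has_real_derivative E' t) (at t)" if "a < t" "t < b" for t
    using der[OF that] unfolding has_real_derivative_iff_has_vector_derivative E_def E'_def
      has_vector_derivative_def
    by (auto intro!: derivative_eq_intros simp: inner_commute algebra_simps)
  have E_bound: "\<bar>E' t\<bar> \<le> C * E t" if "a < t" "t < b" for t
  proof -
    define p r where "p = norm (w t)" and "r = norm (w' t)"
    have pr: "p \<ge> 0" "r \<ge> 0" by (auto simp: p_def r_def)
    have "\<bar>w t \<bullet> w' t\<bar> \<le> p * r" unfolding p_def r_def by (rule Cauchy_Schwarz_ineq2)
    moreover have "\<bar>w' t \<bullet> w'' t\<bar> \<le> r * (K * (p + r))"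
      using Cauchy_Schwarz_ineq2[of "w' t" "w'' t"] bound[OF that] mult_left_mono[OF bound[OF that] pr(2)]
      unfolding p_def r_def by linarith
    ultimately have "\<bar>E' t\<bar> \<le> 2 * (p * r) + 2 * (r * (K * (p + r)))" unfolding E'_def by linarith
    also have "\<dots> = 2 * (p * r) * (1 + K) + 2 * K * r\<^sup>2" by (simp add: algebra_simps power2_eq_square)
    also have "\<dots> \<le> (p\<^sup>2 + r\<^sup>2) * (1 + K) + 2 * K * (p\<^sup>2 + r\<^sup>2)"
      using K sum_squares_bound[of p r] by (intro add_mono mult_right_mono mult_left_mono) (auto simp: mult.assoc)
    also have "\<dots> = C * (p\<^sup>2 + r\<^sup>2)" by (simp add: C_def algebra_simps)
    also have "\<dots> = C * E t" by (simp add: E_def p_def r_def power2_norm_eq_inner)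
    finally show ?thesis .
  qed
  have "E x \<le> 0"
  proof (cases "c \<le> x")
    case True
    have "E x * exp (- C * x) \<le> E c * exp (- C * c)"
    proof (rule DERIV_nonpos_imp_decreasing_open[OF True])
      fix t assume t: "c < t" "t < x"
      have ab: "a < t" "t < b" using t c x by auto
      have "((\<lambda>t. E t * exp (- C * t)) has_real_derivative (E' t - C * E t) * exp (- C * t)) (at t)"
        by (auto intro!: derivative_eq_intros E_der ab simp: algebra_simps)
      moreover have "(E' t - C * E t) * exp (- C * t) \<le> 0"
        using E_bound[OF ab] by (intro mult_nonpos_nonneg) auto
      ultimately show "\<exists>y. ((\<lambda>t. E t * exp (- C * t)) has_real_derivative y) (at t) \<and> y \<le> 0" by blast
    next
      show "continuous_on {c..x} (\<lambda>t. E t * exp (- C * t))"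
        using c x by (intro continuous_intros continuous_on_subset[OF E_cont]) auto
    qed
    thus ?thesis using init by (simp add: E_def mult_le_0_iff)
  next
    case False
    hence False: "x \<le> c" by simp
    have "E x * exp (C * x) \<le> E c * exp (C * c)"
    proof (rule DERIV_nonneg_imp_increasing_open[OF False])
      fix t assume t: "x < t" "t < c"
      have ab: "a < t" "t < b" using t c x by auto
      have "((\<lambda>t. E t * exp (C * t)) has_real_derivative (E' t + C * E t) * exp (C * t)) (at t)"
        by (auto intro!: derivative_eq_intros E_der ab simp: algebra_simps)
      moreover have "(E' t + C * E t) * exp (C * t) \<ge> 0"
        using E_bound[OF ab] by (intro mult_nonneg_nonneg) auto
      ultimately show "\<exists>y. ((\<lambda>t. E t * exp (C * t)) has_real_derivative y) (at t) \<and> y \<ge> 0" by blast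
    next
      show "continuous_on {x..c} (\<lambda>t. E t * exp (C * t))"
        using c x by (intro continuous_intros continuous_on_subset[OF E_cont]) auto
    qed
    thus ?thesis using init by (simp add: E_def mult_le_0_iff)
  qed
  hence "w x \<bullet> w x \<le> 0" using inner_ge_zero[of "w' x"] unfolding E_def by linarith
  thus ?thesis by (simp add: antisym[OF _ inner_ge_zero] flip: inner_eq_zero_iff)
qed

section \<open>The solution that is regular at the pole\<close>

definition pseries :: "(nat \<Rightarrow> real) \<Rightarrow> real \<Rightarrow> real" where
  "pseries a z = (\<Sum>n. a n * z ^ n)"

definition unit_disc_conv :: "(nat \<Rightarrow> real) \<Rightarrow> bool" where
  "unit_disc_conv a \<longleftrightarrow> (\<forall>z. norm z < 1 \<longrightarrow> summable (\<lambda>n. a n * z ^ n))"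

lemma pseries_sums: "unit_disc_conv a \<Longrightarrow> norm z < 1 \<Longrightarrow> (\<lambda>n. a n * z ^ n) sums pseries a z"
  unfolding unit_disc_conv_def pseries_def by (blast intro: summable_sums)

lemma unit_disc_conv_diffs: "unit_disc_conv a \<Longrightarrow> unit_disc_conv (diffs a)"
  unfolding unit_disc_conv_def using termdiff_converges[of _ 1 a] by auto

lemma pseries_deriv: "unit_disc_conv a \<Longrightarrow> norm z < 1 \<Longrightarrow> (pseries a has_real_derivative pseries (diffs a) z) (at z)"
  unfolding unit_disc_conv_def pseries_def [abs_def] by (rule termdiffs_strong') auto

lemma pseries_0 [simp]: "pseries a 0 = a 0"
  unfolding pseries_def by (rule powser_zero)

lemma sums_times_arg:
  fixes b :: "nat \<Rightarrow> real"
  assumes "(\<lambda>n. b n * z ^ n) sums s" shows "(\<lambda>n. (if n = 0 then 0 else b (n - 1)) * z ^ n) sums (z * s)"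
proof -
  have "(\<lambda>n. (if Suc n = 0 then 0 else b (Suc n - 1)) * z ^ Suc n) sums (z * s)"
    using sums_mult[OF assms, of z] by (simp add: mult_ac)
  thus ?thesis by (subst (asm) sums_Suc_iff) simp
qed

text \<open>The expansions of the products that occur in the differential equations solved
  below, at the pole and at the equator. Every sum is indexed so that the coefficient of
  \<open>z ^ n\<close> is visible, which reduces each equation to a recursion.\<close>

lemma pseries_ode_terms:
  assumes "unit_disc_conv a" "norm z < 1"
  shows "(\<lambda>n. (of_nat n * (of_nat n - 1) * a n) * z ^ n) sums (z\<^sup>2 * pseries (diffs (diffs a)) z)"
    and "(\<lambda>n. (of_nat (n + 1) * of_nat n * a (n + 1)) * z ^ n) sums (z * pseries (diffs (diffs a)) z)"
    and "(\<lambda>n. (of_nat n * a n) * z ^ n) sums (z * pseries (diffs a) z)"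
    and "(\<lambda>n. (of_nat (n + 1) * a (n + 1)) * z ^ n) sums (pseries (diffs a) z)"
    and "(\<lambda>n. (of_nat (n + 1) * of_nat (n + 2) * a (n + 2)) * z ^ n) sums (pseries (diffs (diffs a)) z)"
proof -
  have 1: "(\<lambda>n. diffs a n * z ^ n) sums pseries (diffs a) z" 
    by (intro pseries_sums unit_disc_conv_diffs assms)
  have 2: "(\<lambda>n. diffs (diffs a) n * z ^ n) sums pseries (diffs (diffs a)) z" 
    by (intro pseries_sums unit_disc_conv_diffs assms)
  have z1: "(\<lambda>n. (if n = 0 then 0 else diffs a (n - 1)) * z ^ n) = (\<lambda>n. (of_nat n * a n) * z ^ n)"
    by (auto simp: fun_eq_iff diffs_def)
  have z2: "(\<lambda>n. (if n = 0 then 0 else diffs (diffs a) (n - 1)) * z ^ n) 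
      = (\<lambda>n. (of_nat (n + 1) * of_nat n * a (n + 1)) * z ^ n)"
    by (auto simp: fun_eq_iff diffs_def)
  show 3: "(\<lambda>n. (of_nat (n + 1) * of_nat n * a (n + 1)) * z ^ n) sums (z * pseries (diffs (diffs a)) z)"
    using sums_times_arg[OF 2] unfolding z2 .
  have z3: "(\<lambda>n. (if n = 0 then 0 else of_nat (n - 1 + 1) * of_nat (n - 1) * a (n - 1 + 1)) * z ^ n) 
      = (\<lambda>n. (of_nat n * (of_nat n - 1) * a n) * z ^ n)"
    by (auto simp: fun_eq_iff of_nat_diff)
  show "(\<lambda>n. (of_nat n * (of_nat n - 1) * a n) * z ^ n) sums (z\<^sup>2 * pseries (diffs (diffs a)) z)"
    using sums_times_arg[OF 3] unfolding z3 by (simp add: power2_eq_square mult_ac)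
  show "(\<lambda>n. (of_nat n * a n) * z ^ n) sums (z * pseries (diffs a) z)"
    using sums_times_arg[OF 1] unfolding z1 .
  show "(\<lambda>n. (of_nat (n + 1) * a (n + 1)) * z ^ n) sums (pseries (diffs a) z)"
    using 1 by (simp add: diffs_def)
  show "(\<lambda>n. (of_nat (n + 1) * of_nat (n + 2) * a (n + 2)) * z ^ n) sums (pseries (diffs (diffs a)) z)"
    using 2 by (simp add: diffs_def mult.assoc)
qed

text \<open>With \<open>\<kappa> = (\<nu> - m) (\<nu> + m + 1)\<close> this is \<open>(n + m - \<nu>) (n + m + \<nu> + 1)\<close>. The form in
  terms of \<open>\<kappa>\<close> also covers eigenvalue parameters for which \<open>\<nu>\<close> would be complex.\<close>

definition recursion_factor :: "nat \<Rightarrow> real \<Rightarrow> nat \<Rightarrow> real" where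
  "recursion_factor m \<kappa> n = of_nat n ^ 2 + (2 * of_nat m + 1) * of_nat n - \<kappa>"

text \<open>The coefficients of the hypergeometric function \<open>F(m - \<nu>, m + \<nu> + 1; m + 1; z)\<close>.\<close>

fun regular_coeff :: "nat \<Rightarrow> real \<Rightarrow> nat \<Rightarrow> real" where
  "regular_coeff m \<kappa> 0 = 1"
| "regular_coeff m \<kappa> (Suc n) = regular_coeff m \<kappa> n * (recursion_factor m \<kappa> n / ((of_nat n + 1) * (of_nat n + of_nat m + 1)))"

lemma unit_disc_conv_regular_coeff: "unit_disc_conv (regular_coeff m \<kappa>)"
  unfolding unit_disc_conv_def
proof (intro allI impI)
  fix z :: real assume z: "norm z < 1"
  obtain c where c: "norm z < c" "c < 1" using dense[OF z] by blast
  have "((\<lambda>n. \<bar>recursion_factor m \<kappa> n / ((of_nat n + 1) * (of_nat n + of_nat m + 1))\<bar> * norm z) \<longlonglongrightarrow> \<bar>1\<bar> * norm z)"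
  proof (intro tendsto_intros)
    show "(\<lambda>n. recursion_factor m \<kappa> n / ((of_nat n + 1) * (of_nat n + of_nat m + 1))) \<longlonglongrightarrow> 1"
      unfolding recursion_factor_def by real_asymp
  qed
  hence "eventually (\<lambda>n. \<bar>recursion_factor m \<kappa> n / ((of_nat n + 1) * (of_nat n + of_nat m + 1))\<bar> * norm z < c) sequentially"
    using c by (intro order_tendstoD) auto
  then obtain N where N: "\<And>n. n \<ge> N \<Longrightarrow> \<bar>recursion_factor m \<kappa> n / ((of_nat n + 1) * (of_nat n + of_nat m + 1))\<bar> * norm z < c"
    by (auto simp: eventually_sequentially)
  show "summable (\<lambda>n. regular_coeff m \<kappa> n * z ^ n)"
  proof (rule summable_ratio_test[OF c(2)])
    fix n assume "n \<ge> N"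
    have "norm (regular_coeff m \<kappa> (Suc n) * z ^ Suc n) = (\<bar>recursion_factor m \<kappa> n / ((of_nat n + 1) * (of_nat n + of_nat m + 1))\<bar> * norm z) * norm (regular_coeff m \<kappa> n * z ^ n)"
      by (simp add: abs_mult power_abs abs_divide mult_ac)
    also have "\<dots> \<le> c * norm (regular_coeff m \<kappa> n * z ^ n)"
      using N[OF \<open>n \<ge> N\<close>] by (intro mult_right_mono) auto
    finally show "norm (regular_coeff m \<kappa> (Suc n) * z ^ Suc n) \<le> c * norm (regular_coeff m \<kappa> n * z ^ n)" .
  qed
qed

lemma regular_series_ode:
  fixes m :: nat and \<kappa> z :: real
  assumes "norm z < 1"
  defines "w \<equiv> pseries (regular_coeff m \<kappa>) z" and "w' \<equiv> pseries (diffs (regular_coeff m \<kappa>)) z" and "w'' \<equiv> pseries (diffs (diffs (regular_coeff m \<kappa>))) z"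
  shows "z * (1 - z) * w'' + (of_nat m + 1) * (1 - 2 * z) * w' + \<kappa> * w = 0"
proof -
  let ?h = "regular_coeff m \<kappa>"
  note t = pseries_ode_terms[OF unit_disc_conv_regular_coeff assms(1), of m \<kappa>]
  note w = pseries_sums[OF unit_disc_conv_regular_coeff assms(1), of m \<kappa>]
  have "(\<lambda>n. (of_nat (n + 1) * of_nat n * ?h (n + 1)) * z ^ n + (of_nat m + 1) * ((of_nat (n + 1) * ?h (n + 1)) * z ^ n)
     - ((of_nat n * (of_nat n - 1) * ?h n) * z ^ n + 2 * (of_nat m + 1) * ((of_nat n * ?h n) * z ^ n) - \<kappa> * (?h n * z ^ n)))
    sums (z * w'' + (of_nat m + 1) * w' - (z\<^sup>2 * w'' + 2 * (of_nat m + 1) * (z * w') - \<kappa> * w))"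
    unfolding w_def w'_def w''_def by (intro sums_diff sums_add sums_mult t w)
  moreover have "(of_nat (n + 1) * of_nat n * ?h (n + 1)) * z ^ n + (of_nat m + 1) * ((of_nat (n + 1) * ?h (n + 1)) * z ^ n)
     - ((of_nat n * (of_nat n - 1) * ?h n) * z ^ n + 2 * (of_nat m + 1) * ((of_nat n * ?h n) * z ^ n) - \<kappa> * (?h n * z ^ n)) = 0" for n
  proof -
    have nz: "(1 + real n) * (1 + real n + real m) \<noteq> 0" by (simp add: add_pos_nonneg)
    have "(real n + 1) * (real n + real m + 1) * ?h (n+1) = recursion_factor m \<kappa> n * ?h n"
      using nz by (simp add: add_ac)
    hence *: "((real n + 1) * (real n + real m + 1) * ?h (n+1) - recursion_factor m \<kappa> n * ?h n) * z ^ n = 0" by simp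
    show ?thesis unfolding *[symmetric] by (simp add: recursion_factor_def algebra_simps power2_eq_square del: regular_coeff.simps)
  qed
  ultimately have "(\<lambda>n. 0) sums (z * w'' + (of_nat m + 1) * w' - (z\<^sup>2 * w'' + 2 * (of_nat m + 1) * (z * w') - \<kappa> * w))"
    by simp
  hence "0 = z * w'' + (of_nat m + 1) * w' - (z\<^sup>2 * w'' + 2 * (of_nat m + 1) * (z * w') - \<kappa> * w)"
    using sums_unique2 sums_zero by blast
  thus ?thesis by (simp add: algebra_simps power2_eq_square)
qed

text \<open>The associated Legendre function without its factor \<open>(1 - x\<^sup>2)\<close> to the power
  \<open>m / 2\<close>, normalised at the pole \<open>x = 1\<close>. The series in \<open>(1 - x) / 2\<close> converges on
  \<open>(-1, 3)\<close>, hence in a full neighbourhood of the heights \<open>0 \<le> x \<le> 1\<close> of the hemisphere.\<close>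

definition legendre :: "nat \<Rightarrow> real \<Rightarrow> real \<Rightarrow> real" where
  "legendre m \<kappa> x = pseries (regular_coeff m \<kappa>) ((1 - x) / 2)"
definition legendre' :: "nat \<Rightarrow> real \<Rightarrow> real \<Rightarrow> real" where
  "legendre' m \<kappa> x = - pseries (diffs (regular_coeff m \<kappa>)) ((1 - x) / 2) / 2"
definition legendre'' :: "nat \<Rightarrow> real \<Rightarrow> real \<Rightarrow> real" where
  "legendre'' m \<kappa> x = pseries (diffs (diffs (regular_coeff m \<kappa>))) ((1 - x) / 2) / 4"

lemma legendre_at_1: "legendre m \<kappa> 1 = 1" by (simp add: legendre_def)

lemma legendre_deriv:
  assumes "-1 < x" "x < 3"
  shows "(legendre m \<kappa> has_real_derivative legendre' m \<kappa> x) (at x)"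
    and "(legendre' m \<kappa> has_real_derivative legendre'' m \<kappa> x) (at x)"
    and "isCont (legendre'' m \<kappa>) x"
proof -
  have z: "norm ((1 - x) / 2) < 1" using assms by (auto simp: abs_if)
  have aff: "((\<lambda>x. (1 - x) / 2) has_real_derivative -1/2) (at x)" 
    by (auto intro!: derivative_eq_intros)
  have chain: "((\<lambda>x. pseries a ((1 - x) / 2)) has_real_derivative pseries (diffs a) ((1 - x) / 2) * (-1/2)) (at x)" if "unit_disc_conv a" for a
    by (rule DERIV_chain2[OF pseries_deriv[OF that z] aff])
  show "(legendre m \<kappa> has_real_derivative legendre' m \<kappa> x) (at x)"
    using chain[OF unit_disc_conv_regular_coeff] unfolding legendre_def[abs_def] legendre'_def by simp
  show "(legendre' m \<kappa> has_real_derivative legendre'' m \<kappa> x) (at x)"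
    using DERIV_cmult[OF chain[OF unit_disc_conv_diffs[OF unit_disc_conv_regular_coeff]], of "-1/2" m \<kappa>] 
    unfolding legendre'_def[abs_def] legendre''_def by simp
  show "isCont (legendre'' m \<kappa>) x"
    using DERIV_isCont[OF DERIV_cmult[OF chain[OF unit_disc_conv_diffs[OF unit_disc_conv_diffs[OF unit_disc_conv_regular_coeff]]], of "1/4" m \<kappa>]]
    unfolding legendre''_def[abs_def] by simp
qed

text \<open>Separating \<open>e\<^sup>i\<^sup>m\<^sup>\<phi> sin\<^sup>m \<theta> v(cos \<theta>)\<close> in \<open>\<Delta> F + \<mu> F = 0\<close> leads to this equation for
  \<open>v\<close>, with \<open>\<kappa> = \<mu> - m (m + 1)\<close>.\<close>

lemma legendre_ode:
  assumes "-1 < x" "x < 3"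
  shows "(1 - x\<^sup>2) * legendre'' m \<kappa> x - 2 * (of_nat m + 1) * x * legendre' m \<kappa> x + \<kappa> * legendre m \<kappa> x = 0"
proof -
  have z: "norm ((1 - x) / 2) < 1" using assms by (auto simp: abs_if)
  show ?thesis using regular_series_ode[OF z, of m \<kappa>] unfolding legendre_def legendre'_def legendre''_def
    by (simp add: field_simps power2_eq_square)
qed

text \<open>All coefficients at the pole are positive when \<open>\<kappa> < 0\<close>. Hence a Robin condition
  \<open>v'(0) = \<sigma> v(0)\<close> with \<open>\<sigma> \<ge> 0\<close> cannot hold, and every eigenvalue in sector \<open>m\<close> has the
  form \<open>\<nu> (\<nu> + 1)\<close> with real \<open>\<nu> \<ge> m\<close>.\<close>

lemma legendre_signs_of_neg:
  assumes "\<kappa> < 0" shows "legendre m \<kappa> 0 > 0" "legendre' m \<kappa> 0 < 0"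
proof -
  have q: "recursion_factor m \<kappa> n > 0" for n using assms unfolding recursion_factor_def by (smt (verit) of_nat_0_le_iff zero_le_power mult_nonneg_nonneg)
  have pos: "regular_coeff m \<kappa> n > 0" for n
  proof (induction n)
    case (Suc n)
    have "(real n + 1) * (real n + real m + 1) > 0" by (intro mult_pos_pos) auto
    thus ?case using Suc q[of n] by simp
  qed simp
  show "legendre m \<kappa> 0 > 0" unfolding legendre_def pseries_def
    using unit_disc_conv_regular_coeff[of m \<kappa>] pos by (intro suminf_pos) (auto simp: unit_disc_conv_def)
  have "pseries (diffs (regular_coeff m \<kappa>)) (1/2) > 0" unfolding pseries_def
    using unit_disc_conv_diffs[OF unit_disc_conv_regular_coeff[of m \<kappa>]] pos by (intro suminf_pos) (auto simp: unit_disc_conv_def diffs_def simp del: regular_coeff.simps)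
  thus "legendre' m \<kappa> 0 < 0" unfolding legendre'_def by simp
qed

section \<open>The ratio of value and slope at the equator\<close>

text \<open>The Taylor coefficients at \<open>x = 0\<close> of the solution of the same equation with value
  \<open>\<alpha>\<close> and slope \<open>\<beta>\<close> there. The recursion has step two, so even and odd coefficients do not
  interact.\<close>

fun equator_coeff :: "nat \<Rightarrow> real \<Rightarrow> real \<Rightarrow> real \<Rightarrow> nat \<Rightarrow> real" where
  "equator_coeff m \<kappa> \<alpha> \<beta> 0 = \<alpha>"
| "equator_coeff m \<kappa> \<alpha> \<beta> (Suc 0) = \<beta>"
| "equator_coeff m \<kappa> \<alpha> \<beta> (Suc (Suc n)) = equator_coeff m \<kappa> \<alpha> \<beta> n * (recursion_factor m \<kappa> n / ((of_nat n + 1) * (of_nat n + 2)))"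

lemma recursion_factor_asymp: "(\<lambda>n. recursion_factor m \<kappa> n / ((of_nat n + 1) * (of_nat n + 2))) \<longlonglongrightarrow> 1"
  unfolding recursion_factor_def by real_asymp

text \<open>For every \<open>r < 1\<close> the factor of the two-step recursion is eventually below
  \<open>1 / r\<^sup>2\<close>, so \<open>\<bar>c\<^sub>n\<bar> r\<^sup>n\<close> stays below the maximum of its initial values; Abel's lemma
  gives convergence.\<close>

lemma unit_disc_conv_equator_coeff: "unit_disc_conv (equator_coeff m \<kappa> \<alpha> \<beta>)"
  unfolding unit_disc_conv_def
proof (intro allI impI)
  fix z :: real assume z: "norm z < 1"
  let ?c = "equator_coeff m \<kappa> \<alpha> \<beta>"
  obtain r where r: "norm z < r" "r < 1" using dense[OF z] by blast
  have r0: "r > 0" using r norm_ge_zero[of z] by linarith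
  have "(\<lambda>n. \<bar>recursion_factor m \<kappa> n / ((of_nat n + 1) * (of_nat n + 2))\<bar> * r\<^sup>2) \<longlonglongrightarrow> \<bar>1\<bar> * r\<^sup>2"
    by (intro tendsto_intros recursion_factor_asymp)
  hence "eventually (\<lambda>n. \<bar>recursion_factor m \<kappa> n / ((of_nat n + 1) * (of_nat n + 2))\<bar> * r\<^sup>2 < 1) sequentially"
    using r r0 by (elim order_tendstoD(2)) (auto simp: power_less_one_iff)
  then obtain N where N: "\<And>n. n \<ge> N \<Longrightarrow> \<bar>recursion_factor m \<kappa> n / ((of_nat n + 1) * (of_nat n + 2))\<bar> * r\<^sup>2 < 1"
    by (auto simp: eventually_sequentially)
  \<comment> \<open>the bound survives every recursion step with \<open>n \<ge> N\<close>, where the recursion multiplies by less than \<open>1 / r\<^sup>2\<close>\<close>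
  define M where "M = Max ((\<lambda>n. norm (?c n) * r ^ n) ` {..N + 1})"
  have "norm (?c n) * r ^ n \<le> M" for n
  proof (induction n rule: less_induct)
    case (less n)
    show ?case
    proof (cases "n \<le> N + 1")
      case True
      thus ?thesis unfolding M_def by (intro Max_ge) auto
    next
      case False
      then obtain k where k: "n = Suc (Suc k)" "k \<ge> N"
        by (intro that[of "n - 2"]) auto
      have "norm (?c n) * r ^ n = (\<bar>recursion_factor m \<kappa> k / ((of_nat k + 1) * (of_nat k + 2))\<bar> * r\<^sup>2) * (norm (?c k) * r ^ k)"
        by (simp add: k abs_mult power2_eq_square mult_ac)
      also have "\<dots> \<le> 1 * (norm (?c k) * r ^ k)"
        using N[OF k(2)] r0 by (intro mult_right_mono) auto
      also have "\<dots> \<le> M" using less[of k] k by simp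
      finally show ?thesis .
    qed
  qed
  from Abel_lemma[OF norm_ge_zero r(1) this]
  have "summable (\<lambda>n. norm (?c n * z ^ n))" by (simp add: abs_mult power_abs)
  thus "summable (\<lambda>n. ?c n * z ^ n)" by (rule summable_norm_cancel)
qed

lemma equator_series_ode:
  fixes m :: nat and \<kappa> \<alpha> \<beta> z :: real
  assumes "norm z < 1"
  defines "c \<equiv> equator_coeff m \<kappa> \<alpha> \<beta>"
  shows "(1 - z\<^sup>2) * pseries (diffs (diffs c)) z - 2 * (of_nat m + 1) * z * pseries (diffs c) z + \<kappa> * pseries c z = 0"
proof -
  note t = pseries_ode_terms[OF unit_disc_conv_equator_coeff assms(1), of m \<kappa> \<alpha> \<beta>, folded c_def]
  note w = pseries_sums[OF unit_disc_conv_equator_coeff assms(1), of m \<kappa> \<alpha> \<beta>, folded c_def]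
  let ?s = "\<lambda>n. (of_nat (n + 1) * of_nat (n + 2) * c (n + 2)) * z ^ n 
     - ((of_nat n * (of_nat n - 1) * c n) * z ^ n + 2 * (of_nat m + 1) * ((of_nat n * c n) * z ^ n) - \<kappa> * (c n * z ^ n))"
  have "?s sums (pseries (diffs (diffs c)) z - (z\<^sup>2 * pseries (diffs (diffs c)) z + 2 * (of_nat m + 1) * (z * pseries (diffs c) z) - \<kappa> * pseries c z))"
    by (intro sums_diff sums_add sums_mult t w)
  moreover have "?s n = 0" for n
  proof -
    have nz: "(1 + real n) * (2 + real n) \<noteq> 0" by (simp add: add_pos_nonneg)
    have "(real n + 1) * (real n + 2) * c (n+2) = recursion_factor m \<kappa> n * c n"
      using nz by (simp add: c_def add_ac)
    hence *: "((real n + 1) * (real n + 2) * c (n+2) - recursion_factor m \<kappa> n * c n) * z ^ n = 0" by simp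
    show ?thesis unfolding *[symmetric] by (simp add: recursion_factor_def algebra_simps power2_eq_square)
  qed
  ultimately have "(\<lambda>n. 0) sums (pseries (diffs (diffs c)) z - (z\<^sup>2 * pseries (diffs (diffs c)) z + 2 * (of_nat m + 1) * (z * pseries (diffs c) z) - \<kappa> * pseries c z))"
    by simp
  hence "0 = pseries (diffs (diffs c)) z - (z\<^sup>2 * pseries (diffs (diffs c)) z + 2 * (of_nat m + 1) * (z * pseries (diffs c) z) - \<kappa> * pseries c z)"
    using sums_unique2 sums_zero by blast
  thus ?thesis by (simp add: algebra_simps)
qed

text \<open>Both sides solve the same equation on \<open>[0, 1)\<close> with the same data at \<open>0\<close>. Away from
  the singular point \<open>1\<close> its coefficients are bounded, so the solution is unique.\<close>

lemma legendre_eq_equator_series: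
  assumes "0 \<le> x" "x < 1"
  shows "legendre m \<kappa> x = pseries (equator_coeff m \<kappa> (legendre m \<kappa> 0) (legendre' m \<kappa> 0)) x"
proof -
  define c where "c = equator_coeff m \<kappa> (legendre m \<kappa> 0) (legendre' m \<kappa> 0)"
  define w where "w = (\<lambda>x. legendre m \<kappa> x - pseries c x)"
  define w' where "w' = (\<lambda>x. legendre' m \<kappa> x - pseries (diffs c) x)"
  define w'' where "w'' = (\<lambda>x. legendre'' m \<kappa> x - pseries (diffs (diffs c)) x)"
  define a where "a = 2 * (real m + 1)"
  have a: "a > 0" by (simp add: a_def)
  define K where "K = (a + \<bar>\<kappa>\<bar>) / (1 - x\<^sup>2)"
  have conv: "unit_disc_conv c" unfolding c_def by (rule unit_disc_conv_equator_coeff)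
  have x2: "x\<^sup>2 < 1" using assms by (simp add: power_less_one_iff abs_square_less_1)
  have d1: "(w has_real_derivative w' t) (at t)" and d2: "(w' has_real_derivative w'' t) (at t)" if "-1 < t" "t < 1" for t
    using that unfolding w_def w'_def w''_def
    by (auto intro!: DERIV_diff legendre_deriv pseries_deriv unit_disc_conv_diffs conv)
  have "w x = 0"
  proof (rule linear_ode_unique[where a = 0 and b = x and c = 0 and x = x and w = w and w' = w' and w'' = w'' and K = K])
    show "continuous_on {0..x} w" "continuous_on {0..x} w'"
      using assms by (auto intro!: continuous_at_imp_continuous_on DERIV_isCont d1 d2)
    show "(w has_vector_derivative w' t) (at t)" if "0 < t" "t < x" for t
      unfolding has_real_derivative_iff_has_vector_derivative [symmetric] using that assms by (auto intro!: d1)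
    show "(w' has_vector_derivative w'' t) (at t)" if "0 < t" "t < x" for t
      unfolding has_real_derivative_iff_has_vector_derivative [symmetric] using that assms by (auto intro!: d2)
    show "K \<ge> 0" using x2 a by (auto simp: K_def intro!: divide_nonneg_nonneg add_nonneg_nonneg)
    show "w 0 = 0" "w' 0 = 0" by (auto simp: w_def w'_def c_def diffs_def)
    show "norm (w'' t) \<le> K * (norm (w t) + norm (w' t))" if t: "0 < t" "t < x" for t
    proof -
      have t1: "norm t < 1" using t assms by auto
      have eq: "(1 - t\<^sup>2) * w'' t = a * t * w' t - \<kappa> * w t"
        using legendre_ode[of t m \<kappa>] equator_series_ode[OF t1, of m \<kappa> "legendre m \<kappa> 0" "legendre' m \<kappa> 0"] t assms
        unfolding w_def w'_def w''_def a_def c_def[symmetric] by (simp add: algebra_simps)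
      have t2: "1 - x\<^sup>2 \<le> 1 - t\<^sup>2" using t by (simp add: power_mono)
      have "(1 - x\<^sup>2) * \<bar>w'' t\<bar> \<le> (1 - t\<^sup>2) * \<bar>w'' t\<bar>" using t2 by (intro mult_right_mono) auto
      also have "\<dots> = \<bar>(1 - t\<^sup>2) * w'' t\<bar>" using t2 x2 by (simp add: abs_mult)
      also have "\<dots> = \<bar>a * t * w' t - \<kappa> * w t\<bar>" by (simp only: eq)
      also have "\<dots> \<le> \<bar>a * t * w' t\<bar> + \<bar>\<kappa> * w t\<bar>" by (rule abs_triangle_ineq4)
      also have "\<dots> = a * t * \<bar>w' t\<bar> + \<bar>\<kappa>\<bar> * \<bar>w t\<bar>" using a t by (simp add: abs_mult)
      also have "\<dots> \<le> a * 1 * \<bar>w' t\<bar> + \<bar>\<kappa>\<bar> * \<bar>w t\<bar>" using a t assms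
        by (intro add_mono mult_right_mono mult_left_mono) auto
      also have "\<dots> \<le> (a + \<bar>\<kappa>\<bar>) * \<bar>w' t\<bar> + (a + \<bar>\<kappa>\<bar>) * \<bar>w t\<bar>"
        using a by (intro add_mono mult_right_mono) auto
      finally show ?thesis using x2 by (simp add: K_def field_simps)
    qed
  qed (use assms in auto)
  thus ?thesis unfolding w_def c_def by simp
qed

lemma legendre_continuous: "continuous_on {0..1} (legendre m \<kappa>)"
  by (auto intro!: continuous_at_imp_continuous_on DERIV_isCont legendre_deriv)

lemma legendre_initial_nonzero: "legendre m \<kappa> 0 \<noteq> 0 \<or> legendre' m \<kappa> 0 \<noteq> 0"
proof (rule ccontr)
  assume "\<not> ?thesis"
  moreover have "equator_coeff m \<kappa> 0 0 n = 0" for n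
    by (induction m \<kappa> "0::real" "0::real" n rule: equator_coeff.induct) auto
  ultimately have zero: "legendre m \<kappa> x = 0" if "0 \<le> x" "x < 1" for x
    using legendre_eq_equator_series[OF that, of m \<kappa>] by (simp add: pseries_def)
  have lim: "(legendre m \<kappa> \<longlongrightarrow> legendre m \<kappa> 1) (at_left 1)"
    using DERIV_isCont[OF legendre_deriv(1)[of 1 m \<kappa>]] by (auto simp: isCont_def intro: tendsto_within_subset)
  have ev: "eventually (\<lambda>x. legendre m \<kappa> x = 0) (at_left 1)"
    using eventually_at_left_real[of 0 "1::real", OF zero_less_one] by eventually_elim (auto intro: zero)
  have "((\<lambda>x::real. 0::real) \<longlongrightarrow> legendre m \<kappa> 1) (at_left 1)"
    using tendsto_cong[OF ev] lim by simp
  hence "legendre m \<kappa> 1 = 0" using tendsto_const tendsto_unique trivial_limit_at_left_real by blast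
  thus False by (simp add: legendre_at_1)
qed

text \<open>A bounded power series with eventually nonnegative coefficients has bounded partial
  sums of coefficients: let \<open>x\<close> tend to \<open>1\<close> in the partial sums. The harmonic series
  excludes this.\<close>

lemma pseries_unbounded_of_harmonic:
  assumes conv: "unit_disc_conv b" and \<delta>: "\<delta> > 0" and b: "\<And>k. k \<ge> N \<Longrightarrow> b k \<ge> \<delta> / (of_nat k + 1)"
    and B: "\<And>x. 0 \<le> x \<Longrightarrow> x < 1 \<Longrightarrow> pseries b x \<le> B"
  shows False
proof -
  have nn: "b k \<ge> 0" if "k \<ge> N" for k
    using b[OF that] \<delta> by (smt (verit) divide_nonneg_nonneg of_nat_0_le_iff)
  have partial: "(\<Sum>k<M. b k) \<le> B" if "M \<ge> N" for M
  proof (rule tendsto_upperbound)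
    show "((\<lambda>x. \<Sum>k<M. b k * x ^ k) \<longlongrightarrow> (\<Sum>k<M. b k)) (at_left 1)"
      by (rule tendsto_eq_intros | simp)+
    show "\<forall>\<^sub>F x in at_left 1. (\<Sum>k<M. b k * x ^ k) \<le> B"
      using eventually_at_left_real[of 0 "1::real", OF zero_less_one]
    proof eventually_elim
      case (elim x)
      have s: "summable (\<lambda>n. b n * x ^ n)" using conv elim by (auto simp: unit_disc_conv_def)
      have "(\<Sum>k<M. b k * x ^ k) \<le> pseries b x" unfolding pseries_def
        using elim that by (intro sum_le_suminf s) (auto intro!: mult_nonneg_nonneg nn)
      thus ?case using B[of x] elim by simp
    qed
  qed auto
  have "summable (\<lambda>k. b (k + N))"
  proof (rule summableI_nonneg_bounded)
    show "0 \<le> b (n + N)" for n by (rule nn) simp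
    show "(\<Sum>k<n. b (k + N)) \<le> B - (\<Sum>k<N. b k)" for n
      using partial[of "n + N"] sum.nat_group[of b] sum.atLeastLessThan_concat[of 0 N "n + N" b] sum.shift_bounds_nat_ivl[of b 0 N n]
      by (simp add: atLeast0LessThan)
  qed
  hence "summable (\<lambda>k. \<delta> / (of_nat (k + N) + 1))"
  proof (rule summable_comparison_test_ev[rotated])
    show "\<forall>\<^sub>F k in sequentially. norm (\<delta> / (of_nat (k + N) + 1)) \<le> b (k + N)"
    proof (rule always_eventually, rule allI)
      fix k show "norm (\<delta> / (of_nat (k + N) + 1)) \<le> b (k + N)"
        using b[of "k + N"] \<delta> by simp
    qed
  qed
  hence "summable (\<lambda>k. \<delta> / (of_nat k + 1))" 
    using summable_iff_shift[of "\<lambda>k. \<delta> / (of_nat k + 1)" N] by simp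
  hence "summable (\<lambda>k. 1 / \<delta> * (\<delta> / (of_nat k + 1)))" by (rule summable_mult)
  hence "summable (\<lambda>k. inverse (of_nat (Suc k)) :: real)" using \<delta> by (simp add: inverse_eq_divide add_ac)
  hence "summable (\<lambda>k. inverse (of_nat k) :: real)" by (subst (asm) summable_Suc_iff)
  thus False using not_summable_harmonic[where 'a = real] by simp
qed

text \<open>Gauss's product formula for the Gamma function, applied to each of the four
  Pochhammer symbols. By the hypothesis on the parameters the quotient grows like
  \<open>n ^ (m - 1)\<close>, which the factor \<open>n / n ^ m\<close> compensates, also for \<open>m = 0\<close>. The
  reciprocal \<open>rGamma\<close> is entire, so \<open>a\<close> and \<open>b\<close> may be nonpositive integers.\<close>

lemma pochhammer_ratio_asymp:
  fixes a b c d :: real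
  assumes "c > 0" "d > 0" "a + b - c - d = real m - 1"
  shows "(\<lambda>n. pochhammer a (n + 1) * pochhammer b (n + 1) / (pochhammer c (n + 1) * pochhammer d (n + 1)) * (real n / real n ^ m))
     \<longlonglongrightarrow> rGamma a * rGamma b / (rGamma c * rGamma d)"
proof (rule Lim_transform_eventually)
  show "(\<lambda>n. rGamma_series a n * rGamma_series b n / (rGamma_series c n * rGamma_series d n))
      \<longlonglongrightarrow> rGamma a * rGamma b / (rGamma c * rGamma d)"
    using assms by (intro tendsto_intros) (auto simp: rGamma_eq_zero_iff elim!: nonpos_Ints_cases')
  show "\<forall>\<^sub>F n in sequentially. rGamma_series a n * rGamma_series b n / (rGamma_series c n * rGamma_series d n)
      = pochhammer a (n + 1) * pochhammer b (n + 1) / (pochhammer c (n + 1) * pochhammer d (n + 1)) * (real n / real n ^ m)"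
    using eventually_gt_at_top[of 0]
  proof eventually_elim
    case (elim n)
    define e where "e = (\<lambda>z::real. exp (z * ln (real n)))"
    have e0: "e z \<noteq> 0" for z by (simp add: e_def)
    have rs: "rGamma_series z n = pochhammer z (n + 1) / (fact n * e z)" for z
      by (simp add: rGamma_series_def e_def)
    have "e a * e b * e 1 = e c * e d * e (real m)" 
      unfolding e_def exp_add [symmetric] distrib_right [symmetric]
      using assms(3) by (intro arg_cong[where f = exp] arg_cong2[where f = "(*)"]) auto
    moreover have "e 1 = real n" "e (real m) = real n ^ m"
      using elim by (auto simp: e_def exp_of_nat_mult)
    ultimately have e_eq: "e c * e d / (e a * e b) = real n / real n ^ m"
      using elim e0 by (simp add: field_simps)
    have "rGamma_series a n * rGamma_series b n / (rGamma_series c n * rGamma_series d n) =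
       pochhammer a (n + 1) * pochhammer b (n + 1) / (pochhammer c (n + 1) * pochhammer d (n + 1)) * (e c * e d / (e a * e b))"
      unfolding rs by (simp add: field_simps e0)
    thus ?case unfolding e_eq .
  qed
qed

lemma equator_coeff_even_odd:
  fixes m :: nat and \<nu> :: real
  defines "\<kappa> \<equiv> (\<nu> - real m) * (\<nu> + real m + 1)" and "A \<equiv> (real m - \<nu>) / 2" and "B \<equiv> (real m + \<nu> + 1) / 2"
  shows "equator_coeff m \<kappa> \<alpha> \<beta> (2 * n) = \<alpha> * (pochhammer A n * pochhammer B n / (pochhammer (1/2) n * pochhammer 1 n))"
    and "equator_coeff m \<kappa> \<alpha> \<beta> (2 * n + 1) = \<beta> * (pochhammer (A + 1/2) n * pochhammer (B + 1/2) n / (pochhammer (3/2) n * pochhammer 1 n))"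
proof (induction n)
  case (Suc n)
  have r1: "recursion_factor m \<kappa> (2 * n) / ((real (2 * n) + 1) * (real (2 * n) + 2)) = (A + n) * (B + n) / ((1/2 + n) * (1 + n))"
    unfolding recursion_factor_def \<kappa>_def A_def B_def by (simp add: divide_simps add_pos_nonneg) (simp add: algebra_simps power2_eq_square)
  have r2: "recursion_factor m \<kappa> (2 * n + 1) / ((real (2 * n + 1) + 1) * (real (2 * n + 1) + 2)) = (A + 1/2 + n) * (B + 1/2 + n) / ((3/2 + n) * (1 + n))"
    unfolding recursion_factor_def \<kappa>_def A_def B_def by (simp add: divide_simps add_pos_nonneg) (simp add: algebra_simps power2_eq_square)
  have "equator_coeff m \<kappa> \<alpha> \<beta> (2 * Suc n) = equator_coeff m \<kappa> \<alpha> \<beta> (2 * n) * ((A + n) * (B + n) / ((1/2 + n) * (1 + n)))"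
    using r1 by simp
  thus "equator_coeff m \<kappa> \<alpha> \<beta> (2 * Suc n) = \<alpha> * (pochhammer A (Suc n) * pochhammer B (Suc n) / (pochhammer (1/2) (Suc n) * pochhammer 1 (Suc n)))"
    unfolding Suc(1) pochhammer_Suc by (simp add: mult_ac)
  have "equator_coeff m \<kappa> \<alpha> \<beta> (2 * Suc n + 1) = equator_coeff m \<kappa> \<alpha> \<beta> (2 * n + 1) * ((A + 1/2 + n) * (B + 1/2 + n) / ((3/2 + n) * (1 + n)))"
    using r2 by simp
  thus "equator_coeff m \<kappa> \<alpha> \<beta> (2 * Suc n + 1) = \<beta> * (pochhammer (A + 1/2) (Suc n) * pochhammer (B + 1/2) (Suc n) / (pochhammer (3/2) (Suc n) * pochhammer 1 (Suc n)))"
    unfolding Suc(2) pochhammer_Suc by (simp add: mult_ac)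
qed auto

text \<open>The even Taylor coefficients at the equator are asymptotic to \<open>j ^ (m - 1)\<close> times
  the first summand, the odd ones to \<open>j ^ (m - 1)\<close> times the second. So this is, up to a
  positive factor, the coefficient of the solution that is singular at the pole in the
  solution with value \<open>\<alpha>\<close> and slope \<open>\<beta>\<close> at the equator.\<close>

definition connection :: "nat \<Rightarrow> real \<Rightarrow> real \<Rightarrow> real \<Rightarrow> real" where
  "connection m \<nu> \<alpha> \<beta> = \<alpha> * (rGamma ((real m - \<nu>) / 2) * rGamma ((real m + \<nu> + 1) / 2) / (rGamma (1/2) * rGamma 1))
     + \<beta> * (rGamma ((real m - \<nu>) / 2 + 1/2) * rGamma ((real m + \<nu> + 1) / 2 + 1/2) / (rGamma (3/2) * rGamma 1))"

text \<open>Multiplication of the series by \<open>1 + x\<close> adds neighbouring coefficients, and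
  therefore adds the even and the odd constant in every degree. If the sum \<open>L\<close> of the
  constants were positive, the new coefficients would eventually exceed
  \<open>(L / 2) j ^ (m - 1) \<ge> (L / 2) / j\<close>, and the series could not be bounded near \<open>x = 1\<close>.\<close>

lemma connection_nonpos:
  fixes m :: nat and \<nu> \<alpha> \<beta> C :: real
  defines "\<kappa> \<equiv> (\<nu> - real m) * (\<nu> + real m + 1)"
  assumes B: "\<And>x. 0 \<le> x \<Longrightarrow> x < 1 \<Longrightarrow> \<bar>pseries (equator_coeff m \<kappa> \<alpha> \<beta>) x\<bar> \<le> C"
  shows "connection m \<nu> \<alpha> \<beta> \<le> 0"
proof (rule ccontr)
  define L where "L = connection m \<nu> \<alpha> \<beta>"
  assume "\<not> ?thesis"
  hence L: "L > 0" by (simp add: L_def)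
  define c where "c = equator_coeff m \<kappa> \<alpha> \<beta>"
  define KE where "KE = \<alpha> * (rGamma ((real m - \<nu>) / 2) * rGamma ((real m + \<nu> + 1) / 2) / (rGamma (1/2) * rGamma 1))"
  define KO where "KO = \<beta> * (rGamma ((real m - \<nu>) / 2 + 1/2) * rGamma ((real m + \<nu> + 1) / 2 + 1/2) / (rGamma (3/2) * rGamma 1))"
  have E: "(\<lambda>n. c (2 * (n + 1)) * (real n / real n ^ m)) \<longlonglongrightarrow> KE"
    unfolding c_def \<kappa>_def equator_coeff_even_odd KE_def mult.assoc[of \<alpha>]
    by (intro tendsto_mult_left pochhammer_ratio_asymp) (auto simp: field_simps)
  have O: "(\<lambda>n. c (2 * (n + 1) + 1) * (real n / real n ^ m)) \<longlonglongrightarrow> KO"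
    unfolding c_def \<kappa>_def equator_coeff_even_odd KO_def mult.assoc[of \<beta>]
    by (intro tendsto_mult_left pochhammer_ratio_asymp) (auto simp: field_simps)
  have "(\<lambda>n. recursion_factor m \<kappa> (2 * (n + 1)) / ((real (2 * (n + 1)) + 1) * (real (2 * (n + 1)) + 2))) \<longlonglongrightarrow> 1"
    unfolding recursion_factor_def by real_asymp
  from tendsto_mult[OF E this]
  \<comment> \<open>one more recursion step does not change the asymptotics, so \<open>c\<^sub>2\<^sub>j\<^sub>+\<^sub>1 + c\<^sub>2\<^sub>j\<^sub>+\<^sub>2\<close> is covered as well\<close>
  have E2: "(\<lambda>n. c (2 * (n + 1) + 2) * (real n / real n ^ m)) \<longlonglongrightarrow> KE"
    by (simp add: c_def mult_ac)
  have KL: "KE + KO = L" by (simp add: L_def KE_def KO_def connection_def)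
  \<comment> \<open>the coefficients of \<open>(1 + x) \<Sum> c\<^sub>k x\<^sup>k\<close>\<close>
  define b where "b = (\<lambda>k. c k + (if k = 0 then 0 else c (k - 1)))"
  have 1: "(\<lambda>n. b (2 * n + 3) * (real n / real n ^ m)) \<longlonglongrightarrow> L"
    using tendsto_add[OF E O] by (simp add: b_def KL algebra_simps numeral_eq_Suc)
  have 2: "(\<lambda>n. b (2 * n + 4) * (real n / real n ^ m)) \<longlonglongrightarrow> L"
    using tendsto_add[OF E2 O] by (simp add: b_def KL algebra_simps numeral_eq_Suc)
  have "eventually (\<lambda>n. b (2 * n + 3) * (real n / real n ^ m) > L / 2 \<and> b (2 * n + 4) * (real n / real n ^ m) > L / 2 \<and> n \<ge> 1) sequentially"
    using L by (intro eventually_conj order_tendstoD(1)[OF 1] order_tendstoD(1)[OF 2] eventually_ge_at_top) auto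
  then obtain N where N: "\<And>n. n \<ge> N \<Longrightarrow> b (2 * n + 3) * (real n / real n ^ m) > L / 2"
    "\<And>n. n \<ge> N \<Longrightarrow> b (2 * n + 4) * (real n / real n ^ m) > L / 2" "\<And>n. n \<ge> N \<Longrightarrow> n \<ge> 1"
    by (auto simp: eventually_sequentially)
  have conv: "unit_disc_conv c" unfolding c_def by (rule unit_disc_conv_equator_coeff)
  have sb: "(\<lambda>k. b k * z ^ k) sums ((1 + z) * pseries c z)" if "norm z < 1" for z
    using sums_add[OF pseries_sums[OF conv that] sums_times_arg[OF pseries_sums[OF conv that]]]
    unfolding b_def by (simp add: algebra_simps)
  show False
  proof (rule pseries_unbounded_of_harmonic)
    show "unit_disc_conv b" unfolding unit_disc_conv_def using sb sums_summable by blast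
    show "L / 2 > 0" using L by simp
    show "b k \<ge> L / 2 / (real k + 1)" if k: "k \<ge> 2 * N + 3" for k
    proof -
      obtain n where n: "n \<ge> N" "k = 2 * n + 3 \<or> k = 2 * n + 4"
        using k by (intro that[of "(k - 3) div 2"]) presburger+
      have n1: "real n \<ge> 1" using N(3)[OF n(1)] by simp
      have *: "b k * (real n / real n ^ m) > L / 2" using n N by auto
      hence "b k * (real n / real n ^ m) > 0" using L by linarith
      hence bk: "b k > 0" using n1 by (simp add: zero_less_mult_iff zero_less_divide_iff)
      have "L / 2 < b k * (real n / real n ^ m)" by fact
      also have "\<dots> \<le> b k * real n" using n1 bk
        by (intro mult_left_mono) (auto simp: field_simps)
      also have "\<dots> \<le> b k * (real k + 1)" using n bk by (intro mult_left_mono) auto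
      finally show ?thesis by (simp add: field_simps)
    qed
    show "pseries b x \<le> 2 * C" if x: "0 \<le> x" "x < 1" for x
    proof -
      have "pseries b x = (1 + x) * pseries c x" unfolding pseries_def[of b] using sums_unique[OF sb[of x]] x by simp
      also have "\<dots> \<le> (1 + x) * \<bar>pseries c x\<bar>" using x by (intro mult_left_mono) auto
      also have "\<dots> \<le> 2 * C" using x B[OF x] unfolding c_def by (intro mult_mono) auto
      finally show ?thesis .
    qed
  qed
qed

text \<open>The regular solution is bounded on \<open>[0, 1]\<close>, and so is its negative.\<close>

lemma connection_zero: 
  fixes m :: nat and \<nu> :: real
  defines "\<kappa> \<equiv> (\<nu> - real m) * (\<nu> + real m + 1)"
  shows "connection m \<nu> (legendre m \<kappa> 0) (legendre' m \<kappa> 0) = 0"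
proof -
  let ?a = "legendre m \<kappa> 0" and ?b = "legendre' m \<kappa> 0"
  have "compact (legendre m \<kappa> ` {0..1})" by (intro compact_continuous_image legendre_continuous) auto
  then obtain C where C: "\<And>x. 0 \<le> x \<Longrightarrow> x \<le> 1 \<Longrightarrow> \<bar>legendre m \<kappa> x\<bar> \<le> C"
    by (force dest!: compact_imp_bounded simp: bounded_iff)
  have neg: "equator_coeff m \<kappa> (- \<alpha>) (- \<beta>) n = - equator_coeff m \<kappa> \<alpha> \<beta> n" for \<alpha> \<beta> n
    by (induction m \<kappa> \<alpha> \<beta> n rule: equator_coeff.induct) auto
  have "\<bar>pseries (equator_coeff m \<kappa> ?a ?b) x\<bar> \<le> C" if "0 \<le> x" "x < 1" for x
    using legendre_eq_equator_series[OF that, of m \<kappa>] C[of x] that by simp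
  moreover from this have "\<bar>pseries (equator_coeff m \<kappa> (- ?a) (- ?b)) x\<bar> \<le> C" if "0 \<le> x" "x < 1" for x
    using that unit_disc_conv_equator_coeff[of m \<kappa> ?a ?b] by (simp add: pseries_def neg suminf_minus unit_disc_conv_def)
  ultimately have "connection m \<nu> ?a ?b \<le> 0" "connection m \<nu> (- ?a) (- ?b) \<le> 0"
    unfolding \<kappa>_def using connection_nonpos by blast+
  thus ?thesis unfolding connection_def by simp
qed

text \<open>The Gamma quotient of \<open>S m \<nu>\<close> without the factor \<open>2 tan (\<pi> (m + \<nu>) / 2)\<close>.\<close>

definition gamma_quot :: "nat \<Rightarrow> real \<Rightarrow> real" where
  "gamma_quot m \<nu> = (Gamma ((\<nu> + real m) / 2 + 1) * Gamma ((\<nu> - real m) / 2 + 1)) /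
     (Gamma ((\<nu> + real m + 1) / 2) * Gamma ((\<nu> - real m + 1) / 2))"

lemma rGamma_reflection_real: "rGamma z * rGamma (1 - z :: real) = sin (pi * z) / pi"
proof -
  have "complex_of_real (rGamma z * rGamma (1 - z)) = of_real (sin (pi * z) / pi)"
    using rGamma_reflection_complex[of "of_real z"]
    by (simp flip: rGamma_complex_of_real sin_of_real)
  thus ?thesis by (simp only: of_real_eq_iff)
qed

text \<open>The vanishing of the connection coefficient is a linear relation between value and
  slope at the equator. The reflection formula expresses \<open>rGamma\<close> at \<open>(m - \<nu>) / 2\<close> and at
  \<open>(m - \<nu> + 1) / 2\<close> by \<open>Gamma\<close> at positive arguments; this is where the sine and the
  cosine come from.\<close>

lemma robin_quotient:
  fixes m :: nat and \<nu> :: real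
  defines "\<kappa> \<equiv> (\<nu> - real m) * (\<nu> + real m + 1)"
  assumes "\<nu> \<ge> real m"
  shows "legendre' m \<kappa> 0 * cos (pi * (\<nu> - real m) / 2) = 2 * legendre m \<kappa> 0 * (sin (pi * (\<nu> - real m) / 2) * gamma_quot m \<nu>)"
proof -
  define \<alpha> \<beta> where "\<alpha> = legendre m \<kappa> 0" and "\<beta> = legendre' m \<kappa> 0"
  define t where "t = (\<nu> - real m) / 2"
  define P where "P = (\<nu> + real m + 1) / 2"
  have t: "t \<ge> 0" and P: "P > 0" using assms(2) by (auto simp: t_def P_def)
  have tm: "- t = (real m - \<nu>) / 2" "1/2 - t = (real m - \<nu>) / 2 + 1/2" by (auto simp: t_def field_simps)
  have g: "Gamma x > 0" if "x > 0" for x :: real using that by (rule Gamma_real_pos)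
  have half: "rGamma (3/2 :: real) = 2 * rGamma (1/2)"
    using rGamma_plus1[of "1/2::real"] by simp
  have h0: "rGamma (1/2 :: real) \<noteq> 0" by (simp add: rGamma_inverse_Gamma Gamma_one_half_real)
  have "connection m \<nu> \<alpha> \<beta> = 0" unfolding \<alpha>_def \<beta>_def \<kappa>_def by (rule connection_zero)
  hence "\<alpha> * (rGamma (- t) * rGamma P / rGamma (1/2)) + \<beta> * (rGamma (1/2 - t) * rGamma (P + 1/2) / rGamma (3/2)) = 0"
    unfolding connection_def tm P_def by (simp add: algebra_simps)
  hence *: "2 * \<alpha> * rGamma (- t) * rGamma P + \<beta> * rGamma (1/2 - t) * rGamma (P + 1/2) = 0"
    using h0 unfolding half by (simp add: field_simps)
  have r1: "rGamma (- t) = - sin (pi * t) / pi * Gamma (t + 1)"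
    using rGamma_reflection_real[of "- t"] g[of "t + 1"] t by (simp add: Gamma_def field_simps)
  have r2: "rGamma (1/2 - t) = cos (pi * t) / pi * Gamma (t + 1/2)"
  proof -
    have "sin (pi * (1/2 - t)) = cos (pi * t)" by (simp add: cos_sin_eq algebra_simps)
    thus ?thesis using rGamma_reflection_real[of "1/2 - t"] g[of "t + 1/2"] t by (simp add: Gamma_def field_simps)
  qed
  have "\<beta> * cos (pi * t) * Gamma (t + 1/2) * rGamma (P + 1/2) = 2 * \<alpha> * sin (pi * t) * Gamma (t + 1) * rGamma P"
    using * unfolding r1 r2 by (simp add: field_simps)
  hence "\<beta> * cos (pi * t) = 2 * \<alpha> * (sin (pi * t) * (Gamma (P + 1/2) * Gamma (t + 1) / (Gamma P * Gamma (t + 1/2))))"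
  proof -
    define x y where "x = Gamma (t + 1/2)" and "y = Gamma (P + 1/2)"
    have "x > 0" "y > 0" "Gamma P > 0" using t P by (auto simp: x_def y_def intro!: g)
    moreover assume "\<beta> * cos (pi * t) * Gamma (t + 1/2) * rGamma (P + 1/2) = 2 * \<alpha> * sin (pi * t) * Gamma (t + 1) * rGamma P"
    ultimately show ?thesis unfolding x_def[symmetric] y_def[symmetric] rGamma_inverse_Gamma by (simp add: field_simps)
  qed
  moreover have "Gamma (P + 1/2) * Gamma (t + 1) / (Gamma P * Gamma (t + 1/2)) = gamma_quot m \<nu>"
    unfolding gamma_quot_def P_def t_def by (simp add: add_divide_distrib algebra_simps diff_divide_distrib)
  moreover have "pi * (\<nu> - real m) / 2 = pi * t" by (simp add: t_def)
  ultimately show ?thesis unfolding \<alpha>_def[symmetric] \<beta>_def[symmetric] by simp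
qed

lemma gamma_quot_pos: "\<nu> \<ge> real m \<Longrightarrow> gamma_quot m \<nu> > 0"
  unfolding gamma_quot_def by (intro divide_pos_pos mult_pos_pos Gamma_real_pos add_nonneg_pos) auto

text \<open>Written with sine and cosine instead of the tangent the relation also holds at the
  poles and zeros of \<open>S m\<close>; value and slope never vanish together, nor do sine and
  cosine.\<close>

lemma robin_condition_iff:
  fixes m :: nat and \<nu> \<sigma> :: real
  defines "\<kappa> \<equiv> (\<nu> - real m) * (\<nu> + real m + 1)"
  assumes "\<nu> \<ge> real m"
  shows "legendre' m \<kappa> 0 = \<sigma> * legendre m \<kappa> 0 \<longleftrightarrow> \<sigma> * cos (pi * (\<nu> - real m) / 2) = 2 * (sin (pi * (\<nu> - real m) / 2) * gamma_quot m \<nu>)"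
    (is "?l \<longleftrightarrow> ?r")
proof -
  note eq = robin_quotient[OF assms(2), folded \<kappa>_def]
  have nz: "legendre m \<kappa> 0 \<noteq> 0 \<or> legendre' m \<kappa> 0 \<noteq> 0" by (rule legendre_initial_nonzero)
  show ?thesis
  proof
    assume l: ?l
    hence "legendre m \<kappa> 0 \<noteq> 0" using nz by auto
    moreover have "legendre m \<kappa> 0 * (\<sigma> * cos (pi * (\<nu> - real m) / 2)) = legendre m \<kappa> 0 * (2 * (sin (pi * (\<nu> - real m) / 2) * gamma_quot m \<nu>))"
      using eq unfolding l by (simp add: mult_ac)
    ultimately show ?r by (simp only: mult_cancel_left) auto
  next
    assume r: ?r
    have "cos (pi * (\<nu> - real m) / 2) \<noteq> 0"
    proof
      assume c: "cos (pi * (\<nu> - real m) / 2) = 0"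
      hence "sin (pi * (\<nu> - real m) / 2) = 0" using r gamma_quot_pos[OF assms(2)] by auto
      thus False using c sin_cos_squared_add[of "pi * (\<nu> - real m) / 2"] by simp
    qed
    moreover have "legendre' m \<kappa> 0 * cos (pi * (\<nu> - real m) / 2) = (\<sigma> * legendre m \<kappa> 0) * cos (pi * (\<nu> - real m) / 2)"
      using eq r by (simp add: mult_ac)
    ultimately show ?l by simp
  qed
qed

section \<open>From eigenfunctions to the Robin condition\<close>

lemma norm_sph [simp]: "norm (sph \<theta> \<phi>) = 1"
proof -
  have "(sin \<theta> * cos \<phi>)\<^sup>2 + (sin \<theta> * sin \<phi>)\<^sup>2 + (cos \<theta>)\<^sup>2 = 1"
    by (simp only: power_mult_distrib distrib_left[symmetric] sin_cos_squared_add sin_cos_squared_add2 mult_1_right)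
  hence "(norm (sph \<theta> \<phi>))\<^sup>2 = 1"
    unfolding power2_norm_eq_inner inner_vec_def sum_3 by (simp add: sph_def power2_eq_square)
  thus ?thesis using norm_ge_zero[of "sph \<theta> \<phi>"] by (simp add: power2_eq_1_iff)
qed

lemma sph_components [simp]:
  "sph \<theta> \<phi> $ 1 = sin \<theta> * cos \<phi>" "sph \<theta> \<phi> $ 2 = sin \<theta> * sin \<phi>" "sph \<theta> \<phi> $ 3 = cos \<theta>"
  by (auto simp: sph_def)

lemma sph_in_hemisphere: "0 \<le> \<theta> \<Longrightarrow> \<theta> \<le> pi / 2 \<Longrightarrow> sph \<theta> \<phi> \<in> hemisphere"
  by (auto simp: hemisphere_def intro!: cos_ge_zero)

lemma hemisphere_sph:
  assumes "x \<in> hemisphere"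
  obtains \<theta> \<phi> where "0 \<le> \<theta>" "\<theta> \<le> pi / 2" "x = sph \<theta> \<phi>"
proof -
  have n: "(x $ 1)\<^sup>2 + (x $ 2)\<^sup>2 + (x $ 3)\<^sup>2 = 1" and p: "x $ 3 \<ge> 0"
    using assms power2_norm_eq_inner[of x] by (auto simp: hemisphere_def inner_vec_def sum_3 power2_eq_square)
  have "(x $ 3)\<^sup>2 \<le> 1" using n sum_power2_ge_zero[of "x $ 1" "x $ 2"] by linarith
  hence le: "x $ 3 \<le> 1" using abs_square_le_1[of "x $ 3"] by linarith
  define \<theta> where "\<theta> = arccos (x $ 3)"
  have \<theta>: "0 \<le> \<theta>" "\<theta> \<le> pi / 2" "cos \<theta> = x $ 3"
    using p le arccos_le_pi2[of "x $ 3"] by (auto simp: \<theta>_def arccos_lbound)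
  have s: "(x $ 1)\<^sup>2 + (x $ 2)\<^sup>2 = (sin \<theta>)\<^sup>2"
    using n \<theta>(3) sin_cos_squared_add[of \<theta>] by (simp add: algebra_simps)
  obtain \<phi> where "x $ 1 = sin \<theta> * cos \<phi>" "x $ 2 = sin \<theta> * sin \<phi>"
  proof (cases "sin \<theta> = 0")
    case True
    thus ?thesis using s that[of 0] by (simp add: sum_power2_eq_zero_iff)
  next
    case False
    hence "(x $ 1 / sin \<theta>)\<^sup>2 + (x $ 2 / sin \<theta>)\<^sup>2 = 1"
      using s by (simp add: power_divide add_divide_distrib[symmetric])
    then obtain t where "x $ 1 / sin \<theta> = cos t" "x $ 2 / sin \<theta> = sin t" by (rule sincos_total_2pi)
    thus ?thesis using False by (intro that[of t]) (auto simp: field_simps)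
  qed
  hence "x = sph \<theta> \<phi>" using \<theta>(3) by (simp add: vec_eq_iff forall_3)
  thus ?thesis using \<theta> that by blast
qed

text \<open>The restriction of the separated solution in sector \<open>m\<close> to the meridian \<open>\<phi> = 0\<close>, as
  a function of \<open>\<theta>\<close>.\<close>

definition meridian :: "nat \<Rightarrow> real \<Rightarrow> real \<Rightarrow> real" where
  "meridian m \<kappa> t = sin t ^ m * legendre m \<kappa> (cos t)"
definition meridian' :: "nat \<Rightarrow> real \<Rightarrow> real \<Rightarrow> real" where
  "meridian' m \<kappa> t = real m * sin t ^ (m - 1) * cos t * legendre m \<kappa> (cos t) - sin t ^ (m + 1) * legendre' m \<kappa> (cos t)"

lemma meridian_deriv:
  assumes "cos t > -1"
  shows "(meridian m \<kappa> has_real_derivative meridian' m \<kappa> t) (at t)"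
proof -
  have c: "cos t < 3" using cos_le_one[of t] by linarith
  note d = DERIV_chain2[OF legendre_deriv(1)[OF assms c, of m \<kappa>] DERIV_cos]
  show ?thesis unfolding meridian_def[abs_def] meridian'_def
    by (rule derivative_eq_intros d refl)+ (simp add: algebra_simps)
qed

lemma sin_meridian': "sin t * meridian' m \<kappa> t = real m * sin t ^ m * cos t * legendre m \<kappa> (cos t) - sin t ^ (m + 2) * legendre' m \<kappa> (cos t)"
  unfolding meridian'_def by (cases m) (auto simp: algebra_simps)

text \<open>The Laplace--Beltrami equation in the Sturm--Liouville form
  \<open>sin \<theta> (sin \<theta> Z')' = (m\<^sup>2 - \<mu> sin\<^sup>2 \<theta>) Z\<close>, where \<open>\<mu> = \<kappa> + m (m + 1)\<close>.\<close>

lemma meridian_ode: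
  assumes "cos t > -1" "sin t \<noteq> 0"
  shows "((\<lambda>t. sin t * meridian' m \<kappa> t) has_real_derivative ((real m)\<^sup>2 - (\<kappa> + real m * (real m + 1)) * (sin t)\<^sup>2) * meridian m \<kappa> t / sin t) (at t)"
proof -
  have c: "cos t < 3" using cos_le_one[of t] by linarith
  define s x U U' U'' where "s = sin t" and "x = cos t" and "U = legendre m \<kappa> (cos t)" and "U' = legendre' m \<kappa> (cos t)" and "U'' = legendre'' m \<kappa> (cos t)"
  note d = DERIV_chain2[OF legendre_deriv(1)[OF assms(1) c, of m \<kappa>] DERIV_cos] DERIV_chain2[OF legendre_deriv(2)[OF assms(1) c, of m \<kappa>] DERIV_cos]
  have "((\<lambda>t. sin t * meridian' m \<kappa> t) has_real_derivative 
     (real m * (real m * s ^ (m - 1) * x) * x * U - real m * s ^ m * s * U - real m * s ^ m * x * (U' * s)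
       - (real (m + 2) * s ^ (m + 1) * x * U' - s ^ (m + 2) * (U'' * s)))) (at t)"
    unfolding sin_meridian' s_def x_def U_def U'_def U''_def
    by (rule derivative_eq_intros d refl)+ (simp add: algebra_simps)
  moreover have "real m * (real m * s ^ (m - 1) * x) * x * U - real m * s ^ m * s * U - real m * s ^ m * x * (U' * s)
       - (real (m + 2) * s ^ (m + 1) * x * U' - s ^ (m + 2) * (U'' * s))
      = ((real m)\<^sup>2 - (\<kappa> + real m * (real m + 1)) * s\<^sup>2) * (s ^ m * U) / s"
  proof -
    have s0: "s \<noteq> 0" using assms by (simp add: s_def)
    have x2: "x\<^sup>2 = 1 - s\<^sup>2" unfolding x_def s_def by (simp add: cos_squared_eq)
    have ode: "s\<^sup>2 * U'' = 2 * (real m + 1) * x * U' - \<kappa> * U"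
      using legendre_ode[OF assms(1) c, of m \<kappa>] x2 unfolding U_def U'_def U''_def x_def by simp
    have m1: "real m * s ^ (m - 1) * s = real m * s ^ m" by (cases m) auto
    have "(real m * (real m * s ^ (m - 1) * x) * x * U - real m * s ^ m * s * U - real m * s ^ m * x * (U' * s)
       - (real (m + 2) * s ^ (m + 1) * x * U' - s ^ (m + 2) * (U'' * s))) * s
       = real m * (real m * s ^ (m - 1) * s) * x\<^sup>2 * U - real m * s ^ m * s\<^sup>2 * U - real m * s ^ m * x * U' * s\<^sup>2
       - real (m + 2) * s ^ m * s\<^sup>2 * x * U' + s ^ m * s\<^sup>2 * (s\<^sup>2 * U'')"
      by (simp add: algebra_simps power2_eq_square)
    also have "\<dots> = ((real m)\<^sup>2 - (\<kappa> + real m * (real m + 1)) * s\<^sup>2) * (s ^ m * U)"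
      unfolding m1 x2 ode by (simp add: algebra_simps power2_eq_square)
    finally show ?thesis using s0 by (simp add: field_simps)
  qed
  ultimately show ?thesis unfolding s_def U_def meridian_def by simp
qed

lemma meridian_equator: "meridian m \<kappa> (pi / 2) = legendre m \<kappa> 0" "meridian' m \<kappa> (pi / 2) = - legendre' m \<kappa> 0"
  by (auto simp: meridian_def meridian'_def)

lemma angular_deriv:
  fixes s :: real and c :: complex
  shows "((\<lambda>s. c * exp (\<i> * of_nat m * of_real s)) has_vector_derivative
     c * (\<i> * of_nat m) * exp (\<i> * of_nat m * of_real s)) (at s)"
  by (rule has_vector_derivative_real_field) (auto intro!: derivative_eq_intros)

lemma angular_factor_twice:
  fixes c :: complex
  shows "c * (\<i> * of_nat m) * (\<i> * of_nat m) = - of_nat (m\<^sup>2) * c"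
proof -
  have "c * (\<i> * of_nat m) * (\<i> * of_nat m) = (\<i> * \<i>) * (of_nat m * of_nat m * c)" by (simp only: mult_ac)
  thus ?thesis by (simp add: power2_eq_square)
qed

text \<open>An eigenfunction in a sector is determined by its restriction \<open>Y\<close> to one meridian.
  The \<open>C\<^sup>2\<close> extension beyond the hemisphere makes \<open>Y\<close> and \<open>Y'\<close> differentiable also at the
  pole and at the equator, so that no one-sided derivatives and no asymptotic analysis at
  the pole are needed later.\<close>

lemma sector_profile:
  assumes "robin_eigenfunction \<sigma> \<mu> F" "in_sector (int m) F"
  obtains Y Y' Y'' :: "real \<Rightarrow> complex" where
    "\<And>t. 0 \<le> t \<Longrightarrow> t \<le> pi / 2 \<Longrightarrow> (Y has_vector_derivative Y' t) (at t)"
    "\<And>t. 0 \<le> t \<Longrightarrow> t \<le> pi / 2 \<Longrightarrow> (Y' has_vector_derivative Y'' t) (at t)"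
    "\<And>t. 0 < t \<Longrightarrow> t < pi / 2 \<Longrightarrow> 
       of_real (sin t) * (of_real (cos t) * Y' t + of_real (sin t) * Y'' t) = of_real ((real m)\<^sup>2 - \<mu> * (sin t)\<^sup>2) * Y t"
    "Y' (pi / 2) = - of_real \<sigma> * Y (pi / 2)"
    "\<exists>t\<in>{0..pi/2}. Y t \<noteq> 0"
proof -
  obtain U G where U: "open U" "hemisphere \<subseteq> U" "C2_on U G" and GF: "\<And>x. x \<in> hemisphere \<Longrightarrow> G x = F x"
    using assms(1) unfolding robin_eigenfunction_def C2_hemisphere_def by blast
  obtain G' G'' where G': "\<And>x. x \<in> U \<Longrightarrow> (G has_derivative blinfun_apply (G' x)) (at x)"
    and G'': "\<And>x. x \<in> U \<Longrightarrow> (G' has_derivative blinfun_apply (G'' x)) (at x)"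
    using U(3) unfolding C2_on_def by blast
  define \<gamma> where "\<gamma> = (\<lambda>t. sph t 0)"
  define \<gamma>' :: "real \<Rightarrow> real ^ 3" where "\<gamma>' = (\<lambda>t. cos t *\<^sub>R axis 1 1 - sin t *\<^sub>R axis 3 1)"
  have \<gamma>_eq: "\<gamma> = (\<lambda>t. sin t *\<^sub>R axis 1 1 + cos t *\<^sub>R axis 3 1)"
    by (auto simp: \<gamma>_def fun_eq_iff vec_eq_iff forall_3 axis_def)
  have \<gamma>_der: "(\<gamma> has_vector_derivative \<gamma>' t) (at t)" for t
    unfolding \<gamma>_eq \<gamma>'_def by (auto intro!: derivative_eq_intros)
  have \<gamma>'_der: "(\<gamma>' has_vector_derivative - \<gamma> t) (at t)" for t
    unfolding \<gamma>_eq \<gamma>'_def by (auto intro!: derivative_eq_intros)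
  define Y where "Y = G \<circ> \<gamma>"
  define Y' where "Y' = (\<lambda>t. blinfun_apply (G' (\<gamma> t)) (\<gamma>' t))"
  define Y'' where "Y'' = (\<lambda>t. blinfun_apply (G' (\<gamma> t)) (- \<gamma> t) + blinfun_apply (blinfun_apply (G'' (\<gamma> t)) (\<gamma>' t)) (\<gamma>' t))"
  have in_U: "\<gamma> t \<in> U" if "0 \<le> t" "t \<le> pi / 2" for t
    using sph_in_hemisphere[OF that] U by (auto simp: \<gamma>_def)
  have Y1: "(Y has_vector_derivative Y' t) (at t)" if "0 \<le> t" "t \<le> pi / 2" for t
    unfolding Y_def Y'_def
    by (rule vector_derivative_diff_chain_within[OF \<gamma>_der]) (rule has_derivative_at_withinI[OF G'[OF in_U[OF that]]])
  have Y2: "(Y' has_vector_derivative Y'' t) (at t)" if "0 \<le> t" "t \<le> pi / 2" for t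
  proof -
    have "((G' \<circ> \<gamma>) has_vector_derivative blinfun_apply (G'' (\<gamma> t)) (\<gamma>' t)) (at t)"
      by (rule vector_derivative_diff_chain_within[OF \<gamma>_der]) (rule has_derivative_at_withinI[OF G''[OF in_U[OF that]]])
    from bounded_bilinear.has_vector_derivative[OF bounded_bilinear_blinfun_apply this \<gamma>'_der]
    show ?thesis unfolding Y'_def Y''_def by (simp add: o_def)
  qed
  have FY: "F (sph t 0) = Y t" if "0 \<le> t" "t \<le> pi / 2" for t
    using GF[OF sph_in_hemisphere[OF that]] by (simp add: Y_def \<gamma>_def)
  obtain f where f: "\<And>\<theta> \<phi>. 0 \<le> \<theta> \<Longrightarrow> \<theta> \<le> pi / 2 \<Longrightarrow> F (sph \<theta> \<phi>) = exp (\<i> * of_nat m * of_real \<phi>) * f (cos \<theta>)"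
    using assms(2) unfolding in_sector_def by auto
  have fY: "f (cos t) = Y t" if "0 \<le> t" "t \<le> pi / 2" for t
    using f[OF that, of 0] FY[OF that] by simp
  have ode: "of_real (sin \<theta>) * (of_real (cos \<theta>) * Y' \<theta> + of_real (sin \<theta>) * Y'' \<theta>) = of_real ((real m)\<^sup>2 - \<mu> * (sin \<theta>)\<^sup>2) * Y \<theta>"
    if \<theta>: "0 < \<theta>" "\<theta> < pi / 2" for \<theta>
  proof -
    have inner: "vector_derivative (\<lambda>t. F (sph t 0)) (at s) = Y' s" if "s \<in> {0<..<pi/2}" for s
      by (rule vector_derivative_at, rule has_vector_derivative_transform_within_open[of Y _ _ "{0<..<pi/2}"])
         (use that in \<open>auto intro!: Y1 FY[symmetric]\<close>)
    have 1: "vector_derivative (\<lambda>s. sin s *\<^sub>R vector_derivative (\<lambda>t. F (sph t 0)) (at s)) (at \<theta>) = sin \<theta> *\<^sub>R Y'' \<theta> + cos \<theta> *\<^sub>R Y' \<theta>"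
    proof (rule vector_derivative_at, rule has_vector_derivative_transform_within_open[of "\<lambda>s. sin s *\<^sub>R Y' s" _ _ "{0<..<pi/2}"])
      show "((\<lambda>s. sin s *\<^sub>R Y' s) has_vector_derivative sin \<theta> *\<^sub>R Y'' \<theta> + cos \<theta> *\<^sub>R Y' \<theta>) (at \<theta>)"
        using \<theta> by (auto intro!: derivative_eq_intros Y2)
    qed (use \<theta> inner in auto)
    have F\<theta>: "(\<lambda>t. F (sph \<theta> t)) = (\<lambda>t. Y \<theta> * exp (\<i> * of_nat m * of_real t))"
    proof (rule ext)
      fix t show "F (sph \<theta> t) = Y \<theta> * exp (\<i> * of_nat m * of_real t)"
        using f[of \<theta> t] fY[of \<theta>] \<theta> by (simp add: mult.commute)
    qed
    have 2: "vector_derivative (\<lambda>s. vector_derivative (\<lambda>t. F (sph \<theta> t)) (at s)) (at 0) = - of_nat (m\<^sup>2) * Y \<theta>"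
      unfolding F\<theta> vector_derivative_at[OF angular_deriv] angular_factor_twice by simp
    have "laplace_beltrami F \<theta> 0 + of_real \<mu> * F (sph \<theta> 0) = 0"
      using assms(1) \<theta> unfolding robin_eigenfunction_def by blast
    hence "(sin \<theta> *\<^sub>R Y'' \<theta> + cos \<theta> *\<^sub>R Y' \<theta>) /\<^sub>R sin \<theta> + (- of_nat (m\<^sup>2) * Y \<theta>) /\<^sub>R (sin \<theta>)\<^sup>2 + of_real \<mu> * Y \<theta> = 0"
      unfolding laplace_beltrami_def 1 2 using FY[of \<theta>] \<theta> by simp
    moreover have "sin \<theta> > 0" using \<theta> by (intro sin_gt_zero) auto
    ultimately have *: "(of_real (sin \<theta>) * Y'' \<theta> + of_real (cos \<theta>) * Y' \<theta>) / of_real (sin \<theta>) + (- of_nat (m\<^sup>2) * Y \<theta>) / (of_real (sin \<theta>))\<^sup>2 + of_real \<mu> * Y \<theta> = 0"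
      by (simp add: scaleR_conv_of_real divide_inverse mult_ac)
    have clear: "s\<^sup>2 * (A / s + B / s\<^sup>2 + C) = s * A + B + s\<^sup>2 * C" if "s \<noteq> 0" for s A B C :: complex
      using that by (simp add: field_simps power2_eq_square)
    have s0: "complex_of_real (sin \<theta>) \<noteq> 0" using \<open>sin \<theta> > 0\<close> by simp
    have "of_real (sin \<theta>) * (of_real (sin \<theta>) * Y'' \<theta> + of_real (cos \<theta>) * Y' \<theta>) + (- of_nat (m\<^sup>2) * Y \<theta>) + (of_real (sin \<theta>))\<^sup>2 * (of_real \<mu> * Y \<theta>) = 0"
      unfolding clear[OF s0, symmetric] * by simp
    thus ?thesis by (simp add: algebra_simps)
  qed
  have normal: "Y' (pi / 2) = - of_real \<sigma> * Y (pi / 2)"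
  proof -
    have "((\<lambda>\<theta>. F (sph \<theta> 0)) has_vector_derivative Y' (pi / 2)) (at (pi / 2) within {0..pi / 2})"
      by (rule has_vector_derivative_transform[OF _ _ has_vector_derivative_at_within[OF Y1]]) (auto intro!: FY)
    from vector_derivative_within_closed_interval[OF _ _ this]
    have "normal_derivative F 0 = Y' (pi / 2)"
      unfolding normal_derivative_def by simp
    moreover have "normal_derivative F 0 + of_real \<sigma> * F (sph (pi / 2) 0) = 0"
      using assms(1) unfolding robin_eigenfunction_def by blast
    ultimately have "Y' (pi / 2) + of_real \<sigma> * Y (pi / 2) = 0" using FY[of "pi/2"] by simp
    thus ?thesis by (simp add: eq_neg_iff_add_eq_0)
  qed
  obtain x where x: "x \<in> hemisphere" "F x \<noteq> 0" using assms(1) unfolding robin_eigenfunction_def by blast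
  obtain \<theta> \<phi> where \<theta>: "0 \<le> \<theta>" "\<theta> \<le> pi / 2" "x = sph \<theta> \<phi>" using hemisphere_sph[OF x(1)] .
  have "Y \<theta> \<noteq> 0" using x(2) \<theta> f[OF \<theta>(1,2), of \<phi>] fY[OF \<theta>(1,2)] by auto
  with \<theta> have nz: "\<exists>t\<in>{0..pi/2}. Y t \<noteq> 0" by auto
  show ?thesis by (rule that[OF Y1 Y2 ode normal nz])
qed

text \<open>The profile \<open>Y\<close> of the eigenfunction and the regular solution \<open>Z\<close> solve the same
  equation, so \<open>W = sin \<theta> (Z' Y - Z Y')\<close> is constant. Since \<open>Y\<close>, \<open>Y'\<close>, \<open>Z\<close> and \<open>Z'\<close> are
  continuous at the pole, the factor \<open>sin \<theta>\<close> forces \<open>W = 0\<close>. At the equator this reads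
  \<open>(\<sigma> v(0) - v'(0)) Y = 0\<close>, and \<open>Y\<close> cannot vanish there: with the Robin condition \<open>Y'\<close>
  would vanish as well, and \<open>Y\<close> would be zero.\<close>

lemma spectrum_imp_robin_condition:
  assumes "robin_eigenfunction \<sigma> \<mu> F" "in_sector (int m) F"
  defines "\<kappa> \<equiv> \<mu> - real m * (real m + 1)"
  shows "legendre' m \<kappa> 0 = \<sigma> * legendre m \<kappa> 0"
proof -
  obtain Y Y' Y'' :: "real \<Rightarrow> complex" where
    Y1: "\<And>t. 0 \<le> t \<Longrightarrow> t \<le> pi / 2 \<Longrightarrow> (Y has_vector_derivative Y' t) (at t)" and
    Y2: "\<And>t. 0 \<le> t \<Longrightarrow> t \<le> pi / 2 \<Longrightarrow> (Y' has_vector_derivative Y'' t) (at t)" and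
    ode: "\<And>t. 0 < t \<Longrightarrow> t < pi / 2 \<Longrightarrow> 
       of_real (sin t) * (of_real (cos t) * Y' t + of_real (sin t) * Y'' t) = of_real ((real m)\<^sup>2 - \<mu> * (sin t)\<^sup>2) * Y t" and
    bc: "Y' (pi / 2) = - of_real \<sigma> * Y (pi / 2)" and
    nz: "\<exists>t\<in>{0..pi/2}. Y t \<noteq> 0"
    by (rule sector_profile[OF assms(1,2)]) blast
  have contY: "continuous_on {0..pi/2} Y" "continuous_on {0..pi/2} Y'"
    by (auto intro!: continuous_at_imp_continuous_on has_vector_derivative_continuous Y1 Y2)
  have cos1: "cos t > -1" if "0 \<le> t" "t \<le> pi / 2" for t
    using cos_ge_zero[of t] that by linarith
  have sin0: "sin t > 0" if "0 < t" "t \<le> pi / 2" for t using that by (intro sin_gt_zero) auto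
  define T where "T = (\<lambda>t. sin t * meridian' m \<kappa> t)"
  define W where "W = (\<lambda>t. of_real (T t) * Y t - of_real (meridian m \<kappa> t) * (of_real (sin t) * Y' t))"
  have contZ: "continuous_on {0..pi/2} (meridian m \<kappa>)"
    by (auto intro!: continuous_at_imp_continuous_on DERIV_isCont meridian_deriv cos1)
  have contT: "continuous_on {0..pi/2} T"
    unfolding T_def sin_meridian' using cos1 cos_le_one
    by (intro continuous_intros continuous_on_compose2[where f = cos and g = "legendre m \<kappa>" and t = "{-1<..<3}"]
              continuous_on_compose2[where f = cos and g = "legendre' m \<kappa>" and t = "{-1<..<3}"])
       (auto intro!: continuous_at_imp_continuous_on DERIV_isCont legendre_deriv simp: le_less_trans[OF cos_le_one])
  have "W (pi / 2) = 0"
  proof (rule has_derivative_zero_unique_strong_interval[of "{0, pi/2}" 0 "pi/2" W 0])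
    show "continuous_on {0..pi/2} W" unfolding W_def
      by (intro continuous_intros contT contZ contY)
    show "W 0 = 0" by (cases m) (auto simp: W_def T_def meridian'_def meridian_def)
    fix t assume t: "t \<in> {0..pi/2} - {0, pi/2}"
    hence t': "0 < t" "t < pi / 2" by auto
    have s0: "sin t > 0" using t' by (intro sin0) auto
    define a where "a = (real m)\<^sup>2 - \<mu> * (sin t)\<^sup>2"
    have dT: "(T has_vector_derivative a * meridian m \<kappa> t / sin t) (at t)"
      using meridian_ode[of t m \<kappa>] cos1[of t] s0 t' unfolding has_real_derivative_iff_has_vector_derivative[symmetric] T_def a_def \<kappa>_def
      by auto
    have dZ: "(meridian m \<kappa> has_vector_derivative meridian' m \<kappa> t) (at t)"
      using meridian_deriv[of t m \<kappa>] cos1[of t] t' unfolding has_real_derivative_iff_has_vector_derivative[symmetric] by auto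
    have dsin: "((\<lambda>t. of_real (sin t) :: complex) has_vector_derivative of_real (cos t)) (at t)"
      by (intro has_vector_derivative_of_real) (auto intro!: derivative_eq_intros)
    have "(W has_vector_derivative 
        of_real (T t) * Y' t + of_real (a * meridian m \<kappa> t / sin t) * Y t
        - (of_real (meridian m \<kappa> t) * (of_real (sin t) * Y'' t + of_real (cos t) * Y' t) + of_real (meridian' m \<kappa> t) * (of_real (sin t) * Y' t))) (at t)"
      unfolding W_def
      by (intro has_vector_derivative_diff has_vector_derivative_mult has_vector_derivative_of_real dsin)
         (use t' Y1 Y2 dT dZ in \<open>auto simp: has_real_derivative_iff_has_vector_derivative\<close>)
    moreover have "of_real (T t) * Y' t + of_real (a * meridian m \<kappa> t / sin t) * Y t
        - (of_real (meridian m \<kappa> t) * (of_real (sin t) * Y'' t + of_real (cos t) * Y' t) + of_real (meridian' m \<kappa> t) * (of_real (sin t) * Y' t)) = 0" (is "?e = 0")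
    proof -
      have "of_real (sin t) * ?e = of_real (meridian m \<kappa> t) * (of_real a * Y t - of_real (sin t) * (of_real (cos t) * Y' t + of_real (sin t) * Y'' t))"
        using s0 by (simp add: T_def field_simps)
      also have "\<dots> = 0" unfolding ode[OF t'] a_def by simp
      finally show ?thesis using s0 by simp
    qed
    ultimately have "(W has_vector_derivative 0) (at t)" by simp
    thus "(W has_derivative (\<lambda>h. 0)) (at t within {0..pi/2})"
      by (auto simp: has_vector_derivative_def intro: has_derivative_at_withinI)
  qed auto
  hence W: "(of_real (\<sigma> * legendre m \<kappa> 0 - legendre' m \<kappa> 0)) * Y (pi / 2) = 0"
    by (simp add: W_def T_def meridian_equator bc algebra_simps)
  have "Y (pi / 2) \<noteq> 0"
  proof
    assume Y0: "Y (pi / 2) = 0"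
    have zero: "Y e = 0" if e: "0 < e" "e \<le> pi / 2" for e
    proof -
      define s0 where "s0 = sin e"
      have s0: "s0 > 0" unfolding s0_def by (rule sin0[OF e])
      define K where "K = 1 / s0 + (real m)\<^sup>2 / s0\<^sup>2 + \<bar>\<mu>\<bar>"
      have K: "K \<ge> 0" unfolding K_def using s0 by (intro add_nonneg_nonneg) auto
      show ?thesis
      proof (rule linear_ode_unique[of e "pi/2" Y Y' Y'' K "pi/2"])
        show "continuous_on {e..pi/2} Y" "continuous_on {e..pi/2} Y'"
          using e by (auto intro: continuous_on_subset[OF contY(1)] continuous_on_subset[OF contY(2)])
        show "norm (Y'' t) \<le> K * (norm (Y t) + norm (Y' t))" if t: "e < t" "t < pi / 2" for t
        proof -
          have st: "s0 \<le> sin t" unfolding s0_def using t e by (intro sin_monotone_2pi_le) auto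
          hence st0: "sin t > 0" using s0 by linarith
          have "of_real ((sin t)\<^sup>2) * Y'' t = of_real ((real m)\<^sup>2 - \<mu> * (sin t)\<^sup>2) * Y t - of_real (sin t * cos t) * Y' t"
            using ode[of t] t e by (simp add: algebra_simps power2_eq_square)
          hence "Y'' t = (of_real ((real m)\<^sup>2 - \<mu> * (sin t)\<^sup>2) * Y t - of_real (sin t * cos t) * Y' t) / of_real ((sin t)\<^sup>2)"
            using st0 by (simp add: eq_divide_eq mult_ac)
          also have "\<dots> = of_real ((real m)\<^sup>2 / (sin t)\<^sup>2 - \<mu>) * Y t - of_real (cos t / sin t) * Y' t"
            using st0 by (simp add: field_simps power2_eq_square)
          finally have "norm (Y'' t) \<le> \<bar>(real m)\<^sup>2 / (sin t)\<^sup>2 - \<mu>\<bar> * norm (Y t) + \<bar>cos t / sin t\<bar> * norm (Y' t)"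
            by (metis norm_triangle_ineq4 norm_mult norm_of_real)
          also have "\<dots> \<le> K * norm (Y t) + K * norm (Y' t)"
          proof (intro add_mono mult_right_mono)
            have 1: "(real m)\<^sup>2 / (sin t)\<^sup>2 \<le> (real m)\<^sup>2 / s0\<^sup>2"
              using st s0 by (intro divide_left_mono power_mono) auto
            have 2: "\<bar>cos t / sin t\<bar> \<le> 1 / s0"
              unfolding abs_divide using st s0 by (intro frac_le) auto
            have 3: "(real m)\<^sup>2 / (sin t)\<^sup>2 \<ge> 0" "(real m)\<^sup>2 / s0\<^sup>2 \<ge> 0" "1 / s0 \<ge> 0" using s0 by auto
            show "\<bar>(real m)\<^sup>2 / (sin t)\<^sup>2 - \<mu>\<bar> \<le> K" unfolding K_def using 1 3 by linarith
            show "\<bar>cos t / sin t\<bar> \<le> K" unfolding K_def using 2 3 by linarith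
          qed auto
          finally show ?thesis by (simp add: algebra_simps)
        qed
      qed (use e K Y0 bc in \<open>auto intro!: Y1 Y2\<close>)
    qed
    have "Y 0 = 0"
    proof -
      have "(Y \<longlongrightarrow> Y 0) (at_right 0)"
        using has_vector_derivative_continuous[OF Y1[of 0]] by (auto simp: continuous_at intro: tendsto_within_subset)
      moreover have ev: "eventually (\<lambda>t. Y t = 0) (at_right 0)"
        using eventually_at_right_real[of 0 "pi/2", OF pi_half_gt_zero] by eventually_elim (auto intro: zero)
      ultimately have "((\<lambda>t::real. 0::complex) \<longlongrightarrow> Y 0) (at_right 0)"
        using tendsto_cong[OF ev] by simp
      thus ?thesis using tendsto_const tendsto_unique trivial_limit_at_right_real by blast
    qed
    from nz obtain t where t: "0 \<le> t" "t \<le> pi / 2" "Y t \<noteq> 0" by auto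
    show False using zero[of t] \<open>Y 0 = 0\<close> t by (cases "t = 0") auto
  qed
  with W have "complex_of_real (\<sigma> * legendre m \<kappa> 0 - legendre' m \<kappa> 0) = 0" by (simp only: mult_eq_0_iff) auto
  hence "\<sigma> * legendre m \<kappa> 0 - legendre' m \<kappa> 0 = 0" by (simp only: of_real_eq_0_iff)
  thus ?thesis by simp
qed

section \<open>Construction of eigenfunctions\<close>

definition horizontal :: "real ^ 3 \<Rightarrow> complex" where "horizontal x = of_real (x $ 1) + \<i> * of_real (x $ 2)"

text \<open>In Cartesian coordinates \<open>e\<^sup>i\<^sup>m\<^sup>\<phi> sin\<^sup>m \<theta>\<close> is the polynomial \<open>(x\<^sub>1 + i x\<^sub>2)\<^sup>m\<close>, so
  this extension of the separated solution is smooth across the pole and across the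
  equator.\<close>

definition mode_function :: "nat \<Rightarrow> (real \<Rightarrow> real) \<Rightarrow> real ^ 3 \<Rightarrow> complex" where
  "mode_function j w x = horizontal x ^ j * of_real (w (x $ 3))"

text \<open>The derivative of a mode function is a combination of these two covectors. As
  functions of their coefficient they are bounded linear, so that this derivative of a
  mode function is a linear image of mode functions and can be differentiated by the same
  rule.\<close>

definition proj_covector :: "complex \<Rightarrow> (real ^ 3) \<Rightarrow>\<^sub>L complex" where
  "proj_covector a = blinfun_mult_right a o\<^sub>L Blinfun horizontal"
definition height_covector :: "complex \<Rightarrow> (real ^ 3) \<Rightarrow>\<^sub>L complex" where
  "height_covector a = blinfun_mult_right a o\<^sub>L Blinfun (\<lambda>x. of_real (x $ 3))"

lemma bounded_linear_horizontal: "bounded_linear horizontal"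
  unfolding horizontal_def[abs_def]
  by (intro bounded_linear_add bounded_linear_compose[OF bounded_linear_of_real bounded_linear_vec_nth]
        bounded_linear_compose[OF bounded_linear_mult_right bounded_linear_compose[OF bounded_linear_of_real bounded_linear_vec_nth]])

lemma bounded_linear_vertical: "bounded_linear (\<lambda>x::real^3. complex_of_real (x $ 3))"
  by (intro bounded_linear_compose[OF bounded_linear_of_real bounded_linear_vec_nth])

lemma proj_covector_apply [simp]: "blinfun_apply (proj_covector a) h = a * horizontal h"
  by (simp add: proj_covector_def bounded_linear_Blinfun_apply[OF bounded_linear_horizontal])
lemma height_covector_apply [simp]: "blinfun_apply (height_covector a) h = a * of_real (h $ 3)"
  by (simp add: height_covector_def bounded_linear_Blinfun_apply[OF bounded_linear_vertical])

lemma bounded_linear_proj_covector: "bounded_linear proj_covector"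
  unfolding proj_covector_def[abs_def]
  by (rule bounded_linear_compose[OF bounded_bilinear.bounded_linear_left[OF bounded_bilinear_blinfun_compose] bounded_linear_blinfun_mult_right])
lemma bounded_linear_height_covector: "bounded_linear height_covector"
  unfolding height_covector_def[abs_def]
  by (rule bounded_linear_compose[OF bounded_bilinear.bounded_linear_left[OF bounded_bilinear_blinfun_compose] bounded_linear_blinfun_mult_right])

definition mode_gradient :: "nat \<Rightarrow> (real \<Rightarrow> real) \<Rightarrow> (real \<Rightarrow> real) \<Rightarrow> real ^ 3 \<Rightarrow> (real ^ 3) \<Rightarrow>\<^sub>L complex" where
  "mode_gradient j w w' x = proj_covector (of_nat j * mode_function (j - 1) w x) + height_covector (mode_function j w' x)"

lemma mode_function_deriv:
  assumes "(w has_real_derivative w' (x $ 3)) (at (x $ 3))"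
  shows "(mode_function j w has_derivative blinfun_apply (mode_gradient j w w' x)) (at x)"
proof -
  have 1: "((\<lambda>x. horizontal x) has_derivative horizontal) (at x)"
    by (rule bounded_linear.has_derivative[OF bounded_linear_horizontal]) (rule has_derivative_ident)
  have "((\<lambda>x. w (x $ 3)) has_derivative (\<lambda>h. h $ 3 * w' (x $ 3))) (at x)"
  proof -
    have "((\<lambda>x. x $ 3) has_derivative (\<lambda>h. h $ 3)) (at x)"
      by (rule bounded_linear.has_derivative[OF bounded_linear_vec_nth]) (rule has_derivative_ident)
    from has_derivative_compose[OF this assms[unfolded has_field_derivative_def]]
    show ?thesis by (simp add: mult.commute)
  qed
  hence 2: "((\<lambda>x. complex_of_real (w (x $ 3))) has_derivative (\<lambda>h. of_real (h $ 3 * w' (x $ 3)))) (at x)"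
    by (rule has_derivative_of_real)
  show ?thesis unfolding mode_function_def[abs_def]
    by (rule has_derivative_eq_rhs[OF has_derivative_mult[OF has_derivative_power[OF 1] 2]])
       (auto simp: fun_eq_iff mode_gradient_def blinfun.add_left mode_function_def algebra_simps)
qed

lemma mode_function_C2:
  assumes w: "\<And>s. s \<in> I \<Longrightarrow> (w has_real_derivative w' s) (at s)" "\<And>s. s \<in> I \<Longrightarrow> (w' has_real_derivative w'' s) (at s)"
    and cont: "continuous_on I w''"
  shows "C2_on {x. x $ 3 \<in> I} (mode_function j w)"
proof -
  define D2 where "D2 = (\<lambda>x. (Blinfun proj_covector o\<^sub>L (real j *\<^sub>R mode_gradient (j - 1) w w' x)) + (Blinfun height_covector o\<^sub>L mode_gradient j w' w'' x))"
  have "(mode_gradient j w w' has_derivative blinfun_apply (D2 x)) (at x)" if "x $ 3 \<in> I" for x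
  proof -
    note d = mode_function_deriv[of w w' x, OF w(1)[OF that]] mode_function_deriv[of w' w'' x, OF w(2)[OF that]]
    have "((\<lambda>x. proj_covector (real j *\<^sub>R mode_function (j - 1) w x) + height_covector (mode_function j w' x)) has_derivative blinfun_apply (D2 x)) (at x)"
      by (rule has_derivative_eq_rhs[OF has_derivative_add[OF 
           bounded_linear.has_derivative[OF bounded_linear_proj_covector has_derivative_scaleR_right[OF d(1)]] 
           bounded_linear.has_derivative[OF bounded_linear_height_covector d(2)]]])
         (auto simp: fun_eq_iff D2_def blinfun.add_left blinfun.scaleR_left bounded_linear_Blinfun_apply[OF bounded_linear_proj_covector] bounded_linear_Blinfun_apply[OF bounded_linear_height_covector])
    thus ?thesis unfolding mode_gradient_def[abs_def] by (simp add: scaleR_conv_of_real)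
  qed
  moreover have "(mode_function j w has_derivative blinfun_apply (mode_gradient j w w' x)) (at x)" if "x $ 3 \<in> I" for x
    using mode_function_deriv[of w w' x, OF w(1)[OF that]] .
  moreover have "continuous_on {x. x $ 3 \<in> I} D2"
  proof -
    have h: "continuous_on A horizontal" for A by (intro linear_continuous_on bounded_linear_horizontal)
    have c: "continuous_on {x::real^3. x $ 3 \<in> I} (mode_function k v)" if "continuous_on I v" for k v
      unfolding mode_function_def[abs_def]
      by (intro continuous_intros h continuous_on_compose2[OF that]) auto
    have cw: "continuous_on I w" "continuous_on I w'"
      using w by (auto intro!: continuous_at_imp_continuous_on DERIV_isCont)
    show ?thesis unfolding D2_def mode_gradient_def
      by (intro continuous_intros bounded_linear.continuous_on[OF bounded_linear_proj_covector] bounded_linear.continuous_on[OF bounded_linear_height_covector]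
           bounded_bilinear.continuous_on[OF bounded_bilinear_blinfun_compose] c cw cont)
  qed
  ultimately show ?thesis unfolding C2_on_def by blast
qed

lemma horizontal_sph: "horizontal (sph \<theta> \<phi>) = of_real (sin \<theta>) * exp (\<i> * of_real \<phi>)"
  by (simp add: horizontal_def exp_Euler sin_of_real cos_of_real algebra_simps)

lemma mode_function_sph:
  "mode_function m (legendre m \<kappa>) (sph \<theta> \<phi>) = of_real (meridian m \<kappa> \<theta>) * exp (\<i> * of_nat m * of_real \<phi>)"
  by (simp add: mode_function_def horizontal_sph meridian_def power_mult_distrib exp_of_nat_mult[symmetric] mult_ac)

text \<open>The mode function of the regular solution is smooth at the pole and at the equator.
  Its angular factor cancels from the Laplace--Beltrami equation and from the Robin
  condition, which become the equation of the meridian profile and the assumption.\<close>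

lemma robin_condition_imp_spectrum:
  fixes m :: nat and \<mu> \<sigma> :: real
  defines "\<kappa> \<equiv> \<mu> - real m * (real m + 1)"
  assumes bc: "legendre' m \<kappa> 0 = \<sigma> * legendre m \<kappa> 0"
  shows "(m, \<mu>) \<in> desym_spectrum \<sigma>"
proof -
  define F where "F = mode_function m (legendre m \<kappa>)"
  have F: "F (sph \<theta> \<phi>) = of_real (meridian m \<kappa> \<theta>) * exp (\<i> * of_nat m * of_real \<phi>)" for \<theta> \<phi>
    unfolding F_def by (rule mode_function_sph)
  have "in_sector (int m) F" unfolding in_sector_def
  proof (intro exI[of _ "\<lambda>x. of_real (sqrt (1 - x\<^sup>2) ^ m * legendre m \<kappa> x)"] allI impI)
    fix \<theta> \<phi> :: real assume "0 \<le> \<theta> \<and> \<theta> \<le> pi / 2"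
    hence "sin \<theta> \<ge> 0" by (intro sin_ge_zero) auto
    hence "sqrt (1 - (cos \<theta>)\<^sup>2) = sin \<theta>" by (simp add: sin_squared_eq[symmetric])
    thus "F (sph \<theta> \<phi>) = exp (\<i> * of_int (int m) * of_real \<phi>) * of_real (sqrt (1 - (cos \<theta>)\<^sup>2) ^ m * legendre m \<kappa> (cos \<theta>))"
      unfolding F meridian_def by simp
  qed
  moreover have "C2_hemisphere F" unfolding C2_hemisphere_def
  proof (intro exI[of _ "{x. x $ 3 \<in> {-1<..<3}}"] exI[of _ F] conjI ballI)
    show "open {x::real^3. x $ 3 \<in> {-1<..<3}}"
      using continuous_open_vimage[of "{-1<..<3}" "\<lambda>x::real^3. x $ 3"]
      by (simp add: vimage_def continuous_on_component open_vimage)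
    show "hemisphere \<subseteq> {x. x $ 3 \<in> {-1<..<3}}"
    proof
      fix x assume "x \<in> hemisphere"
      hence "norm x = 1" "x $ 3 \<ge> 0" by (auto simp: hemisphere_def)
      thus "x \<in> {x. x $ 3 \<in> {-1<..<3}}" using component_le_norm_cart[of x 3] by auto
    qed
    show "C2_on {x. x $ 3 \<in> {-1<..<3}} F" unfolding F_def
      by (rule mode_function_C2) (auto intro!: legendre_deriv continuous_at_imp_continuous_on)
  qed auto
  moreover have "\<exists>x\<in>hemisphere. F x \<noteq> 0"
  proof (rule bexI)
    have "legendre m \<kappa> 0 \<noteq> 0" using legendre_initial_nonzero[of m \<kappa>] bc by auto
    thus "F (sph (pi / 2) 0) \<noteq> 0" unfolding F meridian_equator by simp
  qed (auto intro: sph_in_hemisphere)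
  moreover have "laplace_beltrami F \<theta> \<phi> + of_real \<mu> * F (sph \<theta> \<phi>) = 0" if \<theta>: "0 < \<theta>" "\<theta> < pi / 2" for \<theta> \<phi>
  proof -
    define e where "e = exp (\<i> * complex_of_nat m * complex_of_real \<phi>)"
    define E where "E = ((real m)\<^sup>2 - \<mu> * (sin \<theta>)\<^sup>2) * meridian m \<kappa> \<theta> / sin \<theta>"
    have s: "sin \<theta> > 0" using \<theta> by (intro sin_gt_zero) auto
    have cs: "cos s > -1" if "s \<in> {0<..<pi/2}" for s using cos_gt_zero[of s] that by auto
    have inner: "vector_derivative (\<lambda>t. F (sph t \<phi>)) (at s) = of_real (meridian' m \<kappa> s) * e" if "s \<in> {0<..<pi/2}" for s
      unfolding F e_def[symmetric]
      by (rule vector_derivative_at, rule has_vector_derivative_mult_left, rule has_vector_derivative_of_real) 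
         (use meridian_deriv[OF cs[OF that], of m \<kappa>] in \<open>simp flip: has_real_derivative_iff_has_vector_derivative\<close>)
    have 1: "vector_derivative (\<lambda>s. sin s *\<^sub>R vector_derivative (\<lambda>t. F (sph t \<phi>)) (at s)) (at \<theta>) = of_real E * e"
    proof (rule vector_derivative_at, rule has_vector_derivative_transform_within_open[of "\<lambda>s. of_real (sin s * meridian' m \<kappa> s) * e" _ _ "{0<..<pi/2}"])
      show "((\<lambda>s. of_real (sin s * meridian' m \<kappa> s) * e) has_vector_derivative of_real E * e) (at \<theta>)"
        by (rule has_vector_derivative_mult_left, rule has_vector_derivative_of_real)
           (use meridian_ode[of \<theta> m \<kappa>] cs[of \<theta>] \<theta> s in \<open>simp add: E_def \<kappa>_def flip: has_real_derivative_iff_has_vector_derivative\<close>)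
    qed (use \<theta> in \<open>auto simp: inner scaleR_conv_of_real\<close>)
    have 2: "vector_derivative (\<lambda>s. vector_derivative (\<lambda>t. F (sph \<theta> t)) (at s)) (at \<phi>) = of_real (- ((real m)\<^sup>2) * meridian m \<kappa> \<theta>) * e"
      unfolding F vector_derivative_at[OF angular_deriv] angular_factor_twice e_def by simp
    have "laplace_beltrami F \<theta> \<phi> + of_real \<mu> * F (sph \<theta> \<phi>) = of_real (E / sin \<theta> + - ((real m)\<^sup>2) * meridian m \<kappa> \<theta> / (sin \<theta>)\<^sup>2 + \<mu> * meridian m \<kappa> \<theta>) * e"
      unfolding laplace_beltrami_def 1 2 unfolding F e_def[symmetric]
      by (simp add: scaleR_conv_of_real divide_inverse algebra_simps)
    also have "E / sin \<theta> + - ((real m)\<^sup>2) * meridian m \<kappa> \<theta> / (sin \<theta>)\<^sup>2 + \<mu> * meridian m \<kappa> \<theta> = 0"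
      using s unfolding E_def by (simp add: field_simps power2_eq_square)
    finally show ?thesis by simp
  qed
  moreover have "normal_derivative F \<phi> + of_real \<sigma> * F (sph (pi / 2) \<phi>) = 0" for \<phi>
  proof -
    define e where "e = exp (\<i> * complex_of_nat m * complex_of_real \<phi>)"
    have "((\<lambda>\<theta>. F (sph \<theta> \<phi>)) has_vector_derivative of_real (meridian' m \<kappa> (pi/2)) * e) (at (pi/2))"
      unfolding F e_def[symmetric]
      by (rule has_vector_derivative_mult_left, rule has_vector_derivative_of_real) 
         (use meridian_deriv[of "pi/2" m \<kappa>] in \<open>simp flip: has_real_derivative_iff_has_vector_derivative\<close>)
    from vector_derivative_within_closed_interval[OF _ _ has_vector_derivative_at_within[OF this], of 0 "pi/2"]
    have "normal_derivative F \<phi> = of_real (meridian' m \<kappa> (pi/2)) * e" unfolding normal_derivative_def by simp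
    thus ?thesis unfolding F meridian_equator e_def[symmetric] bc by (simp add: algebra_simps)
  qed
  ultimately show ?thesis unfolding desym_spectrum_def robin_eigenfunction_def by blast
qed

lemma desym_spectrum_iff:
  "(m, \<mu>) \<in> desym_spectrum \<sigma> \<longleftrightarrow> legendre' m (\<mu> - real m * (real m + 1)) 0 = \<sigma> * legendre m (\<mu> - real m * (real m + 1)) 0"
  using robin_condition_imp_spectrum[of m \<mu> \<sigma>] spectrum_imp_robin_condition[of \<sigma> \<mu> _ m]
  unfolding desym_spectrum_def by blast

text \<open>Negative \<open>\<kappa>\<close> is excluded by the signs at the equator. For \<open>\<kappa> \<ge> 0\<close> the number
  \<open>\<nu> = (sqrt (1 + 4 \<mu>) - 1) / 2\<close> is real and at least \<open>m\<close>.\<close>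

lemma desym_spectrum_roots:
  assumes "\<sigma> \<ge> 0"
  shows "(m, \<mu>) \<in> desym_spectrum \<sigma> \<longleftrightarrow>
    (\<exists>\<nu>\<ge>real m. \<mu> = \<nu> * (\<nu> + 1) \<and> \<sigma> * cos (pi * (\<nu> - real m) / 2) = 2 * (sin (pi * (\<nu> - real m) / 2) * gamma_quot m \<nu>))"
    (is "_ \<longleftrightarrow> (\<exists>\<nu>\<ge>real m. \<mu> = \<nu> * (\<nu> + 1) \<and> ?R \<nu>)")
proof -
  have factor: "\<nu> * (\<nu> + 1) - real m * (real m + 1) = (\<nu> - real m) * (\<nu> + real m + 1)" for \<nu>
    by (simp add: algebra_simps)
  show ?thesis
  proof
    assume l: "(m, \<mu>) \<in> desym_spectrum \<sigma>"
    define \<kappa> where "\<kappa> = \<mu> - real m * (real m + 1)"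
    have eq: "legendre' m \<kappa> 0 = \<sigma> * legendre m \<kappa> 0" using l unfolding desym_spectrum_iff \<kappa>_def .
    have "\<kappa> \<ge> 0"
    proof (rule ccontr)
      assume "\<not> \<kappa> \<ge> 0"
      hence "legendre m \<kappa> 0 > 0" "legendre' m \<kappa> 0 < 0" using legendre_signs_of_neg by auto
      thus False using eq assms by (smt (verit) mult_nonneg_nonneg)
    qed
    hence \<mu>: "real m * (real m + 1) \<le> \<mu>" by (simp add: \<kappa>_def)
    define \<nu> where "\<nu> = (sqrt (1 + 4 * \<mu>) - 1) / 2"
    have sq: "(2 * real m + 1)\<^sup>2 \<le> 1 + 4 * \<mu>" using \<mu> by (simp add: power2_eq_square algebra_simps)
    have "2 * real m + 1 \<le> sqrt (1 + 4 * \<mu>)" by (rule real_le_rsqrt[OF sq])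
    hence \<nu>: "\<nu> \<ge> real m" by (simp add: \<nu>_def)
    have "(sqrt (1 + 4 * \<mu>))\<^sup>2 = 1 + 4 * \<mu>" using order_trans[OF zero_le_power2 sq] by (rule real_sqrt_pow2)
    hence \<mu>\<nu>: "\<mu> = \<nu> * (\<nu> + 1)" unfolding \<nu>_def by (simp add: field_simps power2_eq_square)
    show "\<exists>\<nu>\<ge>real m. \<mu> = \<nu> * (\<nu> + 1) \<and> ?R \<nu>"
      using eq \<nu> \<mu>\<nu> robin_condition_iff[OF \<nu>, of \<sigma>] factor[of \<nu>] unfolding \<kappa>_def by auto
  next
    assume "\<exists>\<nu>\<ge>real m. \<mu> = \<nu> * (\<nu> + 1) \<and> ?R \<nu>"
    thus "(m, \<mu>) \<in> desym_spectrum \<sigma>"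
      unfolding desym_spectrum_iff using factor robin_condition_iff[of m _ \<sigma>] by auto
  qed
qed

section \<open>Roots of the secular equation\<close>

definition gamma_step :: "real \<Rightarrow> real" where "gamma_step x = Gamma (x + 1/2) / Gamma x"

lemma gamma_step_pos: "x > 0 \<Longrightarrow> gamma_step x > 0"
  unfolding gamma_step_def by (intro divide_pos_pos Gamma_real_pos) auto

lemma gamma_step_deriv:
  assumes "x > 0"
  shows "(gamma_step has_real_derivative gamma_step x * (Digamma (x + 1/2) - Digamma x)) (at x)"
proof -
  have "Gamma x > 0" "Gamma (x + 1/2) > 0" using assms by (auto intro!: Gamma_real_pos)
  moreover have "x \<notin> \<int>\<^sub>\<le>\<^sub>0" "x + 1/2 \<notin> \<int>\<^sub>\<le>\<^sub>0" using assms by (auto elim!: nonpos_Ints_cases)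
  ultimately show ?thesis unfolding gamma_step_def[abs_def]
    by (auto intro!: derivative_eq_intros simp: field_simps)
qed

text \<open>The logarithmic derivative is a difference of values of the increasing function
  \<open>Digamma\<close>.\<close>

lemma gamma_step_mono:
  assumes "0 < x" "x \<le> y" shows "gamma_step x \<le> gamma_step y"
proof (rule DERIV_nonneg_imp_nondecreasing[OF assms(2)])
  fix t assume t: "x \<le> t" "t \<le> y"
  have t0: "t > 0" using t assms by linarith
  have "gamma_step t * (Digamma (t + 1/2) - Digamma t) \<ge> 0"
    using gamma_step_pos[OF t0] Digamma_real_mono[of t "t + 1/2"] t0 by (intro mult_nonneg_nonneg) auto
  with gamma_step_deriv[OF t0] show "\<exists>d. (gamma_step has_real_derivative d) (at t) \<and> d \<ge> 0" by blast
qed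

lemma gamma_quot_eq_gamma_step: "gamma_quot m \<nu> = gamma_step ((\<nu> + real m + 1) / 2) * gamma_step ((\<nu> - real m + 1) / 2)"
  unfolding gamma_quot_def gamma_step_def by (simp add: add_divide_distrib diff_divide_distrib add_ac)

lemma gamma_quot_mono: "real m \<le> x \<Longrightarrow> x \<le> y \<Longrightarrow> gamma_quot m x \<le> gamma_quot m y"
  unfolding gamma_quot_eq_gamma_step by (intro mult_mono gamma_step_mono less_imp_le[OF gamma_step_pos]) auto

lemma gamma_quot_continuous:
  assumes "a \<ge> real m"
  shows "continuous_on {a..b} (gamma_quot m)"
proof -
  have step_cont: "continuous_on {0<..} gamma_step"
    by (auto intro!: continuous_at_imp_continuous_on DERIV_isCont gamma_step_deriv)
  show ?thesis unfolding gamma_quot_eq_gamma_step[abs_def]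
    by (intro continuous_intros continuous_on_compose2[OF step_cont]) (use assms in auto)
qed

text \<open>The functional equation of Gamma gives \<open>P / (P - 1/2)\<close> and \<open>Q / (Q - 1/2)\<close> times a
  common factor, with \<open>P = (\<nu> + m) / 2 + 1\<close> larger than \<open>Q = (\<nu> - m) / 2\<close>. This is what
  orders the eigenvalues inside a cluster and makes them distinct.\<close>

lemma gamma_quot_shift:
  assumes "\<nu> > real (m + 2)"
  shows "gamma_quot (m + 2) \<nu> < gamma_quot m \<nu>"
proof -
  \<comment> \<open>up to shifts by \<open>1\<close> the Gamma arguments are \<open>P\<close>, \<open>Q\<close>, \<open>P - 1/2\<close> and \<open>Q - 1/2\<close>\<close>
  define P where "P = (\<nu> + real m) / 2 + 1"
  define Q where "Q = (\<nu> - real m) / 2"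
  have Q: "Q > 1" and P: "P > 2" using assms by (auto simp: P_def Q_def)
  have g: "Gamma P > 0" "Gamma Q > 0" "Gamma (P - 1/2) > 0" "Gamma (Q - 1/2) > 0"
    using P Q by (auto intro!: Gamma_real_pos)
  have n: "P \<notin> \<int>\<^sub>\<le>\<^sub>0" "Q \<notin> \<int>\<^sub>\<le>\<^sub>0" "P - 1/2 \<notin> \<int>\<^sub>\<le>\<^sub>0" "Q - 1/2 \<notin> \<int>\<^sub>\<le>\<^sub>0"
    using P Q by (auto elim!: nonpos_Ints_cases)
  have "Gamma (Q - 1/2 + 1) = (Q - 1/2) * Gamma (Q - 1/2)" "Gamma (P - 1/2 + 1) = (P - 1/2) * Gamma (P - 1/2)"
    by (fact Gamma_plus1[OF n(4)], fact Gamma_plus1[OF n(3)])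
  moreover have "Q - 1/2 + 1 = (\<nu> - real m + 1) / 2" "P - 1/2 + 1 = (\<nu> + real (m + 2) + 1) / 2" 
    by (auto simp: P_def Q_def field_simps)
  ultimately have e: "Gamma ((\<nu> - real m + 1) / 2) = (Q - 1/2) * Gamma (Q - 1/2)" 
     "Gamma ((\<nu> + real (m + 2) + 1) / 2) = (P - 1/2) * Gamma (P - 1/2)" by simp_all
  have e2: "(\<nu> + real (m + 2)) / 2 + 1 = P + 1" "(\<nu> - real (m + 2)) / 2 + 1 = Q" 
     "(\<nu> - real (m + 2) + 1) / 2 = Q - 1/2" "(\<nu> + real m + 1) / 2 = P - 1/2"
     "(\<nu> + real m) / 2 + 1 = P" "(\<nu> - real m) / 2 + 1 = Q + 1"
    by (auto simp: P_def Q_def field_simps)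
  define c where "c = Gamma P * Gamma Q / (Gamma (P - 1/2) * Gamma (Q - 1/2))"
  have c: "c > 0" unfolding c_def using g by (intro divide_pos_pos mult_pos_pos)
  have "gamma_quot (m + 2) \<nu> = c * (P / (P - 1/2))"
    unfolding gamma_quot_def e e2 Gamma_plus1[OF n(1)] c_def by (simp only: times_divide_times_eq) (simp only: mult_ac)
  moreover have "gamma_quot m \<nu> = c * (Q / (Q - 1/2))"
    unfolding gamma_quot_def e e2 Gamma_plus1[OF n(2)] c_def by (simp only: times_divide_times_eq) (simp only: mult_ac)
  moreover have "P / (P - 1/2) < Q / (Q - 1/2)"
  proof -
    have "P - Q = real m + 1" unfolding P_def Q_def by (simp add: field_simps)
    hence "P > Q" using of_nat_0_le_iff[of m, where 'a = real] by linarith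
    thus ?thesis using P Q by (simp add: divide_less_eq less_divide_eq) (simp add: field_simps)
  qed
  ultimately show ?thesis using c by (simp only: mult_strict_left_mono)
qed

text \<open>The equation \<open>S m \<nu> = \<sigma>\<close> on \<open>(l, l + 1)\<close> cleared of denominators; for \<open>\<sigma> = 0\<close> the
  root is \<open>\<nu> = l\<close>, so that the Neumann problem is included.\<close>

definition secular :: "real \<Rightarrow> nat \<Rightarrow> nat \<Rightarrow> real \<Rightarrow> real" where
  "secular \<sigma> l m \<nu> = 2 * (sin (pi * (\<nu> - real l) / 2) * gamma_quot m \<nu>) - \<sigma> * cos (pi * (\<nu> - real l) / 2)"

lemma secular_strict_mono:
  assumes "\<sigma> \<ge> 0" "m \<le> l" "real l \<le> x" "x < y" "y \<le> real l + 1"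
  shows "secular \<sigma> l m x < secular \<sigma> l m y"
proof -
  define a b where "a = pi * (x - real l) / 2" and "b = pi * (y - real l) / 2"
  have "pi * (y - real l) \<le> pi * 1" using assms by (intro mult_left_mono) auto
  hence ab: "0 \<le> a" "a < b" "b \<le> pi / 2" using assms by (auto simp: a_def b_def)
  have G: "gamma_quot m x > 0" "gamma_quot m x \<le> gamma_quot m y" using assms by (auto intro!: gamma_quot_pos gamma_quot_mono)
  have s: "sin a < sin b" using ab by (intro sin_monotone_2pi) auto
  have sb: "sin b \<ge> 0" using ab by (intro sin_ge_zero) auto
  have "sin a * gamma_quot m x < sin b * gamma_quot m x" using s G by simp
  also have "\<dots> \<le> sin b * gamma_quot m y" using G sb by (intro mult_left_mono) auto
  finally have "sin a * gamma_quot m x < sin b * gamma_quot m y" .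
  moreover have "\<sigma> * cos b \<le> \<sigma> * cos a" using ab assms by (intro mult_left_mono cos_monotone_0_pi_le) auto
  ultimately show ?thesis unfolding secular_def a_def b_def by linarith
qed

lemma secular_root_unique:
  assumes "\<sigma> \<ge> 0" "m \<le> l" "real l \<le> x" "x \<le> real l + 1" "secular \<sigma> l m x = 0"
    "real l \<le> y" "y \<le> real l + 1" "secular \<sigma> l m y = 0"
  shows "x = y"
  using secular_strict_mono[OF assms(1,2), of x y] secular_strict_mono[OF assms(1,2), of y x] assms
  by (cases x y rule: linorder_cases) auto

lemma secular_left: "secular \<sigma> l m (real l) = - \<sigma>"
  by (simp add: secular_def)

lemma secular_right: "m \<le> l \<Longrightarrow> secular \<sigma> l m (real l + 1) > 0"
  using gamma_quot_pos[of m "real l + 1"] by (simp add: secular_def)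

lemma secular_root_exists:
  assumes "\<sigma> \<ge> 0" "m \<le> l"
  obtains \<nu> where "real l \<le> \<nu>" "\<nu> < real l + 1" "secular \<sigma> l m \<nu> = 0"
proof -
  have "continuous_on {real l..real l + 1} (secular \<sigma> l m)"
    unfolding secular_def[abs_def] using assms(2) by (intro continuous_intros gamma_quot_continuous) auto
  then obtain \<nu> where \<nu>: "real l \<le> \<nu>" "\<nu> \<le> real l + 1" "secular \<sigma> l m \<nu> = 0"
    using IVT'[of "secular \<sigma> l m" "real l" 0 "real l + 1"] secular_left[of \<sigma> l m] secular_right[OF assms(2), of \<sigma>] assms(1) by auto
  moreover have "\<nu> \<noteq> real l + 1" using \<nu>(3) secular_right[OF assms(2), of \<sigma>] by auto
  ultimately show ?thesis using that by force
qed

definition root_of :: "real \<Rightarrow> nat \<Rightarrow> nat \<Rightarrow> real" where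
  "root_of \<sigma> l m = (THE \<nu>. real l \<le> \<nu> \<and> \<nu> < real l + 1 \<and> secular \<sigma> l m \<nu> = 0)"

lemma root_of_eqI:
  assumes "\<sigma> \<ge> 0" "m \<le> l" "real l \<le> \<nu>" "\<nu> < real l + 1" "secular \<sigma> l m \<nu> = 0"
  shows "root_of \<sigma> l m = \<nu>"
  unfolding root_of_def
proof (rule the_equality)
  show "x = \<nu>" if "real l \<le> x \<and> x < real l + 1 \<and> secular \<sigma> l m x = 0" for x
    using that assms by (intro secular_root_unique[of \<sigma> m l x \<nu>]) auto
qed (use assms in auto)

lemma root_of:
  assumes "\<sigma> \<ge> 0" "m \<le> l"
  shows "real l \<le> root_of \<sigma> l m" "root_of \<sigma> l m < real l + 1" "secular \<sigma> l m (root_of \<sigma> l m) = 0"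
proof -
  obtain \<nu> where \<nu>: "real l \<le> \<nu>" "\<nu> < real l + 1" "secular \<sigma> l m \<nu> = 0" using secular_root_exists[OF assms] .
  have "root_of \<sigma> l m = \<nu>" by (rule root_of_eqI[OF assms \<nu>])
  with \<nu> show "real l \<le> root_of \<sigma> l m" "root_of \<sigma> l m < real l + 1" "secular \<sigma> l m (root_of \<sigma> l m) = 0" by auto
qed

lemma root_of_0: "m \<le> l \<Longrightarrow> root_of 0 l m = real l"
  by (rule root_of_eqI) (auto simp: secular_left)

lemma quarter_turn:
  assumes "0 \<le> x" "x < 1"
  shows "0 \<le> pi * x / 2" "x \<noteq> 0 \<Longrightarrow> 0 < pi * x / 2" "pi * x / 2 < pi / 2"
  using assms mult_strict_left_mono[OF assms(2) pi_gt_zero] by auto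

text \<open>Since \<open>l + m\<close> is even, \<open>tan\<close> has the same value at \<open>\<pi> (m + \<nu>) / 2\<close> and at
  \<open>\<pi> (\<nu> - l) / 2\<close>, and the latter angle lies in the first quadrant.\<close>

lemma S_eq_iff_secular:
  assumes "m \<le> l" "m mod 2 = l mod 2" "real l < \<nu>" "\<nu> < real l + 1"
  shows "S m \<nu> = \<sigma> \<longleftrightarrow> secular \<sigma> l m \<nu> = 0"
proof -
  define t where "t = pi * (\<nu> - real l) / 2"
  have t: "0 < t" "t < pi / 2" unfolding t_def using quarter_turn[of "\<nu> - real l"] assms by auto
  have c: "cos t > 0" using t by (intro cos_gt_zero) auto
  have "even (l + m)" using assms(2) by presburger
  then obtain k where k: "l + m = 2 * k" by (elim evenE)
  have "real (l + m) = 2 * real k" unfolding k by simp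
  hence m: "real m = 2 * real k - real l" by simp
  have eq: "pi * (real m + \<nu>) / 2 = t + real k * pi" unfolding t_def m by (simp add: field_simps)
  have "tan (pi * (real m + \<nu>) / 2) = tan t" unfolding eq by (rule tan_periodic_nat)
  hence "S m \<nu> = 2 * tan t * gamma_quot m \<nu>" unfolding S_def gamma_quot_def by simp
  thus ?thesis unfolding secular_def t_def[symmetric] tan_def using c by (auto simp: field_simps)
qed

lemma nu_eq_root_of:
  assumes "\<sigma> > 0" "m \<le> l" "m mod 2 = l mod 2"
  shows "nu l m \<sigma> = root_of \<sigma> l m"
  unfolding nu_def
proof (rule the_equality)
  have \<sigma>: "\<sigma> \<ge> 0" using assms by simp
  note r = root_of[OF \<sigma> assms(2)]
  have "root_of \<sigma> l m \<noteq> real l" using r(3) secular_left[of \<sigma> l m] assms(1) by auto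
  with r have l: "real l < root_of \<sigma> l m" by simp
  show "real l < root_of \<sigma> l m \<and> root_of \<sigma> l m < real l + 1 \<and> S m (root_of \<sigma> l m) = \<sigma>"
    using S_eq_iff_secular[OF assms(2,3) l r(2)] l r by auto
  show "\<nu> = root_of \<sigma> l m" if "real l < \<nu> \<and> \<nu> < real l + 1 \<and> S m \<nu> = \<sigma>" for \<nu>
    using that S_eq_iff_secular[OF assms(2,3), of \<nu> \<sigma>] by (intro root_of_eqI[symmetric] \<sigma> assms) auto
qed

text \<open>Raising \<open>m\<close> lowers the Gamma quotient, and \<open>secular\<close> increases in \<open>\<nu>\<close>, so the root
  moves to the right.\<close>

lemma root_of_less:
  assumes "\<sigma> > 0" "m + 2 \<le> l"
  shows "root_of \<sigma> l m < root_of \<sigma> l (m + 2)"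
proof (rule ccontr)
  assume neg: "\<not> ?thesis"
  let ?a = "root_of \<sigma> l m" and ?b = "root_of \<sigma> l (m + 2)"
  have \<sigma>: "\<sigma> \<ge> 0" and m: "m \<le> l" using assms by auto
  note a = root_of[OF \<sigma> m] and b = root_of[OF \<sigma> assms(2)]
  have "?b \<noteq> real l" using b(3) secular_left[of \<sigma> l "m + 2"] assms(1) by auto
  hence bl: "real l < ?b" using b by simp
  hence "gamma_quot (m + 2) ?b < gamma_quot m ?b" using assms(2) by (intro gamma_quot_shift) linarith
  moreover have "sin (pi * (?b - real l) / 2) > 0" using bl b mult_strict_left_mono[of "?b - real l" 2 pi] by (intro sin_gt_zero) auto
  ultimately have "secular \<sigma> l (m + 2) ?b < secular \<sigma> l m ?b" unfolding secular_def by simp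
  moreover have "secular \<sigma> l m ?b \<le> secular \<sigma> l m ?a"
    using secular_strict_mono[OF \<sigma> m, of ?b ?a] neg a b bl by (cases "?b = ?a") auto
  ultimately show False using a(3) b(3) by simp
qed

text \<open>Write \<open>\<nu> = l + x\<close> with \<open>0 \<le> x < 1\<close>. If \<open>l - m\<close> is even, the angle \<open>\<pi> (\<nu> - m) / 2\<close> is
  \<open>\<pi> x / 2\<close> up to a multiple of \<open>\<pi>\<close>. If it is odd, a further quarter turn gives the two
  sides opposite signs and there is no root.\<close>

lemma spectrum_parity:
  assumes "\<sigma> \<ge> 0" "\<nu> \<ge> real m"
  shows "\<sigma> * cos (pi * (\<nu> - real m) / 2) = 2 * (sin (pi * (\<nu> - real m) / 2) * gamma_quot m \<nu>) \<longleftrightarrow>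
     (\<exists>l. m \<le> l \<and> m mod 2 = l mod 2 \<and> \<nu> = root_of \<sigma> l m)" (is "?L \<longleftrightarrow> ?R")
proof -
  have even_case: "?L \<longleftrightarrow> secular \<sigma> l m \<nu> = 0" if "m \<le> l" "m mod 2 = l mod 2" for l
  proof -
    define t where "t = pi * (\<nu> - real l) / 2"
    have "even (l - m)" using that by presburger
    then obtain k where "l - m = 2 * k" by (elim evenE)
    hence k: "l = m + 2 * k" using that(1) by simp
    have eq: "pi * (\<nu> - real m) / 2 = t + real k * pi" unfolding t_def k by (simp add: field_simps)
    have "sin (pi * (\<nu> - real m) / 2) = (-1) ^ k * sin t" "cos (pi * (\<nu> - real m) / 2) = (-1) ^ k * cos t"
      unfolding eq by (auto simp: sin_add cos_add mult.commute)
    hence "?L \<longleftrightarrow> (-1) ^ k * (\<sigma> * cos t) = (-1) ^ k * (2 * (sin t * gamma_quot m \<nu>))" by (simp add: mult_ac)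
    thus ?thesis unfolding secular_def t_def[symmetric] by auto
  qed
  \<comment> \<open>without the common sign \<open>(-1) ^ k\<close> the left side is nonpositive and the right side is positive\<close>
  have odd_case: "\<not> ?L" if l: "m \<le> l" "m mod 2 \<noteq> l mod 2" "real l \<le> \<nu>" "\<nu> < real l + 1" for l
  proof
    assume L: ?L
    define t where "t = pi * (\<nu> - real l) / 2"
    have t: "0 \<le> t" "t < pi / 2" unfolding t_def using quarter_turn[of "\<nu> - real l"] l by auto
    have "odd (l - m)" using l by presburger
    then obtain k where "l - m = 2 * k + 1" by (rule oddE)
    hence k: "l = m + (2 * k + 1)" using l(1) by simp
    have eq: "pi * (\<nu> - real m) / 2 = (t + pi / 2) + real k * pi" unfolding t_def k by (simp add: field_simps)
    have "sin (pi * (\<nu> - real m) / 2) = (-1) ^ k * cos t" "cos (pi * (\<nu> - real m) / 2) = (-1) ^ k * (- sin t)"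
      unfolding eq by (auto simp: sin_add[of _ "real k * pi"] cos_add[of _ "real k * pi"] mult.commute) (auto simp: sin_add cos_add)
    with L have "(-1) ^ k * (\<sigma> * (- sin t)) = (-1) ^ k * (2 * (cos t * gamma_quot m \<nu>))" by (simp add: mult_ac)
    hence "\<sigma> * (- sin t) = 2 * (cos t * gamma_quot m \<nu>)" by (simp only: mult_cancel_left) auto
    moreover have "cos t * gamma_quot m \<nu> > 0" using t assms(2) by (intro mult_pos_pos gamma_quot_pos cos_gt_zero_pi) auto
    moreover have "\<sigma> * sin t \<ge> 0" using t assms(1) by (intro mult_nonneg_nonneg sin_ge_zero) auto
    ultimately show False by simp
  qed
  show ?thesis
  proof
    assume L: ?L
    define l where "l = nat \<lfloor>\<nu>\<rfloor>"
    have \<nu>0: "\<nu> \<ge> 0" using assms(2) by (smt (verit) of_nat_0_le_iff)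
    have l: "real l \<le> \<nu>" "\<nu> < real l + 1" using \<nu>0 unfolding l_def by (auto simp: of_nat_nat)
    have ml: "m \<le> l" using assms(2) unfolding l_def by (simp add: le_nat_floor)
    have par: "m mod 2 = l mod 2" using odd_case[OF ml _ l] L by blast
    hence "secular \<sigma> l m \<nu> = 0" using even_case[OF ml] L by blast
    hence "\<nu> = root_of \<sigma> l m" using l ml assms by (intro root_of_eqI[symmetric]) auto
    with ml par show ?R by blast
  next
    assume ?R
    then obtain l where l: "m \<le> l" "m mod 2 = l mod 2" "\<nu> = root_of \<sigma> l m" by blast
    thus ?L using even_case[OF l(1,2)] root_of(3)[OF assms(1) l(1)] by simp
  qed
qed

section \<open>Ordering the spectrum\<close>

definition robin_level :: "real \<Rightarrow> nat \<Rightarrow> nat \<Rightarrow> real" where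
  "robin_level \<sigma> l m = root_of \<sigma> l m * (root_of \<sigma> l m + 1)"

lemma desym_spectrum_eq:
  assumes "\<sigma> \<ge> 0"
  shows "(m, \<mu>) \<in> desym_spectrum \<sigma> \<longleftrightarrow> (\<exists>l. m \<le> l \<and> m mod 2 = l mod 2 \<and> \<mu> = robin_level \<sigma> l m)"
proof
  assume "(m, \<mu>) \<in> desym_spectrum \<sigma>"
  thus "\<exists>l. m \<le> l \<and> m mod 2 = l mod 2 \<and> \<mu> = robin_level \<sigma> l m"
    unfolding desym_spectrum_roots[OF assms] robin_level_def using spectrum_parity[OF assms] by blast
next
  assume "\<exists>l. m \<le> l \<and> m mod 2 = l mod 2 \<and> \<mu> = robin_level \<sigma> l m"
  then obtain l where l: "m \<le> l" "m mod 2 = l mod 2" "\<mu> = robin_level \<sigma> l m" by blast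
  have "real m \<le> root_of \<sigma> l m" using root_of(1)[OF assms l(1)] l(1) by linarith
  thus "(m, \<mu>) \<in> desym_spectrum \<sigma>"
    unfolding desym_spectrum_roots[OF assms] using spectrum_parity[OF assms, of m "root_of \<sigma> l m"] l unfolding robin_level_def by blast
qed

text \<open>The levels of degree \<open>l\<close> lie in the half-open interval from \<open>l (l + 1)\<close> to
  \<open>(l + 1) (l + 2)\<close>, so clusters of different degree are disjoint and ordered.\<close>

lemma robin_level_bounds:
  assumes "\<sigma> \<ge> 0" "m \<le> l"
  shows "real (l * (l + 1)) \<le> robin_level \<sigma> l m" "robin_level \<sigma> l m < real ((l + 1) * (l + 2))"
proof -
  note r = root_of(1,2)[OF assms]
  have "real l * (real l + 1) \<le> root_of \<sigma> l m * (root_of \<sigma> l m + 1)" using r by (intro mult_mono) auto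
  thus "real (l * (l + 1)) \<le> robin_level \<sigma> l m" by (simp add: robin_level_def algebra_simps)
  have "root_of \<sigma> l m * (root_of \<sigma> l m + 1) < (real l + 1) * (real l + 2)"
    using r by (intro mult_strict_mono) auto
  thus "robin_level \<sigma> l m < real ((l + 1) * (l + 2))" by (simp add: robin_level_def algebra_simps)
qed

lemma robin_level_determines_degree:
  assumes "\<sigma> \<ge> 0" "m \<le> l" "m' \<le> l'" "robin_level \<sigma> l m = robin_level \<sigma> l' m'"
  shows "l = l'"
proof (rule ccontr)
  have less: False if "l < l'" "m \<le> l" "m' \<le> l'" "robin_level \<sigma> l m = robin_level \<sigma> l' m'" for l l' m m'
  proof -
    have "(l + 1) * (l + 2) \<le> l' * (l' + 1)" using that(1) by (intro mult_mono) auto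
    hence "real ((l + 1) * (l + 2)) \<le> real (l' * (l' + 1))" by (simp only: of_nat_le_iff)
    with robin_level_bounds(2)[OF assms(1) that(2)] robin_level_bounds(1)[OF assms(1) that(3)] that(4) show False by linarith
  qed
  assume "l \<noteq> l'"
  thus False using less[of l l' m m'] less[of l' l m' m] assms by (cases l l' rule: linorder_cases) auto
qed

lemma robin_level_0: "m \<le> l \<Longrightarrow> robin_level 0 l m = real (l * (l + 1))"
  by (simp add: robin_level_def root_of_0 algebra_simps)

lemma robin_level_strict_mono:
  assumes "\<sigma> > 0" "m + 2 \<le> l"
  shows "robin_level \<sigma> l m < robin_level \<sigma> l (m + 2)"
proof -
  have "root_of \<sigma> l m \<ge> 0" using root_of(1)[of \<sigma> m l] assms by (smt (verit) of_nat_0_le_iff add_leD1 less_imp_le)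
  thus ?thesis using root_of_less[OF assms] unfolding robin_level_def by (intro mult_strict_mono) auto
qed

lemma Lam_eq_robin_level: "\<sigma> > 0 \<Longrightarrow> m \<le> l \<Longrightarrow> m mod 2 = l mod 2 \<Longrightarrow> Lam l m \<sigma> = robin_level \<sigma> l m"
  by (simp add: Lam_def robin_level_def nu_eq_root_of)

text \<open>The number of eigenvalues in the clusters of degree less than \<open>l\<close>. A slot \<open>(l, k)\<close>
  stands for the \<open>k\<close>-th eigenvalue of cluster \<open>l\<close>, counted from \<open>0\<close>; \<open>slot_index\<close> is its
  position in the ordered spectrum and \<open>slot_mode\<close> its sector.\<close>

definition cluster_start :: "nat \<Rightarrow> nat" where "cluster_start l = (\<Sum>i<l. i div 2 + 1)"

definition slots :: "(nat \<times> nat) set" where "slots = {(l, k). k \<le> l div 2}"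

definition slot_index :: "nat \<times> nat \<Rightarrow> nat" where "slot_index p = cluster_start (fst p) + snd p"

definition slot_mode :: "nat \<times> nat \<Rightarrow> nat" where "slot_mode p = fst p mod 2 + 2 * snd p"

lemma slot_index_bij: "bij_betw slot_index slots UNIV"
  unfolding bij_betw_def
proof
  have less: "slot_index (l, k) < slot_index (l', k')" if "l < l'" "k \<le> l div 2" for l l' k k'
  proof -
    have "slot_index (l, k) < cluster_start (Suc l)" using that by (simp add: slot_index_def cluster_start_def)
    also have "\<dots> \<le> cluster_start l'" unfolding cluster_start_def using that by (intro sum_mono2) auto
    finally show ?thesis by (simp add: slot_index_def)
  qed
  show "inj_on slot_index slots"
  proof (rule inj_onI, clarify)
    fix l k l' k' assume *: "(l, k) \<in> slots" "(l', k') \<in> slots" "slot_index (l, k) = slot_index (l', k')"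
    have "l = l'" using less[of l l' k k'] less[of l' l k' k] * by (cases l l' rule: linorder_cases) (auto simp: slots_def)
    thus "l = l' \<and> k = k'" using *(3) by (simp add: slot_index_def)
  qed
  have "\<exists>p\<in>slots. n = slot_index p" for n
  proof (induction n)
    case 0
    show ?case by (rule bexI[of _ "(0, 0)"]) (auto simp: slot_index_def cluster_start_def slots_def)
  next
    case (Suc n)
    then obtain l k where p: "k \<le> l div 2" "n = slot_index (l, k)" by (auto simp: slots_def)
    show ?case
    proof (cases "k < l div 2")
      case True
      thus ?thesis using p by (intro bexI[of _ "(l, Suc k)"]) (auto simp: slots_def slot_index_def)
    next
      case False
      thus ?thesis using p by (intro bexI[of _ "(Suc l, 0)"]) (auto simp: slots_def slot_index_def cluster_start_def)
    qed
  qed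
  thus "slot_index ` slots = UNIV" by blast
qed

lemma slot_mode_props: "p \<in> slots \<Longrightarrow> slot_mode p \<le> fst p" "slot_mode p mod 2 = fst p mod 2"
  unfolding slot_mode_def slots_def by (auto, presburger)

lemma slot_mode_surj:
  assumes "m \<le> l" "m mod 2 = l mod 2"
  shows "(l, m div 2) \<in> slots" "slot_mode (l, m div 2) = m"
  using assms unfolding slots_def slot_mode_def by (auto simp: div_le_mono) presburger

definition slot_of :: "nat \<Rightarrow> nat \<times> nat" where "slot_of = inv_into slots slot_index"

lemma slot_of: "slot_of n \<in> slots" "slot_index (slot_of n) = n" "p \<in> slots \<Longrightarrow> slot_of (slot_index p) = p"
  using slot_index_bij unfolding bij_betw_def slot_of_def
  by (auto intro!: inv_into_into f_inv_into_f inv_into_f_f)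

definition enum_spec :: "real \<Rightarrow> nat \<Rightarrow> nat \<times> real" where
  "enum_spec \<sigma> n = (slot_mode (slot_of n), robin_level \<sigma> (fst (slot_of n)) (slot_mode (slot_of n)))"

lemma enum_spec_bij:
  assumes "\<sigma> \<ge> 0"
  shows "bij_betw (enum_spec \<sigma>) UNIV (desym_spectrum \<sigma>)"
  unfolding bij_betw_def
proof
  show "inj (enum_spec \<sigma>)"
  proof (rule injI)
    fix n n' assume eq: "enum_spec \<sigma> n = enum_spec \<sigma> n'"
    have "fst (slot_of n) = fst (slot_of n')"
      by (rule robin_level_determines_degree[OF assms slot_mode_props(1)[OF slot_of(1)] slot_mode_props(1)[OF slot_of(1)]])
         (use eq in \<open>auto simp: enum_spec_def\<close>)
    moreover from this have "snd (slot_of n) = snd (slot_of n')" using eq by (auto simp: enum_spec_def slot_mode_def)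
    ultimately have "slot_of n = slot_of n'" by (simp add: prod_eq_iff)
    thus "n = n'" by (metis slot_of(2))
  qed
  show "range (enum_spec \<sigma>) = desym_spectrum \<sigma>"
  proof (intro set_eqI iffI)
    fix x assume "x \<in> range (enum_spec \<sigma>)"
    then obtain n where "x = enum_spec \<sigma> n" by blast
    thus "x \<in> desym_spectrum \<sigma>"
      using slot_mode_props(1)[OF slot_of(1)] slot_mode_props(2) unfolding enum_spec_def
      by (auto simp: desym_spectrum_eq[OF assms])
  next
    fix x assume x: "x \<in> desym_spectrum \<sigma>"
    obtain m \<mu> where [simp]: "x = (m, \<mu>)" by (cases x)
    obtain l where l: "m \<le> l" "m mod 2 = l mod 2" "\<mu> = robin_level \<sigma> l m"
      using x by (auto simp: desym_spectrum_eq[OF assms])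
    have "enum_spec \<sigma> (slot_index (l, m div 2)) = x"
      unfolding enum_spec_def slot_of(3)[OF slot_mode_surj(1)[OF l(1,2)]] using slot_mode_surj(2)[OF l(1,2)] l(3) by simp
    thus "x \<in> range (enum_spec \<sigma>)" by (metis rangeI)
  qed
qed

text \<open>Within a cluster the levels increase with \<open>m\<close>; for \<open>\<sigma> = 0\<close> they coincide. Thus one
  and the same enumeration orders the Robin spectrum and the Neumann spectrum, and the
  gaps compare the level in a slot with \<open>l (l + 1)\<close>.\<close>

lemma enum_spec_incseq:
  assumes "\<sigma> \<ge> 0"
  shows "incseq (snd \<circ> enum_spec \<sigma>)"
proof (rule incseq_SucI)
  fix n
  obtain l k where p: "slot_of n = (l, k)" by (cases "slot_of n")
  have s: "(l, k) \<in> slots" "slot_index (l, k) = n" using slot_of(1,2)[of n] p by auto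
  show "(snd \<circ> enum_spec \<sigma>) n \<le> (snd \<circ> enum_spec \<sigma>) (Suc n)"
  proof (cases "k < l div 2")
    case True
    hence s': "(l, Suc k) \<in> slots" by (simp add: slots_def)
    have "slot_index (l, Suc k) = Suc n" using s(2) by (simp add: slot_index_def)
    hence p': "slot_of (Suc n) = (l, Suc k)" using slot_of(3)[OF s'] by simp
    have le: "slot_mode (l, k) + 2 \<le> l" using slot_mode_props(1)[OF s'] by (simp add: slot_mode_def)
    have "robin_level \<sigma> l (slot_mode (l, k)) \<le> robin_level \<sigma> l (slot_mode (l, k) + 2)"
    proof (cases "\<sigma> = 0")
      case True thus ?thesis using le by (simp add: robin_level_0)
    next
      case False thus ?thesis using robin_level_strict_mono[OF _ le, of \<sigma>] assms by simp
    qed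
    thus ?thesis by (simp add: enum_spec_def p p' slot_mode_def)
  next
    case False
    hence k: "k = l div 2" using s(1) by (simp add: slots_def)
    have s': "(Suc l, 0) \<in> slots" by (simp add: slots_def)
    have "slot_index (Suc l, 0) = Suc n" using s(2) k by (simp add: slot_index_def cluster_start_def)
    hence p': "slot_of (Suc n) = (Suc l, 0)" using slot_of(3)[OF s'] by simp
    have "robin_level \<sigma> l (slot_mode (l, k)) \<le> robin_level \<sigma> (Suc l) (slot_mode (Suc l, 0))"
      using robin_level_bounds(2)[OF assms, of "slot_mode (l, k)" l] robin_level_bounds(1)[OF assms, of "slot_mode (Suc l, 0)" "Suc l"]
        slot_mode_props(1)[OF s(1)] slot_mode_props(1)[OF s'] by simp
    thus ?thesis by (simp add: enum_spec_def p p')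
  qed
qed

text \<open>The two enumerations differ by a permutation \<open>\<pi>\<close> of the indices. Among the \<open>n + 1\<close>
  values \<open>\<pi> 0, \<dots>, \<pi> n\<close> one is at least \<open>n\<close>, and monotonicity of both sequences finishes
  the comparison. By symmetry an increasing enumeration of a multiset of values is unique,
  which makes \<open>desym_eigenvalue\<close> well defined.\<close>

lemma sorted_enumeration_le:
  fixes e e' :: "nat \<Rightarrow> 'a \<times> 'b::linorder"
  assumes e: "bij_betw e UNIV P" "incseq (snd \<circ> e)" and e': "bij_betw e' UNIV P" "incseq (snd \<circ> e')"
  shows "(snd \<circ> e') n \<le> (snd \<circ> e) n"
proof -
  define \<pi> where "\<pi> = (\<lambda>i. inv_into UNIV e' (e i))"
  have \<pi>: "e' (\<pi> i) = e i" for i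
    unfolding \<pi>_def using e(1) e'(1) by (intro f_inv_into_f) (auto simp: bij_betw_def)
  have "inj \<pi>" using \<pi> e(1) unfolding bij_betw_def by (metis injD injI)
  have "\<exists>i\<le>n. n \<le> \<pi> i"
  proof (rule ccontr)
    assume "\<not> ?thesis"
    hence "\<pi> ` {..n} \<subseteq> {..<n}" by force
    hence "card (\<pi> ` {..n}) \<le> card {..<n}" by (intro card_mono) auto
    moreover have "card (\<pi> ` {..n}) = Suc n" using \<open>inj \<pi>\<close> by (subst card_image) (auto intro: inj_on_subset)
    ultimately show False by simp
  qed
  then obtain i where i: "i \<le> n" "n \<le> \<pi> i" by blast
  have "(snd \<circ> e') n \<le> (snd \<circ> e') (\<pi> i)" using e'(2) i(2) by (rule incseqD)
  also have "\<dots> = (snd \<circ> e) i" by (simp add: \<pi>)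
  also have "\<dots> \<le> (snd \<circ> e) n" using e(2) i(1) by (rule incseqD)
  finally show ?thesis .
qed

lemma desym_eigenvalue_slot_index:
  assumes "\<sigma> \<ge> 0" "p \<in> slots"
  shows "desym_eigenvalue \<sigma> (slot_index p) = robin_level \<sigma> (fst p) (slot_mode p)"
proof -
  have "desym_eigenvalue \<sigma> = snd \<circ> enum_spec \<sigma>"
    unfolding desym_eigenvalue_def
  proof (rule the_equality)
    show "incseq (snd \<circ> enum_spec \<sigma>) \<and> (\<exists>e. bij_betw e UNIV (desym_spectrum \<sigma>) \<and> snd \<circ> enum_spec \<sigma> = snd \<circ> e)"
      using enum_spec_bij[OF assms(1)] enum_spec_incseq[OF assms(1)] by blast
  next
    fix s assume "incseq s \<and> (\<exists>e. bij_betw e UNIV (desym_spectrum \<sigma>) \<and> s = snd \<circ> e)"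
    then obtain e where e: "incseq (snd \<circ> e)" "bij_betw e UNIV (desym_spectrum \<sigma>)" "s = snd \<circ> e" by blast
    show "s = snd \<circ> enum_spec \<sigma>" unfolding e(3)
      using sorted_enumeration_le[OF e(2,1) enum_spec_bij[OF assms(1)] enum_spec_incseq[OF assms(1)]]
        sorted_enumeration_le[OF enum_spec_bij[OF assms(1)] enum_spec_incseq[OF assms(1)] e(2,1)]
      by (intro ext antisym)
  qed
  thus ?thesis by (simp add: enum_spec_def slot_of(3)[OF assms(2)])
qed

lemma cluster_eq:
  assumes "\<sigma> > 0"
  shows "cluster l \<sigma> = (\<lambda>k. robin_level \<sigma> l (slot_mode (l, k))) ` {..l div 2}"
proof (intro set_eqI iffI)
  fix x assume "x \<in> cluster l \<sigma>"
  then obtain m where m: "m \<le> l" "m mod 2 = l mod 2" "x = Lam l m \<sigma>" unfolding cluster_def by blast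
  thus "x \<in> (\<lambda>k. robin_level \<sigma> l (slot_mode (l, k))) ` {..l div 2}"
    using slot_mode_surj[OF m(1,2)] Lam_eq_robin_level[OF assms m(1,2)] by (intro image_eqI[of _ _ "m div 2"]) (auto simp: slots_def)
next
  fix x assume "x \<in> (\<lambda>k. robin_level \<sigma> l (slot_mode (l, k))) ` {..l div 2}"
  then obtain k where k: "k \<le> l div 2" "x = robin_level \<sigma> l (slot_mode (l, k))" by auto
  have "slot_mode (l, k) \<le> l" "slot_mode (l, k) mod 2 = l mod 2" using slot_mode_props[of "(l, k)"] k by (auto simp: slots_def)
  thus "x \<in> cluster l \<sigma>" using Lam_eq_robin_level[OF assms, of "slot_mode (l, k)" l] k(2) unfolding cluster_def by (intro CollectI exI[of _ "slot_mode (l, k)"]) auto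
qed

lemma robin_level_mode_less:
  assumes "\<sigma> > 0" "k < k'" "k' \<le> l div 2"
  shows "robin_level \<sigma> l (slot_mode (l, k)) < robin_level \<sigma> l (slot_mode (l, k'))"
  using assms(2,3)
proof (induction k' rule: less_induct)
  case (less k')
  then obtain j where j: "k' = Suc j" by (cases k') auto
  have "slot_mode (l, k') \<le> l" using slot_mode_props(1)[of "(l, k')"] less.prems by (simp add: slots_def)
  hence "robin_level \<sigma> l (slot_mode (l, j)) < robin_level \<sigma> l (slot_mode (l, k'))"
    using robin_level_strict_mono[OF assms(1), of "slot_mode (l, j)" l] by (simp add: j slot_mode_def)
  thus ?case using less.IH[of j] less.prems j by (cases "k = j") auto
qed

lemma card_cluster:
  assumes "\<sigma> > 0"
  shows "card (cluster l \<sigma>) = l div 2 + 1"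
proof -
  have "inj_on (\<lambda>k. robin_level \<sigma> l (slot_mode (l, k))) {..l div 2}"
  proof (rule inj_onI)
    fix k k' assume *: "k \<in> {..l div 2}" "k' \<in> {..l div 2}" "robin_level \<sigma> l (slot_mode (l, k)) = robin_level \<sigma> l (slot_mode (l, k'))"
    show "k = k'" using robin_level_mode_less[OF assms, of k k' l] robin_level_mode_less[OF assms, of k' k l] *
      by (cases k k' rule: linorder_cases) auto
  qed
  thus ?thesis unfolding cluster_eq[OF assms] by (simp add: card_image)
qed

text \<open>The indices of cluster \<open>l\<close> are exactly its slots, and the Neumann eigenvalue in such
  a slot is \<open>l (l + 1)\<close>.\<close>

lemma sum_over_cluster:
  fixes f :: "real \<Rightarrow> complex"
  assumes "\<sigma> > 0"
  shows "(\<Sum>n | desym_eigenvalue \<sigma> n \<in> cluster l \<sigma>. f (RN_gap \<sigma> n)) 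
     = (\<Sum>k\<le>l div 2. f (robin_level \<sigma> l (slot_mode (l, k)) - real (l * (l + 1))))"
proof -
  have \<sigma>: "\<sigma> \<ge> 0" using assms by simp
  have slot: "(l, k) \<in> slots" if "k \<le> l div 2" for k using that by (simp add: slots_def)
  have "{n. desym_eigenvalue \<sigma> n \<in> cluster l \<sigma>} = (\<lambda>k. slot_index (l, k)) ` {..l div 2}"
  proof (intro set_eqI iffI)
    fix n assume "n \<in> {n. desym_eigenvalue \<sigma> n \<in> cluster l \<sigma>}"
    moreover obtain l' k' where p: "slot_of n = (l', k')" by (cases "slot_of n")
    have s: "(l', k') \<in> slots" "slot_index (l', k') = n" using slot_of(1,2)[of n] p by auto
    ultimately obtain k where k: "k \<le> l div 2" "robin_level \<sigma> l' (slot_mode (l', k')) = robin_level \<sigma> l (slot_mode (l, k))"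
      using desym_eigenvalue_slot_index[OF \<sigma> s(1)] unfolding cluster_eq[OF assms] by auto
    have "l' = l" using robin_level_determines_degree[OF \<sigma> _ _ k(2)] slot_mode_props(1)[OF s(1)] slot_mode_props(1)[OF slot[OF k(1)]] by simp
    thus "n \<in> (\<lambda>k. slot_index (l, k)) ` {..l div 2}" using s by (auto simp: slots_def)
  next
    fix n assume "n \<in> (\<lambda>k. slot_index (l, k)) ` {..l div 2}"
    thus "n \<in> {n. desym_eigenvalue \<sigma> n \<in> cluster l \<sigma>}"
      using desym_eigenvalue_slot_index[OF \<sigma> slot] unfolding cluster_eq[OF assms] by auto
  qed
  moreover have "inj_on (\<lambda>k. slot_index (l, k)) {..l div 2}" by (auto simp: inj_on_def slot_index_def)
  ultimately have "(\<Sum>n | desym_eigenvalue \<sigma> n \<in> cluster l \<sigma>. f (RN_gap \<sigma> n)) = (\<Sum>k\<le>l div 2. f (RN_gap \<sigma> (slot_index (l, k))))"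
    by (simp add: sum.reindex)
  also have "\<dots> = (\<Sum>k\<le>l div 2. f (robin_level \<sigma> l (slot_mode (l, k)) - real (l * (l + 1))))"
  proof (rule sum.cong[OF refl])
    fix k assume "k \<in> {..l div 2}"
    hence s: "(l, k) \<in> slots" by (simp add: slot)
    show "f (RN_gap \<sigma> (slot_index (l, k))) = f (robin_level \<sigma> l (slot_mode (l, k)) - real (l * (l + 1)))"
      using slot_mode_props(1)[OF s] unfolding RN_gap_def desym_eigenvalue_slot_index[OF \<sigma> s] desym_eigenvalue_slot_index[OF order_refl s]
      by (simp add: robin_level_0)
  qed
  finally show ?thesis .
qed

section \<open>Asymptotics of the gaps\<close>

lemma gamma_step_times_shift: "y > 0 \<Longrightarrow> gamma_step y * gamma_step (y + 1/2) = y"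
proof -
  assume y: "y > 0"
  have "Gamma (y + 1/2) > 0" "Gamma y > 0" using y by (auto intro!: Gamma_real_pos)
  moreover have "Gamma (y + 1) = y * Gamma y" using y by (intro Gamma_plus1) (auto elim!: nonpos_Ints_cases)
  ultimately show ?thesis unfolding gamma_step_def by (simp add: add_ac)
qed

text \<open>By monotonicity the square of \<open>gamma_step y\<close> lies between
  \<open>gamma_step (y - 1/2) * gamma_step y = y - 1/2\<close> and
  \<open>gamma_step y * gamma_step (y + 1/2) = y\<close>.\<close>

lemma gamma_step_bounds:
  assumes "y > 1/2"
  shows "sqrt (y - 1/2) \<le> gamma_step y" "gamma_step y \<le> sqrt y"
proof -
  have p: "gamma_step y > 0" using assms by (intro gamma_step_pos) auto
  have "gamma_step y * gamma_step y \<le> gamma_step y * gamma_step (y + 1/2)" using assms p by (intro mult_left_mono gamma_step_mono) auto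
  also have "\<dots> = y" using assms by (intro gamma_step_times_shift) auto
  finally show "gamma_step y \<le> sqrt y" using p by (intro real_le_rsqrt) (simp add: power2_eq_square)
  have "y - 1/2 = gamma_step (y - 1/2) * gamma_step (y - 1/2 + 1/2)" using assms by (intro gamma_step_times_shift[symmetric]) auto
  also have "\<dots> \<le> gamma_step y * gamma_step y" using assms p by (auto intro!: mult_right_mono gamma_step_mono)
  finally show "sqrt (y - 1/2) \<le> gamma_step y" using p by (intro real_le_lsqrt) (auto simp: power2_eq_square)
qed

lemma gamma_step_asymp: "((\<lambda>y. gamma_step y / sqrt y) \<longlongrightarrow> 1) at_top"
proof (rule tendsto_sandwich)
  show "((\<lambda>y::real. sqrt (y - 1/2) / sqrt y) \<longlongrightarrow> 1) at_top" by real_asymp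
  show "\<forall>\<^sub>F y in at_top. sqrt (y - 1/2) / sqrt y \<le> gamma_step y / sqrt y"
    using eventually_gt_at_top[of 1] by eventually_elim (auto intro!: divide_right_mono gamma_step_bounds)
  show "\<forall>\<^sub>F y in at_top. gamma_step y / sqrt y \<le> 1"
    using eventually_gt_at_top[of 1] by eventually_elim (use gamma_step_bounds(2) in auto)
qed auto

text \<open>Let \<open>x = \<nu> - l\<close>. The Gamma quotient is asymptotic to \<open>sqrt (l\<^sup>2 - m\<^sup>2) / 2\<close>, that
  is, to \<open>l sqrt (1 - t\<^sup>2) / 2\<close>. The secular equation then gives
  \<open>l sin (\<pi> x / 2) \<rightarrow> \<sigma> / sqrt (1 - t\<^sup>2)\<close>; in particular \<open>x\<close> tends to \<open>0\<close>, the sine may be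
  replaced by its argument, and the gap \<open>\<nu> (\<nu> + 1) - l (l + 1) = l x (2 + 1 / l + x / l)\<close>
  is asymptotic to \<open>2 l x\<close>.\<close>

lemma gap_limit:
  assumes \<sigma>: "\<sigma> > 0" and m: "\<And>l. m l \<le> l" and t: "0 \<le> t" "t < 1"
    and lim: "(\<lambda>l. real (m l) / real l) \<longlonglongrightarrow> t"
  shows "(\<lambda>l. robin_level \<sigma> l (m l) - real (l * (l + 1))) \<longlonglongrightarrow> 4 * \<sigma> / pi / sqrt (1 - t\<^sup>2)"
proof -
  define r where "r = (\<lambda>l. root_of \<sigma> l (m l))"
  define x where "x = (\<lambda>l. r l - real l)"
  have \<sigma>0: "\<sigma> \<ge> 0" using \<sigma> by simp
  note ro = root_of[OF \<sigma>0 m]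
  \<comment> \<open>\<open>x \<noteq> 0\<close> because \<open>\<sigma> > 0\<close>; this allows the limit of \<open>sin z / z\<close> to be used at \<open>z = \<pi> x / 2\<close>\<close>
  have r_ne: "r l \<noteq> real l" for l using ro(3)[of l] secular_left[of \<sigma> l "m l"] \<sigma> by (auto simp: r_def)
  have x0: "0 < x l" and x1: "x l < 1" for l using ro(1,2)[of l] r_ne[of l] by (auto simp: x_def r_def)
  have inv_l: "(\<lambda>l. 1 / real l) \<longlonglongrightarrow> 0" by real_asymp
  have ev1: "eventually (\<lambda>l::nat. l > 0) sequentially" by (rule eventually_gt_at_top)
  have x_over: "(\<lambda>l. x l / real l) \<longlonglongrightarrow> 0"
    by (rule tendsto_sandwich[OF _ _ tendsto_const inv_l])
       (auto intro!: always_eventually divide_right_mono divide_nonneg_nonneg less_imp_le[OF x0] less_imp_le[OF x1])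
  have r_over: "(\<lambda>l. r l / real l) \<longlonglongrightarrow> 1"
  proof (rule Lim_transform_eventually)
    show "(\<lambda>l. 1 + x l / real l) \<longlonglongrightarrow> 1" using tendsto_add[OF tendsto_const x_over, of 1] by simp
    show "\<forall>\<^sub>F l in sequentially. 1 + x l / real l = r l / real l"
      using ev1 by eventually_elim (auto simp: x_def field_simps)
  qed
  define y1 where "y1 = (\<lambda>l. (r l + real (m l) + 1) / 2)"
  define y2 where "y2 = (\<lambda>l. (r l - real (m l) + 1) / 2)"
  have y1_over: "(\<lambda>l. y1 l / real l) \<longlonglongrightarrow> (1 + t) / 2"
  proof -
    have "(\<lambda>l. (r l / real l + real (m l) / real l + 1 / real l) / 2) \<longlonglongrightarrow> (1 + t + 0) / 2"
      by (intro tendsto_intros r_over lim inv_l) auto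
    thus ?thesis by (simp add: y1_def add_divide_distrib mult.commute)
  qed
  have y2_over: "(\<lambda>l. y2 l / real l) \<longlonglongrightarrow> (1 - t) / 2"
  proof -
    have "(\<lambda>l. (r l / real l - real (m l) / real l + 1 / real l) / 2) \<longlonglongrightarrow> (1 - t + 0) / 2"
      by (intro tendsto_intros r_over lim inv_l) auto
    thus ?thesis by (simp add: y2_def add_divide_distrib diff_divide_distrib mult.commute)
  qed
  have to_top: "filterlim y at_top sequentially" if "(\<lambda>l. y l / real l) \<longlonglongrightarrow> c" "c > 0" for y c
  proof -
    have "filterlim (\<lambda>l. y l / real l * real l) at_top sequentially"
      by (rule filterlim_tendsto_pos_mult_at_top[OF that filterlim_real_sequentially])
    moreover have "\<forall>\<^sub>F l in sequentially. y l / real l * real l = y l"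
      using ev1 by eventually_elim auto
    ultimately show ?thesis using filterlim_cong[OF refl refl, of "\<lambda>l. y l / real l * real l" y sequentially at_top] by simp
  qed
  have y1_pos: "y1 l > 0" and y2_pos: "y2 l > 0" for l
    using ro(1)[of l] m[of l] by (auto simp: y1_def y2_def r_def)
  define g where "g = sqrt ((1 + t) / 2) * sqrt ((1 - t) / 2)"
  have g_eq: "g = sqrt (1 - t\<^sup>2) / 2"
  proof -
    have "g = sqrt ((1 - t\<^sup>2) / 4)" unfolding g_def real_sqrt_mult[symmetric]
      by (simp add: power2_eq_square algebra_simps)
    thus ?thesis by (simp add: real_sqrt_divide)
  qed
  have g_pos: "g > 0" unfolding g_def using t by (intro mult_pos_pos) auto
  have G_over: "(\<lambda>l. gamma_quot (m l) (r l) / real l) \<longlonglongrightarrow> g"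
  proof (rule Lim_transform_eventually)
    have "(\<lambda>l. gamma_step (y1 l) / sqrt (y1 l)) \<longlonglongrightarrow> 1" "(\<lambda>l. gamma_step (y2 l) / sqrt (y2 l)) \<longlonglongrightarrow> 1"
      using t by (auto intro!: filterlim_compose[OF gamma_step_asymp] to_top[OF y1_over] to_top[OF y2_over])
    from tendsto_mult[OF tendsto_mult[OF this] tendsto_mult[OF tendsto_real_sqrt[OF y1_over] tendsto_real_sqrt[OF y2_over]]]
    show "(\<lambda>l. gamma_step (y1 l) / sqrt (y1 l) * (gamma_step (y2 l) / sqrt (y2 l)) * (sqrt (y1 l / real l) * sqrt (y2 l / real l))) \<longlonglongrightarrow> g"
      by (simp add: g_def)
    show "\<forall>\<^sub>F l in sequentially. gamma_step (y1 l) / sqrt (y1 l) * (gamma_step (y2 l) / sqrt (y2 l)) * (sqrt (y1 l / real l) * sqrt (y2 l / real l)) = gamma_quot (m l) (r l) / real l"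
      using ev1
    proof eventually_elim
      case (elim l)
      have "gamma_quot (m l) (r l) = gamma_step (y1 l) * gamma_step (y2 l)" by (simp add: gamma_quot_eq_gamma_step y1_def y2_def)
      moreover have "sqrt (real l) * sqrt (real l) = real l" by simp
      ultimately show ?case using y1_pos[of l] y2_pos[of l] elim
        by (simp add: real_sqrt_divide field_simps)
    qed
  qed
  define s where "s = (\<lambda>l. sin (pi * x l / 2))"
  define cc where "cc = (\<lambda>l. cos (pi * x l / 2))"
  have ang: "0 < pi * x l / 2" "pi * x l / 2 < pi / 2" for l
    using quarter_turn[of "x l"] x0[of l] x1[of l] by auto
  have s_pos: "s l > 0" for l unfolding s_def using ang[of l] by (intro sin_gt_zero) auto
  have cc01: "0 \<le> cc l" "cc l \<le> 1" for l unfolding cc_def using ang[of l] by (intro cos_ge_zero, linarith, linarith) simp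
  have gamma_quot_pos': "gamma_quot (m l) (r l) > 0" for l using ro(1)[of l] m[of l] by (intro gamma_quot_pos) (simp add: r_def)
  have sec: "2 * (s l * gamma_quot (m l) (r l)) = \<sigma> * cc l" for l
    using ro(3)[of l] by (simp add: secular_def s_def cc_def x_def r_def)
  \<comment> \<open>the secular equation, solved for \<open>l sin (\<pi> x / 2)\<close>\<close>
  have ls: "\<forall>\<^sub>F l in sequentially. \<sigma> * cc l / (2 * (gamma_quot (m l) (r l) / real l)) = real l * s l"
    using ev1
  proof eventually_elim
    case (elim l)
    thus ?case using sec[of l] gamma_quot_pos'[of l] by (simp add: field_simps)
  qed
  have s_lim: "s \<longlonglongrightarrow> 0"
  proof (rule tendsto_sandwich)
    show "\<forall>\<^sub>F l in sequentially. 0 \<le> s l" by (intro always_eventually allI less_imp_le s_pos)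
    have "(\<lambda>l. \<sigma> / (2 * (gamma_quot (m l) (r l) / real l)) * (1 / real l)) \<longlonglongrightarrow> \<sigma> / (2 * g) * 0"
      using g_pos by (intro tendsto_intros G_over inv_l) auto
    thus "(\<lambda>l. \<sigma> / (2 * (gamma_quot (m l) (r l) / real l)) * (1 / real l)) \<longlonglongrightarrow> 0" by simp
    show "\<forall>\<^sub>F l in sequentially. s l \<le> \<sigma> / (2 * (gamma_quot (m l) (r l) / real l)) * (1 / real l)"
      using ev1
    proof eventually_elim
      case (elim l)
      have "2 * (s l * gamma_quot (m l) (r l)) \<le> \<sigma>" unfolding sec using mult_left_mono[OF cc01(2)[of l] \<sigma>0] by simp
      thus ?case using elim gamma_quot_pos'[of l] by (simp add: field_simps)
    qed
  qed simp
  have x_lim: "x \<longlonglongrightarrow> 0"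
  proof -
    have "(\<lambda>l. arcsin (s l)) \<longlonglongrightarrow> arcsin 0"
      by (rule isCont_tendsto_compose[OF isCont_arcsin s_lim]) auto
    moreover have "arcsin (s l) = pi * x l / 2" for l
      unfolding s_def using ang[of l] by (intro arcsin_sin; linarith)
    ultimately have "(\<lambda>l. pi * x l / 2) \<longlonglongrightarrow> 0" by simp
    from tendsto_mult_left[OF this, of "2 / pi"] show ?thesis by simp
  qed
  have a_lim: "(\<lambda>l. pi * x l / 2) \<longlonglongrightarrow> 0" using tendsto_mult_left[OF x_lim, of "pi / 2"] by simp
  have "cc \<longlonglongrightarrow> cos 0" unfolding cc_def by (intro tendsto_cos a_lim)
  hence cc_lim: "cc \<longlonglongrightarrow> 1" by simp
  have ls_lim: "(\<lambda>l. real l * s l) \<longlonglongrightarrow> \<sigma> * 1 / (2 * g)"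
  proof (rule Lim_transform_eventually[OF _ ls])
    show "(\<lambda>l. \<sigma> * cc l / (2 * (gamma_quot (m l) (r l) / real l))) \<longlonglongrightarrow> \<sigma> * 1 / (2 * g)"
      using g_pos by (intro tendsto_intros cc_lim G_over) simp
  qed
  have sinc: "(\<lambda>l. s l / (pi * x l / 2)) \<longlonglongrightarrow> 1"
  proof -
    have "((\<lambda>z::real. sin z / z) \<longlongrightarrow> 1) (at 0)" by real_asymp
    moreover have "filterlim (\<lambda>l. pi * x l / 2) (at 0) sequentially"
      using a_lim x0 by (intro filterlim_atI) (auto simp: less_imp_neq[symmetric])
    ultimately show ?thesis unfolding s_def by (rule filterlim_compose)
  qed
  have lx_lim: "(\<lambda>l. real l * x l) \<longlonglongrightarrow> \<sigma> / (pi * g)"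
  proof -
    have "(\<lambda>l. real l * s l / (s l / (pi * x l / 2)) * (2 / pi)) \<longlonglongrightarrow> \<sigma> * 1 / (2 * g) / 1 * (2 / pi)"
      by (intro tendsto_intros ls_lim sinc) auto
    moreover have "real l * s l / (s l / (pi * x l / 2)) * (2 / pi) = real l * x l" for l
      using s_pos[of l] x0[of l] by (simp add: field_simps)
    ultimately show ?thesis by (simp add: mult.commute)
  qed
  have "(\<lambda>l. real l * x l * (2 + 1 / real l + x l / real l)) \<longlonglongrightarrow> \<sigma> / (pi * g) * (2 + 0 + 0)"
    by (intro tendsto_intros lx_lim inv_l x_over)
  moreover have "\<forall>\<^sub>F l in sequentially. real l * x l * (2 + 1 / real l + x l / real l) = robin_level \<sigma> l (m l) - real (l * (l + 1))"
    using ev1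
  proof eventually_elim
    case (elim l)
    have "robin_level \<sigma> l (m l) = r l * (r l + 1)" by (simp add: robin_level_def r_def)
    moreover have "r l = real l + x l" by (simp add: x_def)
    ultimately have "robin_level \<sigma> l (m l) - real (l * (l + 1)) = x l * (2 * real l + 1 + x l)"
      by (simp add: algebra_simps)
    also have "\<dots> = real l * x l * (2 + 1 / real l + x l / real l)" using elim by (simp add: field_simps)
    finally show ?case ..
  qed
  ultimately have "(\<lambda>l. robin_level \<sigma> l (m l) - real (l * (l + 1))) \<longlonglongrightarrow> \<sigma> / (pi * g) * (2 + 0 + 0)"
    by (rule Lim_transform_eventually)
  thus ?thesis unfolding g_eq by (simp add: field_simps)
qed

section \<open>Averages over a cluster\<close>

lemma step_function_eq:
  fixes g :: "nat \<Rightarrow> complex"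
  assumes "N > 0"
  shows "indicator {0..<1} t *\<^sub>R g (nat \<lfloor>real N * t\<rfloor>)
     = (\<Sum>k<N. indicator {real k / real N..<(real k + 1) / real N} t *\<^sub>R g k)"
proof -
  have mem: "t \<in> {real k / real N..<(real k + 1) / real N} \<longleftrightarrow> \<lfloor>real N * t\<rfloor> = int k" for k
    using assms by (auto simp: floor_eq_iff field_simps)
  show ?thesis
  proof (cases "0 \<le> t \<and> t < 1")
    case True
    define k0 where "k0 = nat \<lfloor>real N * t\<rfloor>"
    have k0: "\<lfloor>real N * t\<rfloor> = int k0" using True by (simp add: k0_def)
    have "real N * t < real N" using True assms by simp
    hence "k0 < N" unfolding k0_def using True by (simp add: nat_less_iff floor_less_iff)
    have "(\<Sum>k<N. indicator {real k / real N..<(real k + 1) / real N} t *\<^sub>R g k) = (\<Sum>k<N. if k = k0 then g k else 0)"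
      by (intro sum.cong refl) (unfold indicator_def mem k0, auto)
    also have "\<dots> = g k0" using \<open>k0 < N\<close> by simp
    finally show ?thesis using True by (simp add: k0_def)
  next
    case False
    have "t \<notin> {real k / real N..<(real k + 1) / real N}" if "k < N" for k
    proof
      assume "t \<in> {real k / real N..<(real k + 1) / real N}"
      moreover have "(real k + 1) / real N \<le> 1" using that by simp
      moreover have "real k / real N \<ge> 0" by simp
      ultimately have "0 \<le> t" "t < 1" unfolding atLeastLessThan_iff by linarith+
      thus False using False by simp
    qed
    hence "(\<Sum>k<N. indicator {real k / real N..<(real k + 1) / real N} t *\<^sub>R g k) = (\<Sum>k<N. 0)"
      by (intro sum.cong refl) (simp add: indicator_def)
    thus ?thesis using False by simp
  qed
qed

text \<open>This turns the average over a cluster into an integral over the fixed interval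
  \<open>[0, 1)\<close>.\<close>

lemma step_function_integral:
  fixes g :: "nat \<Rightarrow> complex"
  assumes "N > 0"
  shows "(LINT t|lborel. indicator {0..<1} t *\<^sub>R g (nat \<lfloor>real N * t\<rfloor>)) = (\<Sum>k<N. g k) / of_nat N"
proof -
  have le: "real k / real N \<le> (real k + 1) / real N" for k by (simp add: divide_right_mono)
  have i: "integrable lborel (indicator {real k / real N..<(real k + 1) / real N} :: real \<Rightarrow> real)" for k
    using le[of k] by (intro integrable_real_indicator) (auto simp: emeasure_lborel_Ico)
  have m: "(LINT t|lborel. indicator {real k / real N..<(real k + 1) / real N} t *\<^sub>R g k) = g k / of_nat N" for k
  proof -
    have "(LINT t|lborel. indicator {real k / real N..<(real k + 1) / real N} t *\<^sub>R g k) = measure lborel {real k / real N..<(real k + 1) / real N} *\<^sub>R g k"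
      using i[of k] by simp
    also have "measure lborel {real k / real N..<(real k + 1) / real N} = 1 / real N"
      using le[of k] by (simp add: measure_def emeasure_lborel_Ico add_divide_distrib)
    finally show ?thesis by (simp add: scaleR_conv_of_real)
  qed
  show ?thesis unfolding step_function_eq[OF assms]
    by (subst Bochner_Integration.integral_sum) (use i m in \<open>auto simp: sum_divide_distrib intro!: integrable_scaleR_left\<close>)
qed

text \<open>The sectors of a cluster equidistribute: the sector in the slot at relative position
  \<open>t\<close> differs from \<open>l t\<close> by at most \<open>3\<close>.\<close>

lemma slot_mode_ratio_limit:
  assumes "0 \<le> t" "t < 1"
  shows "(\<lambda>l. real (slot_mode (l, nat \<lfloor>real (l div 2 + 1) * t\<rfloor>)) / real l) \<longlonglongrightarrow> t"
proof -
  have b: "\<bar>real (slot_mode (l, nat \<lfloor>real (l div 2 + 1) * t\<rfloor>)) - real l * t\<bar> \<le> 3" for l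
  proof -
    define N where "N = real (l div 2 + 1)"
    define k where "k = nat \<lfloor>N * t\<rfloor>"
    have "N * t \<ge> 0" using assms by (simp add: N_def)
    hence k: "real k \<le> N * t" "N * t < real k + 1" unfolding k_def by (auto simp: of_nat_nat)
    define P where "P = real (l mod 2)"
    have P: "P \<le> 1" "P \<ge> 0" by (auto simp: P_def)
    have "real l = 2 * real (l div 2) + real (l mod 2)"
      by (metis mult_div_mod_eq of_nat_add of_nat_mult of_nat_numeral)
    moreover have "real (l div 2) = N - 1" by (simp add: N_def)
    ultimately have N: "real l = 2 * N - 2 + P" by (simp only: P_def right_diff_distrib mult_1_right)
    have lt: "real l * t = 2 * (N * t) - 2 * t + P * t" unfolding N by (simp add: algebra_simps)
    have Pt: "0 \<le> P * t" "P * t \<le> 1 * 1" using assms P by (auto intro: mult_nonneg_nonneg mult_le_one)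
    have e: "real (l mod 2 + 2 * k) = P + 2 * real k" by (simp add: P_def)
    have "\<bar>real (l mod 2 + 2 * k) - real l * t\<bar> \<le> 3"
      unfolding lt e by (rule abs_leI) (use k P Pt assms in linarith)+
    thus ?thesis by (simp add: slot_mode_def k_def N_def)
  qed
  have scaled: "\<bar>M / L - t\<bar> = \<bar>M - L * t\<bar> / L" if "L > 0" for M L :: real
  proof -
    have "M / L - t = (M - L * t) / L" using that by (simp add: diff_divide_distrib)
    thus ?thesis using that by (simp add: abs_divide)
  qed
  have "(\<lambda>l. real (slot_mode (l, nat \<lfloor>real (l div 2 + 1) * t\<rfloor>)) / real l - t) \<longlonglongrightarrow> 0"
  proof (rule tendsto_rabs_zero_cancel, rule tendsto_sandwich[where f = "\<lambda>_. 0" and h = "\<lambda>l. 3 / real l"])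
    show "(\<lambda>l. 3 / real l) \<longlonglongrightarrow> 0" by real_asymp
    show "\<forall>\<^sub>F l in sequentially. \<bar>real (slot_mode (l, nat \<lfloor>real (l div 2 + 1) * t\<rfloor>)) / real l - t\<bar> \<le> 3 / real l"
      using eventually_gt_at_top[of 0]
    proof eventually_elim
      case (elim l)
      have "\<bar>real (slot_mode (l, nat \<lfloor>real (l div 2 + 1) * t\<rfloor>)) / real l - t\<bar> = \<bar>real (slot_mode (l, nat \<lfloor>real (l div 2 + 1) * t\<rfloor>)) - real l * t\<bar> / real l"
        by (rule scaled) (use elim in simp)
      thus ?case using b[of l] by (simp add: divide_right_mono)
    qed
  qed auto
  thus ?thesis by (simp add: LIM_zero_iff)
qed

text \<open>At each \<open>t < 1\<close> the integrands converge by the asymptotics of the gaps, and they are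
  dominated by a constant because \<open>f\<close> is bounded.\<close>

lemma average_limit:
  fixes f :: "real \<Rightarrow> complex"
  assumes \<sigma>: "\<sigma> > 0" and cont: "continuous_on UNIV f" and bdd: "\<And>y. norm (f y) \<le> B"
  shows "(\<lambda>l. (\<Sum>k\<le>l div 2. f (robin_level \<sigma> l (slot_mode (l, k)) - real (l * (l + 1)))) / of_nat (l div 2 + 1))
    \<longlonglongrightarrow> (LINT t|lborel. indicator {0..<1} t *\<^sub>R f (4 * \<sigma> / pi / sqrt (1 - t\<^sup>2)))"
proof -
  define d where "d = (\<lambda>l k. f (robin_level \<sigma> l (slot_mode (l, k)) - real (l * (l + 1))))"
  have f_meas [measurable]: "f \<in> borel_measurable borel" by (rule borel_measurable_continuous_onI[OF cont])
  have "(\<lambda>l. LINT t|lborel. indicator {0..<1} t *\<^sub>R d l (nat \<lfloor>real (l div 2 + 1) * t\<rfloor>))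
      \<longlonglongrightarrow> (LINT t|lborel. indicator {0..<1} t *\<^sub>R f (4 * \<sigma> / pi / sqrt (1 - t\<^sup>2)))"
  proof (rule integral_dominated_convergence[where w = "\<lambda>t. indicator {0..<1} t * B"])
    show "(\<lambda>t. indicator {0..<1} t *\<^sub>R f (4 * \<sigma> / pi / sqrt (1 - t\<^sup>2))) \<in> borel_measurable lborel" by measurable
    show "(\<lambda>t. indicator {0..<1} t *\<^sub>R d l (nat \<lfloor>real (l div 2 + 1) * t\<rfloor>)) \<in> borel_measurable lborel" for l
      by (subst step_function_eq) auto
    show "integrable lborel (\<lambda>t::real. indicator {0..<1} t * B :: real)"
      by (intro integrable_mult_left integrable_real_indicator) (auto simp: emeasure_lborel_Ico)
    show "AE t in lborel. norm (indicator {0..<1} t *\<^sub>R d l (nat \<lfloor>real (l div 2 + 1) * t\<rfloor>)) \<le> indicator {0..<1} t * B" for l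
      using bdd by (auto simp: indicator_def d_def)
    show "AE t in lborel. (\<lambda>l. indicator {0..<1} t *\<^sub>R d l (nat \<lfloor>real (l div 2 + 1) * t\<rfloor>)) \<longlonglongrightarrow> indicator {0..<1} t *\<^sub>R f (4 * \<sigma> / pi / sqrt (1 - t\<^sup>2))"
    proof (rule AE_I2)
      fix t :: real
      show "(\<lambda>l. indicator {0..<1} t *\<^sub>R d l (nat \<lfloor>real (l div 2 + 1) * t\<rfloor>)) \<longlonglongrightarrow> indicator {0..<1} t *\<^sub>R f (4 * \<sigma> / pi / sqrt (1 - t\<^sup>2))"
      proof (cases "0 \<le> t \<and> t < 1")
        case True
        have m: "slot_mode (l, nat \<lfloor>real (l div 2 + 1) * t\<rfloor>) \<le> l" for l
        proof -
          have "real (l div 2 + 1) * t < real (l div 2 + 1)" using True by simp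
          hence "\<lfloor>real (l div 2 + 1) * t\<rfloor> < int (l div 2 + 1)" by (simp add: floor_less_iff)
          hence "nat \<lfloor>real (l div 2 + 1) * t\<rfloor> \<le> l div 2" by linarith
          thus ?thesis using slot_mode_props(1)[of "(l, nat \<lfloor>real (l div 2 + 1) * t\<rfloor>)"] by (simp add: slots_def)
        qed
        have "(\<lambda>l. d l (nat \<lfloor>real (l div 2 + 1) * t\<rfloor>)) \<longlonglongrightarrow> f (4 * \<sigma> / pi / sqrt (1 - t\<^sup>2))"
          unfolding d_def using cont True
          by (intro isCont_tendsto_compose[of _ f] gap_limit \<sigma> m slot_mode_ratio_limit) (auto simp: continuous_on_eq_continuous_at)
        thus ?thesis using True by simp
      qed auto
    qed
  qed
  moreover have "(LINT t|lborel. indicator {0..<1} t *\<^sub>R d l (nat \<lfloor>real (l div 2 + 1) * t\<rfloor>)) = (\<Sum>k\<le>l div 2. d l k) / of_nat (l div 2 + 1)" for l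
    using step_function_integral[of "l div 2 + 1" "d l"] by (simp add: lessThan_Suc_atMost)
  ultimately show ?thesis unfolding d_def by simp
qed

text \<open>The substitution \<open>t = sqrt (1 - (c / y)\<^sup>2)\<close>, the inverse of
  \<open>y = c / sqrt (1 - t\<^sup>2)\<close>, maps \<open>(c, \<infinity>)\<close> onto \<open>(0, 1)\<close>. The weight on the right is its
  derivative.\<close>

lemma gap_density_substitution:
  fixes f :: "real \<Rightarrow> complex"
  assumes c: "c > 0" and cont: "continuous_on UNIV f" and bdd: "\<And>y. norm (f y) \<le> B"
  shows "(LINT t|lborel. indicator {0..<1} t *\<^sub>R f (c / sqrt (1 - t\<^sup>2)))
    = (LINT y:{c<..}|lborel. f y * of_real (c\<^sup>2 / (y ^ 3 * sqrt (1 - (c / y)\<^sup>2))))"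
proof -
  have f_meas [measurable]: "f \<in> borel_measurable borel" by (rule borel_measurable_continuous_onI[OF cont])
  define F where "F = (\<lambda>t. f (c / sqrt (1 - t\<^sup>2)))"
  define g where "g = (\<lambda>y. sqrt (1 - (c / y)\<^sup>2))"
  define h where "h = (\<lambda>y. c\<^sup>2 / (y ^ 3 * sqrt (1 - (c / y)\<^sup>2)))"
  have rad: "0 < 1 - (c / y)\<^sup>2" "1 - (c / y)\<^sup>2 < 1" if "y > c" for y
  proof -
    have "0 < c / y" "c / y < 1" using that c by auto
    thus "0 < 1 - (c / y)\<^sup>2" "1 - (c / y)\<^sup>2 < 1" using abs_square_less_1[of "c / y"] by (simp, metis diff_less_eq less_add_same_cancel1 zero_less_power)
  qed
  have der: "(g has_real_derivative h y) (at y within {c<..})" if "y \<in> {c<..}" for y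
  proof -
    have y: "y > c" using that by simp
    have "(g has_real_derivative h y) (at y)" unfolding g_def h_def using rad[OF y] y c
      by (auto intro!: derivative_eq_intros simp: field_simps power2_eq_square power3_eq_cube)
    thus ?thesis by (rule DERIV_subset) auto
  qed
  have inv: "c / sqrt (1 - (g y)\<^sup>2) = y" if "y > c" for y
  proof -
    have "(g y)\<^sup>2 = 1 - (c / y)\<^sup>2" unfolding g_def using rad[OF that] by simp
    thus ?thesis using that c by (simp add: real_sqrt_abs)
  qed
  have inj: "inj_on g {c<..}" by (rule inj_onI) (metis inv greaterThan_iff)
  have img: "g ` {c<..} = {0<..<1}"
  proof (intro set_eqI iffI)
    fix t assume "t \<in> g ` {c<..}"
    thus "t \<in> {0<..<1}" using rad by (auto simp: g_def)
  next
    fix t :: real assume t: "t \<in> {0<..<1}"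
    hence t2: "0 < 1 - t\<^sup>2" "1 - t\<^sup>2 < 1" by (auto simp: abs_square_less_1 power_less_one_iff)
    define y where "y = c / sqrt (1 - t\<^sup>2)"
    have "sqrt (1 - t\<^sup>2) < 1" using t2 by simp
    hence "y > c" using c t2 by (simp add: y_def field_simps)
    moreover have "g y = t" using t t2 c by (simp add: g_def y_def power_divide)
    ultimately show "t \<in> g ` {c<..}" by (intro image_eqI[of _ _ y]) auto
  qed
  have F_meas: "F \<in> borel_measurable borel" unfolding F_def by measurable
  have F_int: "set_integrable lborel {0<..<1} F"
    unfolding set_integrable_def
  proof (rule Bochner_Integration.integrable_bound)
    show "integrable lborel (\<lambda>t::real. indicator {0<..<1} t * B :: real)"
      by (intro integrable_mult_left integrable_real_indicator) auto
    show "(\<lambda>t. indicator {0<..<1} t *\<^sub>R F t) \<in> borel_measurable lborel" using F_meas by measurable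
    show "AE t in lborel. norm (indicator {0<..<1} t *\<^sub>R F t) \<le> norm (indicator {0<..<1} t * B :: real)"
      using bdd order_trans[OF norm_ge_zero bdd] by (auto simp: indicator_def F_def)
  qed
  have "F absolutely_integrable_on {0<..<1}"
    using F_int unfolding set_integrable_def by (simp add: integrable_completion F_meas)
  with has_absolute_integral_change_of_variables_real[of "{c<..}" g h F "integral {0<..<1} F", OF _ der inj]
  have A: "(\<lambda>y. \<bar>h y\<bar> *\<^sub>R F (g y)) absolutely_integrable_on {c<..}" "integral {c<..} (\<lambda>y. \<bar>h y\<bar> *\<^sub>R F (g y)) = integral {0<..<1} F"
    unfolding img by auto
  have W: "indicator {c<..} y *\<^sub>R (\<bar>h y\<bar> *\<^sub>R F (g y)) = indicator {c<..} y *\<^sub>R (f y * of_real (h y))" for y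
  proof (cases "y > c")
    case True
    have "h y \<ge> 0" unfolding h_def using rad[OF True] True c by (intro divide_nonneg_nonneg mult_nonneg_nonneg) auto
    thus ?thesis using inv[OF True] by (simp add: F_def scaleR_conv_of_real mult.commute)
  qed auto
  \<comment> \<open>the image of the substitution misses the null set \<open>{0}\<close>\<close>
  have "(LINT t|lborel. indicator {0..<1} t *\<^sub>R F t) = (LINT t|lborel. indicator {0<..<1} t *\<^sub>R F t)"
  proof (rule integral_cong_AE)
    have "AE t in lborel. t \<noteq> (0::real)" by (rule AE_lborel_singleton)
    thus "AE t in lborel. indicator {0..<1} t *\<^sub>R F t = indicator {0<..<1} t *\<^sub>R F t"
      by eventually_elim (auto simp: indicator_def)
  qed (use F_meas in measurable)
  also have "\<dots> = integral {0<..<1} F"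
    using set_borel_integral_eq_integral(2)[OF F_int] by (simp add: set_lebesgue_integral_def)
  also have "\<dots> = (LINT y:{c<..}|lebesgue. \<bar>h y\<bar> *\<^sub>R F (g y))"
    using set_lebesgue_integral_eq_integral(2)[OF A(1)] A(2) by simp
  also have "\<dots> = (LINT y|lebesgue. indicator {c<..} y *\<^sub>R (f y * of_real (h y)))"
    unfolding set_lebesgue_integral_def W ..
  also have "\<dots> = (LINT y|lborel. indicator {c<..} y *\<^sub>R (f y * of_real (h y)))"
    by (rule integral_completion) (unfold h_def, measurable)
  finally show ?thesis unfolding F_def h_def set_lebesgue_integral_def .
qed

lemma test_function_continuous: "test_function f \<Longrightarrow> continuous_on UNIV f"
  unfolding test_function_def by (intro differentiable_imp_continuous_on) (metis funpow_0)

lemma test_function_bounded: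
  assumes "test_function f" obtains B where "\<And>y. norm (f y) \<le> B"
proof -
  let ?K = "closure {x. f x \<noteq> 0}"
  have "compact (f ` ?K)"
    using assms test_function_continuous[OF assms] unfolding test_function_def
    by (intro compact_continuous_image) (auto intro: continuous_on_subset)
  hence "bounded (f ` ?K)" by (rule compact_imp_bounded)
  then obtain B where B: "\<forall>z\<in>f ` ?K. norm z \<le> B" unfolding bounded_iff by blast
  have "norm (f y) \<le> max B 0" for y
  proof (cases "f y = 0")
    case False
    hence "y \<in> {x. f x \<noteq> 0}" by simp
    hence "y \<in> ?K" by (rule subsetD[OF closure_subset])
    hence "norm (f y) \<le> B" using B by blast
    thus ?thesis by simp
  qed auto
  thus ?thesis by (rule that)
qed

theorem corollary1p2:
  fixes \<sigma> :: real and f :: "real \<Rightarrow> complex"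
  assumes "\<sigma> > 0" and "test_function f"
  shows "(\<lambda>l. (\<Sum>n | desym_eigenvalue \<sigma> n \<in> cluster l \<sigma>. f (RN_gap \<sigma> n))
                / of_nat (card (cluster l \<sigma>)))
         \<longlonglongrightarrow>
         (LINT y:{4 * \<sigma> / pi<..}|lborel.
            f y * of_real (16 * \<sigma>\<^sup>2 / (pi\<^sup>2 * y ^ 3 * sqrt (1 - (4 * \<sigma> / (pi * y))\<^sup>2))))"
proof -
  obtain B where B: "\<And>y. norm (f y) \<le> B" using test_function_bounded[OF assms(2)] by blast
  note cont = test_function_continuous[OF assms(2)]
  define c where "c = 4 * \<sigma> / pi"
  have c: "c > 0" using assms by (simp add: c_def)
  have w: "c\<^sup>2 / (y ^ 3 * sqrt (1 - (c / y)\<^sup>2)) = 16 * \<sigma>\<^sup>2 / (pi\<^sup>2 * y ^ 3 * sqrt (1 - (4 * \<sigma> / (pi * y))\<^sup>2))" for y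
    by (simp add: c_def power_divide power_mult_distrib)
  have "(\<lambda>l. (\<Sum>n | desym_eigenvalue \<sigma> n \<in> cluster l \<sigma>. f (RN_gap \<sigma> n)) / of_nat (card (cluster l \<sigma>)))
      \<longlonglongrightarrow> (LINT t|lborel. indicator {0..<1} t *\<^sub>R f (c / sqrt (1 - t\<^sup>2)))"
    unfolding sum_over_cluster[OF assms(1)] card_cluster[OF assms(1)] c_def
    by (rule average_limit[OF assms(1) cont B])
  thus ?thesis unfolding gap_density_substitution[OF c cont B] w by (simp add: c_def)
qed

end
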